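(* Assume that $\tau$ is in the limit circle case at $a$ and in the limit point case at $b$. If $\alpha\in(0,\pi)$, then $T_0$ and $T_\alpha$ are relatively prime with respect to $T_{min}$. Moreover, for each $z\in\rho(T_0)\cap\rho(T_\alpha)$, the scalar $$k_\alpha(z)=-\cot(\alpha)-\widetilde\psi^{\,\prime}(z,a)$$ is nonzero and $$(T_\alpha-zI_{L^2_r((a,b))})^{-1}=(T_0-zI_{L^2_r((a,b))})^{-1}+k_\alpha(z)^{-1}(\psi(\overline z,\cdot),\cdot)_{L^2_r((a,b))}\psi(z,\cdot).$$
   Context: Let $(a,b)\subseteq\mathbb R$ (possibly unbounded) and let $p,q,r$ be Lebesgue measurable functions on $(a,b)$ with $r>0$ a.e., $r\in L^1_{loc}((a,b))$; $p>0$ a.e., $1/p\in L^1_{loc}((a,b))$; $q$ real-valued a.e., $q\in L^1_{loc}((a,b))$. Put $\tau f=\frac1r\big[-(pf')'+qf\big]$, $f^{[1]}=pf'$, and $W(f,g)(x)=f(x)g^{[1]}(x)-f^{[1]}(x)g(x)$. Let $L^2_r((a,b))=L^2((a,b);r\,dx)$ with inner product $(\cdot,\cdot)_{L^2_r((a,b))}$ linear in the second argument. The maximal operator is $T_{max}f=\tau f$ with $\mathrm{dom}(T_{max})=\{g\in L^2_r((a,b)) : g,g^{[1]}\in AC_{loc}((a,b)),\ \tau g\in L^2_r((a,b))\}$. The minimal operator $T_{min}$ is the closure of the restriction of $T_{max}$ to those $g\in\mathrm{dom}(T_{max})$ with compact support in $(a,b)$. For $f,g\in\mathrm{dom}(T_{max})$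 the limits $W(f,g)(a)=\lim_{x\downarrow a}W(f,g)(x)$ and $W(f,g)(b)=\lim_{x\uparrow b}W(f,g)(x)$ exist. $\tau$ is in the limit circle case at an endpoint if for every $z\in\mathbb C$ all solutions of $\tau u=zu$ are in $L^2_r$ near that endpoint; otherwise it is in the limit point case there. Generalized boundary values at $a$: fix real-valued $v_1,v_2\in\mathrm{dom}(T_{max})$ with $W(v_1,v_2)(a)=1$ and, for $g\in\mathrm{dom}(T_{max})$, set $\widetilde g(a)=-W(v_2,g)(a)$ and $\widetilde g^{\,\prime}(a)=W(v_1,g)(a)$. (If $T_{min}$ is bounded from below one takes $v_1,v_2$ equal near $a$ to a nonprincipal solution $\widehat u_a(\lambda_0,\cdot)$ and a principal solution $u_a(\lambda_0,\cdot)$ of $\tau u=\lambda_0u$ with $W(\widehat u_a,u_a)=1$, $\lambda_0\in\mathbb R$.) For $\alpha\in[0,\pi)$, $T_\alpha$ denotes the self-adjoint extension of $T_{min}$ given by restricting $T_{max}$ to $\mathrm{dom}(T_\alpha)=\{g\in\mathrm{dom}(T_{max}) : \cos(\alpha)\widetilde g(a)+\sin(\alpha)\widetilde g^{\,\prime}(a)=0\}$; in particular $\mathrm{dom}(T_0)=\{g\in\mathrm{dom}(T_{max}):\widetilde g(a)=0\}$. For $z\in\rho(T_0)$, $\psi(z,\cdot)$ is the unique solution of $\tau y=zy$ with $\psi(z,\cdot)\in L^2_r((a,b))$ and $\widetilde\psi(z,a)=1$; $\widetilde\psi^{\,\prime}(z,a)$ is its second generalized boundary value at $a$. If $T,T'$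 are self-adjoint extensions of a symmetric operator $S$, their maximal common part is the operator $C_{T,T'}u=Tu$ with domain $\{f\in\mathrm{dom}(T)\cap\mathrm{dom}(T') : Tf=T'f\}$; $T$ and $T'$ are relatively prime with respect to $S$ if $C_{T,T'}=S$. The symbol $(f,\cdot)_{L^2_r((a,b))}\,h$ denotes the rank-one operator $g\mapsto(f,g)_{L^2_r((a,b))}h$. *)

theory Defs
  imports "HOL-Analysis.Analysis"
begin

text \<open>
  Vectors are classes of almost everywhere equal square-integrable functions. An operator is
  identified with its graph, a set of pairs of classes, so that the inverse of an operator is the
  converse relation and an extension is a superset.
\<close>

type_synonym 'a l2 = "('a \<Rightarrow> complex) set"
type_synonym 'a l2_op = "('a l2 \<times> 'a l2) set"

definition sq_integrable :: "'a measure \<Rightarrow> ('a \<Rightarrow> complex) \<Rightarrow> bool" where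
  "sq_integrable M f \<longleftrightarrow> f \<in> borel_measurable M \<and> integrable M (\<lambda>x. (cmod (f x))\<^sup>2)"

definition l2_class :: "'a measure \<Rightarrow> ('a \<Rightarrow> complex) \<Rightarrow> 'a l2" where
  "l2_class M f = {g. sq_integrable M g \<and> (AE x in M. g x = f x)}"

definition L2 :: "'a measure \<Rightarrow> 'a l2 set" where
  "L2 M = {l2_class M f | f. sq_integrable M f}"

definition l2_rep :: "'a l2 \<Rightarrow> 'a \<Rightarrow> complex" where
  "l2_rep u = (SOME f. f \<in> u)"

definition l2_add :: "'a measure \<Rightarrow> 'a l2 \<Rightarrow> 'a l2 \<Rightarrow> 'a l2" where
  "l2_add M u v = l2_class M (\<lambda>x. l2_rep u x + l2_rep v x)"

definition l2_scale :: "'a measure \<Rightarrow> complex \<Rightarrow> 'a l2 \<Rightarrow> 'a l2" where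
  "l2_scale M c u = l2_class M (\<lambda>x. c * l2_rep u x)"

definition l2_diff :: "'a measure \<Rightarrow> 'a l2 \<Rightarrow> 'a l2 \<Rightarrow> 'a l2" where
  "l2_diff M u v = l2_class M (\<lambda>x. l2_rep u x - l2_rep v x)"

definition l2_inner :: "'a measure \<Rightarrow> 'a l2 \<Rightarrow> 'a l2 \<Rightarrow> complex" where
  "l2_inner M u v = (\<integral>x. cnj (l2_rep u x) * l2_rep v x \<partial>M)"

definition l2_norm :: "'a measure \<Rightarrow> 'a l2 \<Rightarrow> real" where
  "l2_norm M u = sqrt (Re (l2_inner M u u))"

definition linear_operator :: "'a measure \<Rightarrow> 'a l2_op \<Rightarrow> bool" where
  "linear_operator M T \<longleftrightarrow>
     T \<subseteq> L2 M \<times> L2 M \<and> single_valued T \<and> T \<noteq> {} \<and>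
     (\<forall>u v u' v'. (u, v) \<in> T \<longrightarrow> (u', v') \<in> T \<longrightarrow> (l2_add M u u', l2_add M v v') \<in> T) \<and>
     (\<forall>c u v. (u, v) \<in> T \<longrightarrow> (l2_scale M c u, l2_scale M c v) \<in> T)"

definition densely_defined :: "'a measure \<Rightarrow> 'a l2_op \<Rightarrow> bool" where
  "densely_defined M T \<longleftrightarrow> (\<forall>u\<in>L2 M. \<forall>e>0. \<exists>v\<in>Domain T. l2_norm M (l2_diff M v u) < e)"

definition op_closure :: "'a measure \<Rightarrow> 'a l2_op \<Rightarrow> 'a l2_op" where
  "op_closure M T = {(u, v). u \<in> L2 M \<and> v \<in> L2 M \<and>
     (\<exists>f g. (\<forall>n::nat. (f n, g n) \<in> T) \<and>
        (\<lambda>n. l2_norm M (l2_diff M (f n) u)) \<longlonglongrightarrow> 0 \<and>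
        (\<lambda>n. l2_norm M (l2_diff M (g n) v)) \<longlonglongrightarrow> 0)}"

definition op_adjoint :: "'a measure \<Rightarrow> 'a l2_op \<Rightarrow> 'a l2_op" where
  "op_adjoint M T = {(u, w). u \<in> L2 M \<and> w \<in> L2 M \<and>
     (\<forall>(f, g)\<in>T. l2_inner M u g = l2_inner M w f)}"

definition symmetric_operator :: "'a measure \<Rightarrow> 'a l2_op \<Rightarrow> bool" where
  "symmetric_operator M T \<longleftrightarrow>
     linear_operator M T \<and> densely_defined M T \<and> T \<subseteq> op_adjoint M T"

definition self_adjoint :: "'a measure \<Rightarrow> 'a l2_op \<Rightarrow> bool" where
  "self_adjoint M T \<longleftrightarrow>
     linear_operator M T \<and> densely_defined M T \<and> op_adjoint M T = T"

definition op_minus_scalar :: "'a measure \<Rightarrow> 'a l2_op \<Rightarrow> complex \<Rightarrow> 'a l2_op" where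
  "op_minus_scalar M T z = {(u, l2_diff M v (l2_scale M z u)) | u v. (u, v) \<in> T}"

definition resolvent :: "'a measure \<Rightarrow> 'a l2_op \<Rightarrow> complex \<Rightarrow> 'a l2_op" where
  "resolvent M T z = (op_minus_scalar M T z)\<inverse>"

definition resolvent_set :: "'a measure \<Rightarrow> 'a l2_op \<Rightarrow> complex set" where
  "resolvent_set M T = {z. single_valued (resolvent M T z) \<and> Domain (resolvent M T z) = L2 M \<and>
     (\<exists>C. \<forall>(g, f)\<in>resolvent M T z. l2_norm M f \<le> C * l2_norm M g)}"

definition op_add :: "'a measure \<Rightarrow> 'a l2_op \<Rightarrow> 'a l2_op \<Rightarrow> 'a l2_op" where
  "op_add M A B = {(g, l2_add M u v) | g u v. (g, u) \<in> A \<and> (g, v) \<in> B}"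

definition op_scale :: "'a measure \<Rightarrow> complex \<Rightarrow> 'a l2_op \<Rightarrow> 'a l2_op" where
  "op_scale M c A = {(g, l2_scale M c u) | g u. (g, u) \<in> A}"

definition rank_one :: "'a measure \<Rightarrow> 'a l2 \<Rightarrow> 'a l2 \<Rightarrow> 'a l2_op" where
  "rank_one M f h = {(g, l2_scale M (l2_inner M f g) h) | g. g \<in> L2 M}"

definition common_part :: "'a l2_op \<Rightarrow> 'a l2_op \<Rightarrow> 'a l2_op" where
  "common_part T T' = {(u, v). u \<in> Domain T \<inter> Domain T' \<and> (u, v) \<in> T \<and> (u, v) \<in> T'}"

text \<open>Being relatively prime is a property of two self-adjoint extensions of a symmetric
  operator; this is made part of the definition.\<close>

definition relatively_prime :: "'a measure \<Rightarrow> 'a l2_op \<Rightarrow> 'a l2_op \<Rightarrow> 'a l2_op \<Rightarrow> bool" where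
  "relatively_prime M S T T' \<longleftrightarrow>
     symmetric_operator M S \<and>
     self_adjoint M T \<and> S \<subseteq> T \<and> self_adjoint M T' \<and> S \<subseteq> T' \<and>
     common_part T T' = S"

definition loc_integrable :: "ereal \<Rightarrow> ereal \<Rightarrow> (real \<Rightarrow> real) \<Rightarrow> bool" where
  "loc_integrable a b f \<longleftrightarrow> (\<forall>K. compact K \<and> K \<subseteq> einterval a b \<longrightarrow> set_integrable lebesgue K f)"

definition abs_cont_on :: "real \<Rightarrow> real \<Rightarrow> (real \<Rightarrow> complex) \<Rightarrow> bool" where
  "abs_cont_on c d f \<longleftrightarrow> (\<forall>e>0. \<exists>\<delta>>0. \<forall>D. D division_of \<Union>D \<and> \<Union>D \<subseteq> {c..d} \<and>
     (\<Sum>K\<in>D. Sup K - Inf K) < \<delta> \<longrightarrow> (\<Sum>K\<in>D. cmod (f (Sup K) - f (Inf K))) < e)"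

definition AC_loc :: "ereal \<Rightarrow> ereal \<Rightarrow> (real \<Rightarrow> complex) \<Rightarrow> bool" where
  "AC_loc a b f \<longleftrightarrow> (\<forall>c d. c \<le> d \<and> {c..d} \<subseteq> einterval a b \<longrightarrow> abs_cont_on c d f)"

definition sl_coefficients ::
    "ereal \<Rightarrow> ereal \<Rightarrow> (real \<Rightarrow> real) \<Rightarrow> (real \<Rightarrow> real) \<Rightarrow> (real \<Rightarrow> real) \<Rightarrow> bool" where
  "sl_coefficients a b p q r \<longleftrightarrow>
     p \<in> borel_measurable (lebesgue_on (einterval a b)) \<and>
     q \<in> borel_measurable (lebesgue_on (einterval a b)) \<and>
     r \<in> borel_measurable (lebesgue_on (einterval a b)) \<and>
     (AE x in lebesgue_on (einterval a b). 0 < r x) \<and> loc_integrable a b r \<and>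
     (AE x in lebesgue_on (einterval a b). 0 < p x) \<and> loc_integrable a b (\<lambda>x. 1 / p x) \<and>
     loc_integrable a b q"

definition sl_measure :: "ereal \<Rightarrow> ereal \<Rightarrow> (real \<Rightarrow> real) \<Rightarrow> real measure" where
  "sl_measure a b r = density (lebesgue_on (einterval a b)) (\<lambda>x. ennreal (r x))"

text \<open>The product of \<open>p\<close> and the derivative of \<open>f\<close> is only determined almost everywhere. That it is
  locally absolutely continuous means that it has a locally absolutely continuous
  representative, which is then unique on the interval and gives the quasi-derivative its
  pointwise values.\<close>

definition is_qderiv ::
    "ereal \<Rightarrow> ereal \<Rightarrow> (real \<Rightarrow> real) \<Rightarrow> (real \<Rightarrow> complex) \<Rightarrow> (real \<Rightarrow> complex) \<Rightarrow> bool" where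
  "is_qderiv a b p f h \<longleftrightarrow> AC_loc a b h \<and>
     (AE x in lebesgue_on (einterval a b). h x = p x *\<^sub>R vector_derivative f (at x))"

definition qderiv ::
    "ereal \<Rightarrow> ereal \<Rightarrow> (real \<Rightarrow> real) \<Rightarrow> (real \<Rightarrow> complex) \<Rightarrow> real \<Rightarrow> complex" where
  "qderiv a b p f = (SOME h. is_qderiv a b p f h)"

definition sl_regular :: "ereal \<Rightarrow> ereal \<Rightarrow> (real \<Rightarrow> real) \<Rightarrow> (real \<Rightarrow> complex) \<Rightarrow> bool" where
  "sl_regular a b p f \<longleftrightarrow> AC_loc a b f \<and> (\<exists>h. is_qderiv a b p f h)"

definition sl_expr :: "ereal \<Rightarrow> ereal \<Rightarrow> (real \<Rightarrow> real) \<Rightarrow> (real \<Rightarrow> real) \<Rightarrow> (real \<Rightarrow> real) \<Rightarrow>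
    (real \<Rightarrow> complex) \<Rightarrow> real \<Rightarrow> complex" where
  "sl_expr a b p q r f x =
     (1 / r x) *\<^sub>R (- vector_derivative (qderiv a b p f) (at x) + q x *\<^sub>R f x)"

definition sl_solution :: "ereal \<Rightarrow> ereal \<Rightarrow> (real \<Rightarrow> real) \<Rightarrow> (real \<Rightarrow> real) \<Rightarrow> (real \<Rightarrow> real) \<Rightarrow>
    complex \<Rightarrow> (real \<Rightarrow> complex) \<Rightarrow> bool" where
  "sl_solution a b p q r z u \<longleftrightarrow> sl_regular a b p u \<and>
     (AE x in lebesgue_on (einterval a b). sl_expr a b p q r u x = z * u x)"

definition wronskian :: "ereal \<Rightarrow> ereal \<Rightarrow> (real \<Rightarrow> real) \<Rightarrow>
    (real \<Rightarrow> complex) \<Rightarrow> (real \<Rightarrow> complex) \<Rightarrow> real \<Rightarrow> complex" where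
  "wronskian a b p f g x = f x * qderiv a b p g x - qderiv a b p f x * g x"

definition wronskian_at_left_end :: "ereal \<Rightarrow> ereal \<Rightarrow> (real \<Rightarrow> real) \<Rightarrow>
    (real \<Rightarrow> complex) \<Rightarrow> (real \<Rightarrow> complex) \<Rightarrow> complex" where
  "wronskian_at_left_end a b p f g = Lim (at_right a) (\<lambda>x. wronskian a b p f g (real_of_ereal x))"

definition limit_circle_left ::
    "ereal \<Rightarrow> ereal \<Rightarrow> (real \<Rightarrow> real) \<Rightarrow> (real \<Rightarrow> real) \<Rightarrow> (real \<Rightarrow> real) \<Rightarrow> bool" where
  "limit_circle_left a b p q r \<longleftrightarrow> (\<forall>z u. sl_solution a b p q r z u \<longrightarrow>
     (\<exists>c\<in>einterval a b. sq_integrable (sl_measure a (ereal c) r) u))"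

definition limit_circle_right ::
    "ereal \<Rightarrow> ereal \<Rightarrow> (real \<Rightarrow> real) \<Rightarrow> (real \<Rightarrow> real) \<Rightarrow> (real \<Rightarrow> real) \<Rightarrow> bool" where
  "limit_circle_right a b p q r \<longleftrightarrow> (\<forall>z u. sl_solution a b p q r z u \<longrightarrow>
     (\<exists>c\<in>einterval a b. sq_integrable (sl_measure (ereal c) b r) u))"

definition limit_point_right ::
    "ereal \<Rightarrow> ereal \<Rightarrow> (real \<Rightarrow> real) \<Rightarrow> (real \<Rightarrow> real) \<Rightarrow> (real \<Rightarrow> real) \<Rightarrow> bool" where
  "limit_point_right a b p q r \<longleftrightarrow> \<not> limit_circle_right a b p q r"

definition max_dom :: "ereal \<Rightarrow> ereal \<Rightarrow> (real \<Rightarrow> real) \<Rightarrow> (real \<Rightarrow> real) \<Rightarrow> (real \<Rightarrow> real) \<Rightarrow>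
    (real \<Rightarrow> complex) set" where
  "max_dom a b p q r = {g. sq_integrable (sl_measure a b r) g \<and> sl_regular a b p g \<and>
     sq_integrable (sl_measure a b r) (sl_expr a b p q r g)}"

definition sl_restriction :: "ereal \<Rightarrow> ereal \<Rightarrow> (real \<Rightarrow> real) \<Rightarrow> (real \<Rightarrow> real) \<Rightarrow> (real \<Rightarrow> real) \<Rightarrow>
    ((real \<Rightarrow> complex) \<Rightarrow> bool) \<Rightarrow> real l2_op" where
  "sl_restriction a b p q r P =
     {(l2_class (sl_measure a b r) g, l2_class (sl_measure a b r) (sl_expr a b p q r g)) | g.
        g \<in> max_dom a b p q r \<and> P g}"

definition T_max :: "ereal \<Rightarrow> ereal \<Rightarrow> (real \<Rightarrow> real) \<Rightarrow> (real \<Rightarrow> real) \<Rightarrow> (real \<Rightarrow> real) \<Rightarrow>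
    real l2_op" where
  "T_max a b p q r = sl_restriction a b p q r (\<lambda>g. True)"

definition T_min :: "ereal \<Rightarrow> ereal \<Rightarrow> (real \<Rightarrow> real) \<Rightarrow> (real \<Rightarrow> real) \<Rightarrow> (real \<Rightarrow> real) \<Rightarrow>
    real l2_op" where
  "T_min a b p q r = op_closure (sl_measure a b r) (sl_restriction a b p q r
     (\<lambda>g. \<exists>K. compact K \<and> K \<subseteq> einterval a b \<and> (\<forall>x\<in>einterval a b - K. g x = 0)))"

definition boundary_pair :: "ereal \<Rightarrow> ereal \<Rightarrow> (real \<Rightarrow> real) \<Rightarrow> (real \<Rightarrow> real) \<Rightarrow> (real \<Rightarrow> real) \<Rightarrow>
    (real \<Rightarrow> complex) \<Rightarrow> (real \<Rightarrow> complex) \<Rightarrow> bool" where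
  "boundary_pair a b p q r v1 v2 \<longleftrightarrow>
     v1 \<in> max_dom a b p q r \<and> v2 \<in> max_dom a b p q r \<and>
     (\<forall>x\<in>einterval a b. v1 x \<in> \<real> \<and> v2 x \<in> \<real>) \<and>
     wronskian_at_left_end a b p v1 v2 = 1"

text \<open>The generalized boundary values of \<open>g\<close> and of its derivative at \<open>a\<close>, relative to the boundary
  pair \<open>v1\<close>, \<open>v2\<close>; the value uses \<open>v2\<close> and the derivative uses \<open>v1\<close>.\<close>

definition bval :: "ereal \<Rightarrow> ereal \<Rightarrow> (real \<Rightarrow> real) \<Rightarrow> (real \<Rightarrow> complex) \<Rightarrow>
    (real \<Rightarrow> complex) \<Rightarrow> complex" where
  "bval a b p v2 g = - wronskian_at_left_end a b p v2 g"

definition bval' :: "ereal \<Rightarrow> ereal \<Rightarrow> (real \<Rightarrow> real) \<Rightarrow> (real \<Rightarrow> complex) \<Rightarrow>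
    (real \<Rightarrow> complex) \<Rightarrow> complex" where
  "bval' a b p v1 g = wronskian_at_left_end a b p v1 g"

definition T_bc :: "ereal \<Rightarrow> ereal \<Rightarrow> (real \<Rightarrow> real) \<Rightarrow> (real \<Rightarrow> real) \<Rightarrow> (real \<Rightarrow> real) \<Rightarrow>
    (real \<Rightarrow> complex) \<Rightarrow> (real \<Rightarrow> complex) \<Rightarrow> real \<Rightarrow> real l2_op" where
  "T_bc a b p q r v1 v2 \<alpha> = sl_restriction a b p q r
     (\<lambda>g. complex_of_real (cos \<alpha>) * bval a b p v2 g + complex_of_real (sin \<alpha>) * bval' a b p v1 g = 0)"

text \<open>A solution is determined on the interval only; outside it is set to zero to make the
  description definite.\<close>

definition weyl_solution :: "ereal \<Rightarrow> ereal \<Rightarrow> (real \<Rightarrow> real) \<Rightarrow> (real \<Rightarrow> real) \<Rightarrow> (real \<Rightarrow> real) \<Rightarrow>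
    (real \<Rightarrow> complex) \<Rightarrow> complex \<Rightarrow> real \<Rightarrow> complex" where
  "weyl_solution a b p q r v2 z = (THE y. sl_solution a b p q r z y \<and>
     sq_integrable (sl_measure a b r) y \<and> bval a b p v2 y = 1 \<and>
     (\<forall>x. x \<notin> einterval a b \<longrightarrow> y x = 0))"

definition krein_scalar :: "ereal \<Rightarrow> ereal \<Rightarrow> (real \<Rightarrow> real) \<Rightarrow> (real \<Rightarrow> real) \<Rightarrow> (real \<Rightarrow> real) \<Rightarrow>
    (real \<Rightarrow> complex) \<Rightarrow> (real \<Rightarrow> complex) \<Rightarrow> real \<Rightarrow> complex \<Rightarrow> complex" where
  "krein_scalar a b p q r v1 v2 \<alpha> z =
     - complex_of_real (cot \<alpha>) - bval' a b p v1 (weyl_solution a b p q r v2 z)"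

end

theory Submission
  imports Defs
begin

text \<open>
  Write \<open>W(f,g)\<close> for the Wronskian. Lagrange's identity says that \<open>W(f,g)\<close> is a primitive of
  \<open>r * (\<tau> f * g - f * \<tau> g)\<close>, so for \<open>f\<close>, \<open>g\<close> in the maximal domain \<open>W(f,g)\<close> has limits at both
  endpoints, and their difference is an integral over the interval. In the limit point case the limit at
  \<open>b\<close> is zero (\<open>wronskian_vanishes_at_limit_point\<close>): if it were not, \<open>f\<close> and \<open>g\<close> would form a basis
  near \<open>b\<close> in which all solutions have bounded coefficients, and all solutions would be
  square-integrable there. Hence Green's formula has a boundary term at \<open>a\<close> only, and there the Pluecker
  relation makes \<open>W(f,g)(a)\<close> the determinant of the generalized boundary values of \<open>f\<close> and \<open>g\<close>
  (\<open>W0_bv\<close>). Everything else is linear algebra with these two boundary values, once three facts from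
  analysis are available.

  First, a weak solution is a solution (\<open>weak_solution_regular\<close>): if \<open>u\<close> and \<open>w\<close> satisfy Green's formula
  against all compactly supported functions of the maximal domain, then, up to null sets, \<open>u\<close> is in the maximal
  domain and \<open>\<tau> u = w\<close>. This computes the adjoint of every restriction of \<open>T_max\<close> that contains the compactly
  supported functions (\<open>adjoint_sl_restriction\<close>): it consists of those \<open>g\<close> for which \<open>W(cnj g,f)(a)\<close>
  vanishes on the restriction. In particular the operators \<open>T_\<alpha>\<close> are self-adjoint. Second, the double
  adjoint is the closure, by the projection theorem in \<open>L2\<close>. So \<open>T_min\<close> is the adjoint of \<open>T_max\<close> and
  consists of the functions whose two boundary values vanish (\<open>T_min_eq\<close>). For \<open>0 < \<alpha> < \<pi>\<close> these
  are exactly the functions that satisfy the boundary conditions of both \<open>T_0\<close> and \<open>T_\<alpha>\<close>, which is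
  relative primality. Third, all of this takes place among locally absolutely continuous functions, and
  these are the primitives of locally integrable functions (\<open>absolutely_continuous_between_primitive\<close>, by
  the Radon-Nikodym theorem). Solutions of initial value problems are then obtained by Picard iteration
  (\<open>linear_volterra_solution\<close>).

  Krein's formula follows by adding to \<open>y = (T_0 - z)\<^sup>-\<^sup>1 g\<close> the multiple of \<open>\<psi>(z)\<close> that makes the boundary
  condition of \<open>T_\<alpha>\<close> true. The multiple is the second boundary value of \<open>y\<close> divided by \<open>k_\<alpha>(z)\<close>, and
  Green's formula applied to \<open>\<psi>(z)\<close> and \<open>y\<close> identifies that boundary value with the inner product of
  \<open>\<psi>(cnj z) = cnj \<psi>(z)\<close> and \<open>g\<close>.
\<close>

section \<open>Primitives and their derivatives\<close>

text \<open>A function together with a density on every compact interval of \<open>S\<close>. Absolute integrability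
  is part of the notion, so that the calculus of indefinite Henstock-Kurzweil integrals and Lebesgue's
  convergence theorems can be used side by side.\<close>

definition primitive_on :: "real set \<Rightarrow> (real \<Rightarrow> 'b::euclidean_space) \<Rightarrow> (real \<Rightarrow> 'b) \<Rightarrow> bool" where
  "primitive_on S F f \<longleftrightarrow> (\<forall>x\<in>S. \<forall>y\<in>S. x \<le> y \<longrightarrow>
     f absolutely_integrable_on {x..y} \<and> (f has_integral (F y - F x)) {x..y})"

lemma primitive_onD:
  assumes "primitive_on S F f" "x \<in> S" "y \<in> S" "x \<le> y"
  shows "f absolutely_integrable_on {x..y}" "(f has_integral (F y - F x)) {x..y}"
    "integral {x..y} f = F y - F x"
  using assms unfolding primitive_on_def by (blast intro: integral_unique)+

lemma primitive_on_subset: "primitive_on S F f \<Longrightarrow> T \<subseteq> S \<Longrightarrow> primitive_on T F f"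
  unfolding primitive_on_def by blast

lemma AE_lebesgue_on_iff_negligible:
  assumes "S \<in> sets lebesgue"
  shows "(AE x in lebesgue_on S. P x) \<longleftrightarrow> (\<exists>N. negligible N \<and> (\<forall>x\<in>S - N. P x))"
proof -
  have "(AE x in lebesgue_on S. P x) \<longleftrightarrow> (AE x in lebesgue. x \<in> S \<longrightarrow> P x)"
    using assms by (simp add: AE_restrict_space_iff)
  also have "\<dots> \<longleftrightarrow> (\<exists>N. negligible N \<and> (\<forall>x\<in>S - N. P x))"
  proof
    assume "AE x in lebesgue. x \<in> S \<longrightarrow> P x"
    then obtain N where "N \<in> null_sets lebesgue" "{x \<in> space lebesgue. \<not> (x \<in> S \<longrightarrow> P x)} \<subseteq> N"
      by (auto simp: eventually_ae_filter)
    then show "\<exists>N. negligible N \<and> (\<forall>x\<in>S - N. P x)"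
      by (intro exI[of _ N]) (auto simp: negligible_iff_null_sets)
  next
    assume "\<exists>N. negligible N \<and> (\<forall>x\<in>S - N. P x)"
    then obtain N where "negligible N" "\<forall>x\<in>S - N. P x" by blast
    then show "AE x in lebesgue. x \<in> S \<longrightarrow> P x"
      by (intro AE_I'[of N]) (auto simp: negligible_iff_null_sets)
  qed
  finally show ?thesis .
qed

text \<open>For almost every \<open>x\<close> the averages of \<open>f\<close> over \<open>{x..x + h}\<close> tend to \<open>f x\<close>. Applied to \<open>f\<close>
  and to its reflection at the origin this gives the derivative of the primitive from both sides.\<close>

lemma has_vector_derivative_primitive_interval:
  fixes F f :: "real \<Rightarrow> 'b::euclidean_space"
  assumes "primitive_on {c..d} F f"
  obtains N where "negligible N" "\<And>x. x \<in> {c<..<d} - N \<Longrightarrow> (F has_vector_derivative f x) (at x)"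
proof (cases "c < d")
  case False
  then show ?thesis using that[of "{}"] by auto
next
  case True
  define g where "g x = (if x \<in> {c..d} then f x else 0)" for x
  have gI: "g integrable_on cbox s t" for s t
  proof -
    have "f integrable_on {c..d}"
      using primitive_onD(2)[OF assms, of c d] True by (auto simp: has_integral_iff)
    then have "g integrable_on UNIV"
      unfolding g_def by (subst integrable_restrict_UNIV)
    then show ?thesis by (rule integrable_on_subcbox) auto
  qed
  have hI: "(\<lambda>x. g (- x)) integrable_on cbox s t" for s t
    using integrable_reflect[of g "-s" "-t"] gI[of "-t" "-s"] by simp
  obtain N1 where N1: "negligible N1" "\<And>x e. x \<notin> N1 \<Longrightarrow> 0 < e \<Longrightarrow>
      \<exists>k>0. \<forall>h. 0 < h \<and> h < k \<longrightarrow> norm (integral (cbox x (x + h *\<^sub>R One)) g /\<^sub>R h ^ DIM(real) - g x) < e"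
    using integrable_ccontinuous_explicit[OF gI] by blast
  obtain N2 where N2: "negligible N2" "\<And>x e. x \<notin> N2 \<Longrightarrow> 0 < e \<Longrightarrow>
      \<exists>k>0. \<forall>h. 0 < h \<and> h < k \<longrightarrow>
        norm (integral (cbox x (x + h *\<^sub>R One)) (\<lambda>x. g (- x)) /\<^sub>R h ^ DIM(real) - g (- x)) < e"
    using integrable_ccontinuous_explicit[OF hI] by blast
  have gF: "integral {x..y} g = F y - F x" if "c \<le> x" "x \<le> y" "y \<le> d" for x y
  proof -
    have "integral {x..y} g = integral {x..y} f"
      using that by (intro integral_cong) (auto simp: g_def)
    then show ?thesis using primitive_onD(3)[OF assms, of x y] that by auto
  qed
  have neg: "negligible (uminus ` N2)"
    using N2(1) by (intro negligible_differentiable_image_negligible)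
      (auto simp: differentiable_on_def intro!: derivative_intros)
  show ?thesis
  proof (rule that[of "N1 \<union> uminus ` N2"])
    show "negligible (N1 \<union> uminus ` N2)" using N1(1) neg by auto
    fix x assume x: "x \<in> {c<..<d} - (N1 \<union> uminus ` N2)"
    then have x1: "x \<notin> N1" and x2: "- x \<notin> N2" by (auto simp: image_iff)
    show "(F has_vector_derivative f x) (at x)"
      unfolding has_vector_derivative_def has_derivative_at_alt
    proof (intro conjI allI impI)
      show "bounded_linear (\<lambda>xa. xa *\<^sub>R f x)" by (rule bounded_linear_scaleR_left)
      fix e :: real assume e: "0 < e"
      obtain k1 where k1: "k1 > 0" "\<And>h. 0 < h \<Longrightarrow> h < k1 \<Longrightarrow> norm (integral {x..x+h} g /\<^sub>R h - g x) < e"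
        using N1(2)[OF x1 e] by auto
      obtain k2 where k2: "k2 > 0" "\<And>h. 0 < h \<Longrightarrow> h < k2 \<Longrightarrow>
          norm (integral {-x..-x+h} (\<lambda>x. g (- x)) /\<^sub>R h - g x) < e"
        using N2(2)[OF x2 e] by auto
      define k where "k = min (min k1 k2) (min (x - c) (d - x))"
      have gx: "g x = f x" using x by (auto simp: g_def)
      show "\<exists>k>0. \<forall>y. norm (y - x) < k \<longrightarrow> norm (F y - F x - (y - x) *\<^sub>R f x) \<le> e * norm (y - x)"
      proof (intro exI[of _ k] conjI allI impI)
        show "k > 0" using k1 k2 x by (auto simp: k_def)
        fix y assume y: "norm (y - x) < k"
        consider "y = x" | "y > x" | "y < x" by linarith
        then show "norm (F y - F x - (y - x) *\<^sub>R f x) \<le> e * norm (y - x)"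
        proof cases
          case 1 then show ?thesis by simp
        next
          case 2
          define h where "h = y - x"
          have h: "0 < h" "h < k1" "x + h \<le> d" "c \<le> x" using y 2 x by (auto simp: h_def k_def)
          have "norm ((F y - F x) /\<^sub>R h - f x) < e"
            using k1(2)[of h] gF[of x "x+h"] h gx by (auto simp: h_def)
          moreover have "F y - F x - h *\<^sub>R f x = h *\<^sub>R ((F y - F x) /\<^sub>R h - f x)"
            using h by (simp add: algebra_simps)
          ultimately show ?thesis using h by (simp add: h_def[symmetric] mult.commute)
        next
          case 3
          define h where "h = x - y"
          have h: "0 < h" "h < k2" "c \<le> x - h" "x \<le> d" using y 3 x by (auto simp: h_def k_def)
          have "integral {-x..-x+h} (\<lambda>x. g (- x)) = integral {x-h..x} g"
            using integral_reflect[of "x" "x-h" g] by (simp add: algebra_simps)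
          then have "norm ((F x - F y) /\<^sub>R h - f x) < e"
            using k2(2)[of h] gF[of "x-h" x] h gx by (auto simp: h_def)
          moreover have "F y - F x - (- h) *\<^sub>R f x = (- h) *\<^sub>R ((F x - F y) /\<^sub>R h - f x)"
            using h by (simp add: algebra_simps)
          ultimately have "norm (F y - F x - (- h) *\<^sub>R f x) = h * norm ((F x - F y) /\<^sub>R h - f x)"
            using h by (simp only: norm_scaleR)
          also have "\<dots> \<le> h * e"
            using h \<open>norm ((F x - F y) /\<^sub>R h - f x) < e\<close> by (intro mult_left_mono) auto
          finally have "norm (F y - F x - (- h) *\<^sub>R f x) \<le> e * h" by (simp add: mult.commute)
          then show ?thesis using h by (simp add: h_def)
        qed
      qed
    qed
  qed
qed

text \<open>Lebesgue's differentiation theorem; countably many intervals with rational endpoints reduce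
  it to the case of a single interval.\<close>

lemma primitive_on_has_vector_derivative:
  fixes F f :: "real \<Rightarrow> 'b::euclidean_space"
  assumes F: "primitive_on S F f" and S: "open S"
  shows "AE x in lebesgue_on S. (F has_vector_derivative f x) (at x)"
proof -
  define Q where "Q = {cd \<in> \<rat> \<times> \<rat>. {fst cd..snd cd::real} \<subseteq> S}"
  have "countable Q"
    unfolding Q_def by (rule countable_subset[of _ "\<rat> \<times> \<rat>"]) (auto simp: countable_rat)
  have "\<forall>cd\<in>Q. \<exists>N. negligible N \<and> (\<forall>x\<in>{fst cd<..<snd cd} - N. (F has_vector_derivative f x) (at x))"
  proof
    fix cd assume "cd \<in> Q"
    then have "primitive_on {fst cd..snd cd} F f"
      using F by (auto simp: Q_def intro: primitive_on_subset)
    then show "\<exists>N. negligible N \<and> (\<forall>x\<in>{fst cd<..<snd cd} - N. (F has_vector_derivative f x) (at x))"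
      using has_vector_derivative_primitive_interval by metis
  qed
  then obtain N where N: "\<And>cd. cd \<in> Q \<Longrightarrow> negligible (N cd)"
    "\<And>cd x. cd \<in> Q \<Longrightarrow> x \<in> {fst cd<..<snd cd} - N cd \<Longrightarrow> (F has_vector_derivative f x) (at x)"
    by metis
  have "negligible (\<Union>cd\<in>Q. N cd)"
    using N(1) \<open>countable Q\<close> by (intro negligible_countable_Union) auto
  moreover have "(F has_vector_derivative f x) (at x)" if x: "x \<in> S - (\<Union>cd\<in>Q. N cd)" for x
  proof -
    obtain e where e: "e > 0" "cball x e \<subseteq> S"
      using S x open_contains_cball by blast
    obtain c where c: "c \<in> \<rat>" "x - e < c" "c < x" using Rats_dense_in_real[of "x - e" x] e by auto
    obtain d where d: "d \<in> \<rat>" "x < d" "d < x + e" using Rats_dense_in_real[of x "x + e"] e by auto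
    have "{c..d} \<subseteq> cball x e" using c d by (auto simp: cball_eq_atLeastAtMost)
    then have "(c, d) \<in> Q" using c d e by (auto simp: Q_def)
    then show ?thesis using N(2)[of "(c, d)" x] x c d by auto
  qed
  moreover have "S \<in> sets lebesgue" using S by (simp add: borel_open sets_completionI_sets)
  ultimately show ?thesis by (subst AE_lebesgue_on_iff_negligible) blast+
qed

section \<open>Absolutely continuous functions\<close>

text \<open>The values may lie in any normed space, because the variation of a complex function is a real
  function whose absolute continuity matters as well.\<close>

definition absolutely_continuous_between ::
    "real \<Rightarrow> real \<Rightarrow> (real \<Rightarrow> 'b::real_normed_vector) \<Rightarrow> bool" where
  "absolutely_continuous_between c d f \<longleftrightarrow> (\<forall>e>0. \<exists>\<delta>>0. \<forall>D. D division_of \<Union>D \<and> \<Union>D \<subseteq> {c..d} \<and>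
     (\<Sum>K\<in>D. Sup K - Inf K) < \<delta> \<longrightarrow> (\<Sum>K\<in>D. norm (f (Sup K) - f (Inf K))) < e)"

lemma abs_cont_on_iff: "abs_cont_on c d f \<longleftrightarrow> absolutely_continuous_between c d f"
  by (simp add: abs_cont_on_def absolutely_continuous_between_def)

lemma division_of_realE:
  assumes "D division_of E" "K \<in> D"
  obtains l u :: real where "K = {l..u}" "l \<le> u" "Sup K = u" "Inf K = l"
proof -
  obtain l u where "K = cbox l u" "K \<noteq> {}" using division_ofD(3,4)[OF assms] by metis
  then show ?thesis using that[of l u] by auto
qed

lemma absolutely_continuous_betweenD:
  assumes "absolutely_continuous_between c d f" "e > 0"
  obtains \<delta> where "\<delta> > 0" "\<And>D. D division_of \<Union>D \<Longrightarrow> \<Union>D \<subseteq> {c..d} \<Longrightarrow>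
     (\<Sum>K\<in>D. Sup K - Inf K) < \<delta> \<Longrightarrow> (\<Sum>K\<in>D. norm (f (Sup K) - f (Inf K))) < e"
proof -
  obtain \<delta> where "\<delta> > 0" and *: "\<forall>D. D division_of \<Union>D \<and> \<Union>D \<subseteq> {c..d} \<and>
     (\<Sum>K\<in>D. Sup K - Inf K) < \<delta> \<longrightarrow> (\<Sum>K\<in>D. norm (f (Sup K) - f (Inf K))) < e"
    using assms(1)[unfolded absolutely_continuous_between_def, rule_format, OF assms(2)]
    by (elim exE conjE) (rule that)
  show ?thesis
    by (rule that[OF \<open>\<delta> > 0\<close>]) (rule *[rule_format], blast)
qed

lemma absolutely_continuous_between_subset:
  assumes "absolutely_continuous_between c d f" "c \<le> c'" "d' \<le> d"
  shows "absolutely_continuous_between c' d' f"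
proof -
  have "{c'..d'} \<subseteq> {c..d}" using assms by auto
  then show ?thesis
    using assms unfolding absolutely_continuous_between_def by (meson order_trans)
qed

text \<open>The form of the estimate covers sums and, on bounded functions, products.\<close>

lemma absolutely_continuous_between_dominated_add:
  assumes f: "absolutely_continuous_between c d f" and g: "absolutely_continuous_between c d g"
    and "C \<ge> 0"
    and h: "\<And>x y. x \<in> {c..d} \<Longrightarrow> y \<in> {c..d} \<Longrightarrow>
      norm (h y - h x) \<le> C * norm (f y - f x) + C * norm (g y - g x)"
  shows "absolutely_continuous_between c d h"
  unfolding absolutely_continuous_between_def
proof (intro allI impI)
  fix e :: real assume "e > 0"
  then have e': "e / (2 * (C + 1)) > 0" using \<open>C \<ge> 0\<close> by simp
  obtain \<delta>1 where \<delta>1: "\<delta>1 > 0" "\<And>D. D division_of \<Union>D \<Longrightarrow> \<Union>D \<subseteq> {c..d} \<Longrightarrow>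
     (\<Sum>K\<in>D. Sup K - Inf K) < \<delta>1 \<Longrightarrow> (\<Sum>K\<in>D. norm (f (Sup K) - f (Inf K))) < e / (2 * (C + 1))"
    by (rule absolutely_continuous_betweenD[OF f e']) (rule that; blast)
  obtain \<delta>2 where \<delta>2: "\<delta>2 > 0" "\<And>D. D division_of \<Union>D \<Longrightarrow> \<Union>D \<subseteq> {c..d} \<Longrightarrow>
     (\<Sum>K\<in>D. Sup K - Inf K) < \<delta>2 \<Longrightarrow> (\<Sum>K\<in>D. norm (g (Sup K) - g (Inf K))) < e / (2 * (C + 1))"
    by (rule absolutely_continuous_betweenD[OF g e']) (rule that; blast)
  show "\<exists>\<delta>>0. \<forall>D. D division_of \<Union>D \<and> \<Union>D \<subseteq> {c..d} \<and>
     (\<Sum>K\<in>D. Sup K - Inf K) < \<delta> \<longrightarrow> (\<Sum>K\<in>D. norm (h (Sup K) - h (Inf K))) < e"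
  proof (intro exI[of _ "min \<delta>1 \<delta>2"] conjI allI impI)
    fix D assume D: "D division_of \<Union>D \<and> \<Union>D \<subseteq> {c..d} \<and> (\<Sum>K\<in>D. Sup K - Inf K) < min \<delta>1 \<delta>2"
    have "norm (h (Sup K) - h (Inf K)) \<le>
        C * norm (f (Sup K) - f (Inf K)) + C * norm (g (Sup K) - g (Inf K))" if "K \<in> D" for K
    proof -
      obtain l u where K: "K = {l..u}" "l \<le> u" "Sup K = u" "Inf K = l"
        using division_of_realE D \<open>K \<in> D\<close> by metis
      moreover have "K \<subseteq> {c..d}" using D \<open>K \<in> D\<close> by blast
      ultimately show ?thesis using h[of l u] by auto
    qed
    then have "(\<Sum>K\<in>D. norm (h (Sup K) - h (Inf K))) \<le>
        C * (\<Sum>K\<in>D. norm (f (Sup K) - f (Inf K))) + C * (\<Sum>K\<in>D. norm (g (Sup K) - g (Inf K)))"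
      unfolding sum_distrib_left sum.distrib[symmetric] by (rule sum_mono)
    also have "\<dots> \<le> C * (e / (2 * (C + 1))) + C * (e / (2 * (C + 1)))"
      using \<delta>1(2)[of D] \<delta>2(2)[of D] D \<open>C \<ge> 0\<close> by (intro add_mono mult_left_mono) auto
    also have "\<dots> = e * (C / (C + 1))"
      using \<open>C \<ge> 0\<close> by (simp add: divide_simps)
    also have "\<dots> < e * 1"
      using \<open>C \<ge> 0\<close> \<open>e > 0\<close> by (intro mult_strict_left_mono) auto
    finally show "(\<Sum>K\<in>D. norm (h (Sup K) - h (Inf K))) < e" by simp
  qed (use \<delta>1 \<delta>2 in auto)
qed

lemma absolutely_continuous_between_continuous:
  assumes "absolutely_continuous_between c d f"
  shows "continuous_on {c..d} f"
  unfolding continuous_on_iff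
proof (intro ballI allI impI)
  fix x e :: real assume x: "x \<in> {c..d}" and "e > 0"
  obtain \<delta> where \<delta>: "\<delta> > 0" "\<And>D. D division_of \<Union>D \<Longrightarrow> \<Union>D \<subseteq> {c..d} \<Longrightarrow>
     (\<Sum>K\<in>D. Sup K - Inf K) < \<delta> \<Longrightarrow> (\<Sum>K\<in>D. norm (f (Sup K) - f (Inf K))) < e"
    by (rule absolutely_continuous_betweenD[OF assms \<open>e > 0\<close>]) (rule that; blast)
  have *: "norm (f v - f u) < e" if "u \<in> {c..d}" "v \<in> {c..d}" "u \<le> v" "v - u < \<delta>" for u v
  proof -
    have "{{u..v}} division_of \<Union>{{u..v}}"
      using that division_of_self[of u v] by auto
    then show ?thesis using \<delta>(2)[of "{{u..v}}"] that by auto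
  qed
  show "\<exists>\<delta>>0. \<forall>x'\<in>{c..d}. dist x' x < \<delta> \<longrightarrow> dist (f x') (f x) < e"
  proof (intro exI[of _ \<delta>] conjI ballI impI)
    fix y assume y: "y \<in> {c..d}" "dist y x < \<delta>"
    show "dist (f y) (f x) < e"
      using *[of x y] *[of y x] x y
      by (cases "x \<le> y") (auto simp: dist_norm norm_minus_commute)
  qed (use \<delta> in auto)
qed

text \<open>Truncation at a high level \<open>n\<close> splits \<open>g\<close> into a part bounded by \<open>n\<close>, whose integral over
  \<open>E\<close> is at most \<open>n\<close> times the measure of \<open>E\<close>, and a remainder of small integral.\<close>

lemma integral_absolutely_continuous:
  fixes g :: "'a \<Rightarrow> real"
  assumes g: "integrable M g" and nn: "\<And>x. 0 \<le> g x" and e: "e > 0"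
  shows "\<exists>\<delta>>0. \<forall>E\<in>fmeasurable M. measure M E < \<delta> \<longrightarrow> (LINT x:E|M. g x) < e"
proof -
  have [measurable]: "g \<in> borel_measurable M" using g by auto
  have "(\<lambda>n. \<integral>x. min (g x) (real n) \<partial>M) \<longlonglongrightarrow> (\<integral>x. g x \<partial>M)"
  proof (rule integral_dominated_convergence[where w=g])
    show "AE x in M. (\<lambda>n. min (g x) (real n)) \<longlonglongrightarrow> g x"
    proof (intro AE_I2)
      fix x
      have "eventually (\<lambda>n. min (g x) (real n) = g x) sequentially"
        using eventually_ge_at_top[of "nat \<lceil>g x\<rceil>"] by eventually_elim linarith
      then show "(\<lambda>n. min (g x) (real n)) \<longlonglongrightarrow> g x" by (rule tendsto_eventually)
    qed
  qed (use g nn in \<open>auto simp: min_def\<close>)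
  then obtain n where n: "\<bar>(\<integral>x. min (g x) (real n) \<partial>M) - (\<integral>x. g x \<partial>M)\<bar> < e / 2"
    using e unfolding LIMSEQ_iff by (metis half_gt_zero order_refl real_norm_def)
  have im: "integrable M (\<lambda>x. min (g x) (real n))"
    by (rule Bochner_Integration.integrable_bound[OF g]) (use nn in \<open>auto simp: min_def\<close>)
  show ?thesis
  proof (intro exI[of _ "e / (2 * (real n + 1))"] conjI ballI impI)
    show "0 < e / (2 * (real n + 1))" using e by simp
    fix E assume E: "E \<in> fmeasurable M" and small: "measure M E < e / (2 * (real n + 1))"
    then have iE: "integrable M (indicat_real E)"
      by (simp add: fmeasurable_def integrable_real_indicator)
    have "(LINT x:E|M. g x) \<le> (\<integral>x. (g x - min (g x) (real n)) + real n * indicat_real E x \<partial>M)"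
      unfolding set_lebesgue_integral_def
    proof (rule integral_mono)
      show "integrable M (\<lambda>x. indicat_real E x *\<^sub>R g x)"
        using E g by (intro integrable_mult_indicator) (auto dest: fmeasurableD)
      show "integrable M (\<lambda>x. (g x - min (g x) (real n)) + real n * indicat_real E x)"
        using g im iE by simp
    qed (use nn in \<open>auto simp: indicator_def min_def\<close>)
    also have "\<dots> = ((\<integral>x. g x \<partial>M) - (\<integral>x. min (g x) (real n) \<partial>M)) + real n * measure M E"
      using g im iE E by (simp add: fmeasurableD)
    also have "\<dots> < e / 2 + real n * measure M E"
      using n by linarith
    also have "\<dots> \<le> e / 2 + (real n + 1) * (e / (2 * (real n + 1)))"
      using small by (intro add_left_mono mult_mono) (auto simp: less_imp_le)
    also have "\<dots> = e" by (simp add: field_simps)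
    finally show "(LINT x:E|M. g x) < e" .
  qed
qed

text \<open>The increments over the intervals of \<open>D\<close> add up to at most the integral of the norm of \<open>f\<close>
  over \<open>\<Union>D\<close>.\<close>

lemma primitive_on_absolutely_continuous:
  fixes F f :: "real \<Rightarrow> 'b::euclidean_space"
  assumes F: "primitive_on {c..d} F f"
  shows "absolutely_continuous_between c d F"
proof (cases "c \<le> d")
  case False
  have D: "D = {}" if D: "D division_of \<Union>D" "\<Union>D \<subseteq> {c..d}" for D
  proof (rule ccontr)
    assume "D \<noteq> {}"
    then obtain K where "K \<in> D" by blast
    then have "K \<noteq> {}" "K \<subseteq> {c..d}" using division_ofD(3)[OF D(1)] D(2) by auto
    then show False using False by auto
  qed
  show ?thesis
    unfolding absolutely_continuous_between_def
  proof (intro allI impI exI[of _ 1] conjI)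
    fix e :: real and D
    assume "e > 0" "D division_of \<Union>D \<and> \<Union>D \<subseteq> {c..d} \<and> (\<Sum>K\<in>D. Sup K - Inf K) < 1"
    then show "(\<Sum>K\<in>D. norm (F (Sup K) - F (Inf K))) < e" using D[of D] by simp
  qed simp
next
  case True
  define g where "g x = indicat_real {c..d} x * norm (f x)" for x
  have fcd: "f absolutely_integrable_on {c..d}" using primitive_onD(1)[OF F] True by auto
  then have gI: "integrable lebesgue g"
    using set_integrable_norm[OF fcd] by (simp add: set_integrable_def g_def[abs_def])
  show ?thesis
    unfolding absolutely_continuous_between_def
  proof (intro allI impI)
    fix e :: real assume "e > 0"
    then obtain \<delta> where \<delta>: "\<delta> > 0"
      "\<forall>E\<in>lmeasurable. measure lebesgue E < \<delta> \<longrightarrow> (LINT x:E|lebesgue. g x) < e"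
      using integral_absolutely_continuous[OF gI] by (auto simp: g_def)
    show "\<exists>\<delta>>0. \<forall>D. D division_of \<Union>D \<and> \<Union>D \<subseteq> {c..d} \<and>
     (\<Sum>K\<in>D. Sup K - Inf K) < \<delta> \<longrightarrow> (\<Sum>K\<in>D. norm (F (Sup K) - F (Inf K))) < e"
    proof (intro exI[of _ \<delta>] conjI allI impI)
      fix D assume D: "D division_of \<Union>D \<and> \<Union>D \<subseteq> {c..d} \<and> (\<Sum>K\<in>D. Sup K - Inf K) < \<delta>"
      then have "finite D" by blast
      have K: "K \<in> lmeasurable \<and> measure lebesgue K = Sup K - Inf K \<and>
         norm (F (Sup K) - F (Inf K)) \<le> integral K (\<lambda>x. norm (f x))" if "K \<in> D" for K
      proof -
        obtain l u where K: "K = {l..u}" "l \<le> u" "Sup K = u" "Inf K = l"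
          using division_of_realE D \<open>K \<in> D\<close> by metis
        moreover have "K \<subseteq> {c..d}" using D \<open>K \<in> D\<close> by blast
        ultimately have lu: "l \<in> {c..d}" "u \<in> {c..d}" by auto
        note lu' = primitive_onD[OF F lu \<open>l \<le> u\<close>]
        have "norm (F u - F l) \<le> integral {l..u} (\<lambda>x. norm (f x))"
          unfolding lu'(3)[symmetric] using lu'(1)
          by (intro integral_norm_bound_integral)
            (auto simp: absolutely_integrable_on_def)
        then show ?thesis using K by auto
      qed
      have UD: "\<Union>D \<in> lmeasurable" using K \<open>finite D\<close> by (intro fmeasurable.finite_Union) auto
      have nf: "(\<lambda>x. norm (f x)) absolutely_integrable_on \<Union>D"
        using D UD by (intro set_integrable_subset[OF set_integrable_norm[OF fcd]]) auto
      have "measure lebesgue (\<Union>D) \<le> (\<Sum>K\<in>D. measure lebesgue K)"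
        using K \<open>finite D\<close> by (intro measure_Union_le) auto
      also have "\<dots> < \<delta>" using D K by simp
      finally have small: "(LINT x:\<Union>D|lebesgue. g x) < e" using \<delta>(2) UD by blast
      have "(\<Sum>K\<in>D. norm (F (Sup K) - F (Inf K))) \<le> (\<Sum>K\<in>D. integral K (\<lambda>x. norm (f x)))"
        using K by (intro sum_mono) auto
      also have "\<dots> = integral (\<Union>D) (\<lambda>x. norm (f x))"
        using nf D by (intro integral_combine_division_topdown[symmetric])
          (auto simp: absolutely_integrable_on_def)
      also have "\<dots> = (LINT x:\<Union>D|lebesgue. norm (f x))"
        using set_lebesgue_integral_eq_integral(2)[OF nf] by simp
      also have "\<dots> = (LINT x:\<Union>D|lebesgue. g x)"
        using D by (intro set_lebesgue_integral_cong) (auto simp: g_def UD fmeasurableD indicator_def)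
      finally show "(\<Sum>K\<in>D. norm (F (Sup K) - F (Inf K))) < e" using small by simp
    qed (use \<delta> in auto)
  qed
qed

section \<open>The variation function\<close>

text \<open>Variation is measured along monotone sequences instead of divisions: a sequence is cut at a
  point by taking minima and maxima with that point, which makes the variation additive.\<close>

definition chain_sum :: "(real \<Rightarrow> 'b::real_normed_vector) \<Rightarrow> nat \<Rightarrow> (nat \<Rightarrow> real) \<Rightarrow> real" where
  "chain_sum f n e = (\<Sum>i<n. norm (f (e (Suc i)) - f (e i)))"

definition chain_in :: "real \<Rightarrow> real \<Rightarrow> (nat \<Rightarrow> real) \<Rightarrow> bool" where
  "chain_in x y e \<longleftrightarrow> mono e \<and> (\<forall>i. e i \<in> {x..y})"

definition variation :: "(real \<Rightarrow> 'b::real_normed_vector) \<Rightarrow> real \<Rightarrow> real \<Rightarrow> real" where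
  "variation f c x = Sup {chain_sum f n e | n e. chain_in c x e}"

text \<open>The nondegenerate steps of chains inside the intervals of a division form a division of their
  own, to which the definition of absolute continuity applies as a whole.\<close>

lemma chain_sums_to_division:
  fixes f :: "real \<Rightarrow> 'b::real_normed_vector"
  assumes D: "D division_of \<Union>D" and e: "\<And>K. K \<in> D \<Longrightarrow> chain_in (Inf K) (Sup K) (e K)"
  obtains D' where "D' division_of \<Union>D'" "\<Union>D' \<subseteq> \<Union>D"
    "(\<Sum>K\<in>D'. Sup K - Inf K) \<le> (\<Sum>K\<in>D. Sup K - Inf K)"
    "(\<Sum>K\<in>D'. norm (f (Sup K) - f (Inf K))) = (\<Sum>K\<in>D. chain_sum f (n K) (e K))"
proof -
  define J where "J = (SIGMA K:D. {i. i < n K \<and> e K i < e K (Suc i)})"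
  define \<phi> where "\<phi> = (\<lambda>(K, i). {e K i..e K (Suc i)})"
  have finD: "finite D" using D by blast
  have Jfin: "finite J" unfolding J_def using finD by auto
  have sub: "{e K i..e K (Suc i)} \<subseteq> K" if "K \<in> D" for K i
  proof -
    obtain l u where K: "K = {l..u}" "l \<le> u" "Sup K = u" "Inf K = l"
      using division_of_realE[OF D \<open>K \<in> D\<close>] by metis
    moreover have "e K j \<in> {Inf K..Sup K}" for j using e[OF \<open>K \<in> D\<close>] unfolding chain_in_def by blast
    ultimately have "e K i \<in> {l..u}" "e K (Suc i) \<in> {l..u}" by metis+
    then show ?thesis unfolding K(1) by auto
  qed
  have disj: "{e K i<..<e K (Suc i)} \<inter> {e L j<..<e L (Suc j)} = {}"
    if "(K, i) \<in> J" "(L, j) \<in> J" "(K, i) \<noteq> (L, j)" for K i L j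
  proof (cases "K = L")
    case False
    then have "interior K \<inter> interior L = {}"
      using division_ofD(5)[OF D] that by (auto simp: J_def)
    moreover have "{e K i<..<e K (Suc i)} \<subseteq> interior K" "{e L j<..<e L (Suc j)} \<subseteq> interior L"
      using interior_mono[OF sub[of K i]] interior_mono[OF sub[of L j]] that by (auto simp: J_def)
    ultimately show ?thesis by blast
  next
    case True
    then have "mono (e K)" "i \<noteq> j" using e that by (auto simp: J_def chain_in_def)
    moreover from \<open>i \<noteq> j\<close> have "Suc i \<le> j \<or> Suc j \<le> i" by auto
    ultimately have "e K (Suc i) \<le> e K j \<or> e K (Suc j) \<le> e K i" by (auto dest: monoD)
    then show ?thesis using True by auto
  qed
  have ne: "{e K i<..<e K (Suc i)} \<noteq> {}" if "(K, i) \<in> J" for K i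
    using that by (auto simp: J_def)
  have inj: "inj_on \<phi> J"
  proof (rule inj_onI)
    fix a b assume ab: "a \<in> J" "b \<in> J" "\<phi> a = \<phi> b"
    obtain K i L j where [simp]: "a = (K, i)" "b = (L, j)" by (metis surj_pair)
    have "interior (\<phi> a) = interior (\<phi> b)" using ab by simp
    then have "{e K i<..<e K (Suc i)} = {e L j<..<e L (Suc j)}" by (simp add: \<phi>_def)
    then show "a = b" using disj[of K i L j] ne[of K i] ab by auto
  qed
  have less: "e K i < e K (Suc i)" if "(K, i) \<in> J" for K i using that by (auto simp: J_def)
  have "\<phi> ` J division_of \<Union>(\<phi> ` J)"
  proof (rule division_ofI)
    show "finite (\<phi> ` J)" using Jfin by auto
    fix A assume "A \<in> \<phi> ` J"
    then obtain K i where A: "(K, i) \<in> J" "A = {e K i..e K (Suc i)}" by (auto simp: \<phi>_def)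
    show "A \<noteq> {}" using less[OF A(1)] A by auto
    show "\<exists>a b. A = cbox a b" using A by auto
    show "A \<subseteq> \<Union>(\<phi> ` J)" using \<open>A \<in> \<phi> ` J\<close> by blast
    fix B assume "B \<in> \<phi> ` J" "A \<noteq> B"
    then obtain L j where B: "(L, j) \<in> J" "B = {e L j..e L (Suc j)}" by (auto simp: \<phi>_def)
    then have "(K, i) \<noteq> (L, j)" using A \<open>A \<noteq> B\<close> by auto
    then show "interior A \<inter> interior B = {}" using disj[OF A(1) B(1)] A B by simp
  qed simp
  moreover have "\<Union>(\<phi> ` J) \<subseteq> \<Union>D"
    using sub by (fastforce simp: J_def \<phi>_def)
  moreover have "(\<Sum>K\<in>\<phi> ` J. Sup K - Inf K) \<le> (\<Sum>K\<in>D. Sup K - Inf K)"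
  proof -
    have "(\<Sum>K\<in>\<phi> ` J. Sup K - Inf K) = (\<Sum>(K, i)\<in>J. e K (Suc i) - e K i)"
      using less by (subst sum.reindex[OF inj]) (auto simp: \<phi>_def less_imp_le intro!: sum.cong)
    also have "\<dots> = (\<Sum>K\<in>D. \<Sum>i | i < n K \<and> e K i < e K (Suc i). e K (Suc i) - e K i)"
      unfolding J_def using finD by (subst sum.Sigma) auto
    also have "\<dots> \<le> (\<Sum>K\<in>D. Sup K - Inf K)"
    proof (rule sum_mono)
      fix K assume K: "K \<in> D"
      have "mono (e K)" using e[OF K] by (auto simp: chain_in_def)
      then have "(\<Sum>i | i < n K \<and> e K i < e K (Suc i). e K (Suc i) - e K i)
          \<le> (\<Sum>i<n K. e K (Suc i) - e K i)"
        using monoD[of "e K" i "Suc i" for i] by (intro sum_mono2) auto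
      also have "\<dots> = e K (n K) - e K 0" by (rule sum_lessThan_telescope)
      also have "\<dots> \<le> Sup K - Inf K" using e[OF K] unfolding chain_in_def
        by (intro diff_mono) auto
      finally show "(\<Sum>i | i < n K \<and> e K i < e K (Suc i). e K (Suc i) - e K i) \<le> Sup K - Inf K" .
    qed
    finally show ?thesis .
  qed
  moreover have "(\<Sum>K\<in>\<phi> ` J. norm (f (Sup K) - f (Inf K))) = (\<Sum>K\<in>D. chain_sum f (n K) (e K))"
  proof -
    have "(\<Sum>K\<in>\<phi> ` J. norm (f (Sup K) - f (Inf K))) = (\<Sum>(K, i)\<in>J. norm (f (e K (Suc i)) - f (e K i)))"
      using less by (subst sum.reindex[OF inj]) (auto simp: \<phi>_def less_imp_le intro!: sum.cong)
    also have "\<dots> = (\<Sum>K\<in>D. \<Sum>i | i < n K \<and> e K i < e K (Suc i). norm (f (e K (Suc i)) - f (e K i)))"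
      unfolding J_def using finD by (subst sum.Sigma) auto
    also have "\<dots> = (\<Sum>K\<in>D. chain_sum f (n K) (e K))"
    proof (rule sum.cong[OF refl])
      fix K assume K: "K \<in> D"
      have m: "mono (e K)" using e[OF K] by (auto simp: chain_in_def)
      have "e K (Suc i) = e K i" if "\<not> e K i < e K (Suc i)" for i
        using monoD[OF m, of i "Suc i"] that by auto
      then show "(\<Sum>i | i < n K \<and> e K i < e K (Suc i). norm (f (e K (Suc i)) - f (e K i))) = chain_sum f (n K) (e K)"
        unfolding chain_sum_def by (intro sum.mono_neutral_left) (auto, metis)
    qed
    finally show ?thesis .
  qed
  ultimately show ?thesis by (rule that)
qed

lemma chain_sum_split:
  "chain_sum f n e \<le> chain_sum f n (\<lambda>i. min (e i) x) + chain_sum f n (\<lambda>i. max (e i) x)"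
proof -
  have "norm (f (e (Suc i)) - f (e i)) \<le>
      norm (f (min (e (Suc i)) x) - f (min (e i) x)) + norm (f (max (e (Suc i)) x) - f (max (e i) x))" for i
    using norm_triangle_ineq[of "f (e (Suc i)) - f x" "f x - f (e i)"]
      norm_triangle_ineq[of "f (e (Suc i)) - f x" "f x - f (e i)"]
    by (cases "e i \<le> x"; cases "e (Suc i) \<le> x") (auto simp: min_def max_def norm_minus_commute)
  then show ?thesis unfolding chain_sum_def sum.distrib[symmetric] by (rule sum_mono)
qed

text \<open>On an interval shorter than the \<open>\<delta>\<close> that belongs to the bound \<open>1\<close> all chain sums stay below
  \<open>1\<close>, so the variation is finite. It is absolutely continuous because its increment over an
  interval is, up to an arbitrarily small error, a chain sum inside that interval.\<close>

lemma variation_properties: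
  fixes f :: "real \<Rightarrow> 'b::real_normed_vector"
  assumes ac: "absolutely_continuous_between c d f"
    and \<delta>: "\<And>D. D division_of \<Union>D \<Longrightarrow> \<Union>D \<subseteq> {c..d} \<Longrightarrow>
     (\<Sum>K\<in>D. Sup K - Inf K) < \<delta> \<Longrightarrow> (\<Sum>K\<in>D. norm (f (Sup K) - f (Inf K))) < 1"
    and short: "d - c < \<delta>" "c \<le> d"
  shows "\<And>x y. c \<le> x \<Longrightarrow> x \<le> y \<Longrightarrow> y \<le> d \<Longrightarrow>
      norm (f y - f x) \<le> variation f c y - variation f c x"
    and "absolutely_continuous_between c d (variation f c)"
proof -
  have bdd: "chain_sum f n e < 1" if ch: "chain_in c d e" for n e
  proof -
    have D: "{{c..d}} division_of \<Union>{{c..d}}" using division_of_self[of c d] short by auto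
    obtain D' where "D' division_of \<Union>D'" "\<Union>D' \<subseteq> \<Union>{{c..d}}"
      "(\<Sum>K\<in>D'. Sup K - Inf K) \<le> (\<Sum>K\<in>{{c..d}}. Sup K - Inf K)"
      "(\<Sum>K\<in>D'. norm (f (Sup K) - f (Inf K))) = (\<Sum>K\<in>{{c..d}}. chain_sum f n e)"
      by (rule chain_sums_to_division[OF D, of "\<lambda>_. e" f "\<lambda>_. n"]) (use ch short in auto)
    then show ?thesis using \<delta>[of D'] short by auto
  qed
  have bdda: "bdd_above {chain_sum f n e | n e. chain_in c x e}" if "x \<le> d" for x
  proof (rule bdd_aboveI[of _ 1], clarify)
    fix n e assume "chain_in c x e"
    then have "chain_in c d e" using that unfolding chain_in_def by fastforce
    then show "chain_sum f n e \<le> 1" using bdd[of e n] by simp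
  qed
  have ne: "{chain_sum f n e | n e. chain_in c x e} \<noteq> {}" if "c \<le> x" for x
    using that by (fastforce simp: chain_in_def mono_def)
  have up: "chain_sum f n e \<le> variation f c x" if "chain_in c x e" "x \<le> d" for n e x
    unfolding variation_def using that bdda by (intro cSup_upper) auto
  show var: "norm (f y - f x) \<le> variation f c y - variation f c x" if xy: "c \<le> x" "x \<le> y" "y \<le> d" for x y
  proof -
    have "variation f c x \<le> variation f c y - norm (f y - f x)"
      unfolding variation_def[of f c x]
    proof (rule cSup_least[OF ne[OF xy(1)]], clarify)
      fix n e assume e: "chain_in c x e"
      \<comment> \<open>the chain is continued by a last step from \<open>x\<close> to \<open>y\<close>\<close>
      define e' where "e' i = (if i \<le> n then e i else if i = Suc n then x else y)" for i
      have ex: "mono e" "\<And>i. c \<le> e i" "\<And>i. e i \<le> x" using e by (auto simp: chain_in_def)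
      have "mono e'"
      proof (rule incseq_SucI)
        fix i show "e' i \<le> e' (Suc i)"
          using ex(3)[of i] xy monoD[OF ex(1), of i "Suc i"] by (auto simp: e'_def not_le)
      qed
      moreover have "e' i \<in> {c..y}" for i
        using ex(2)[of i] ex(3)[of i] xy by (auto simp: e'_def)
      ultimately have "chain_in c y e'" unfolding chain_in_def by blast
      then have "chain_sum f (Suc (Suc n)) e' \<le> variation f c y" using xy by (intro up) auto
      moreover have "(\<Sum>i<n. norm (f (e' (Suc i)) - f (e' i))) = chain_sum f n e"
        unfolding chain_sum_def by (intro sum.cong) (auto simp: e'_def)
      then have "chain_sum f (Suc (Suc n)) e' = chain_sum f n e + norm (f x - f (e n)) + norm (f y - f x)"
        unfolding chain_sum_def by (simp add: e'_def)
      ultimately show "chain_sum f n e \<le> variation f c y - norm (f y - f x)"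
        using norm_ge_zero[of "f x - f (e n)"] by linarith
    qed
    then show ?thesis by simp
  qed
  have approx: "\<exists>n e. chain_in x y e \<and> variation f c y - variation f c x \<le> chain_sum f n e + \<eta>"
    if xy: "c \<le> x" "x \<le> y" "y \<le> d" and \<eta>: "\<eta> > 0" for x y \<eta>
  proof -
    have "variation f c y - \<eta> < Sup {chain_sum f n e | n e. chain_in c y e}"
      using \<eta> by (simp add: variation_def)
    moreover have "c \<le> y" using xy by simp
    ultimately obtain n e where e: "chain_in c y e" "variation f c y - \<eta> < chain_sum f n e"
      using less_cSup_iff[OF ne bdda[OF xy(3)]] by auto
    have ex: "mono e" "\<And>i. c \<le> e i" "\<And>i. e i \<le> y" using e by (auto simp: chain_in_def)
    have 1: "chain_in c x (\<lambda>i. min (e i) x)" and 2: "chain_in x y (\<lambda>i. max (e i) x)"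
      using ex xy unfolding chain_in_def mono_def
      by (auto simp: min_le_iff_disj le_max_iff_disj) (metis linear order_trans)+
    have "chain_sum f n e \<le> variation f c x + chain_sum f n (\<lambda>i. max (e i) x)"
      using chain_sum_split[of f n e x] up[OF 1, of n] xy by auto
    then show ?thesis using 2 e by (intro exI[of _ n] exI[of _ "\<lambda>i. max (e i) x"]) auto
  qed
  show "absolutely_continuous_between c d (variation f c)"
    unfolding absolutely_continuous_between_def
  proof (intro allI impI)
    fix e :: real assume "e > 0"
    then have e2: "e / 2 > 0" by simp
    obtain \<delta>' where \<delta>': "\<delta>' > 0" "\<And>D. D division_of \<Union>D \<Longrightarrow> \<Union>D \<subseteq> {c..d} \<Longrightarrow>
      (\<Sum>K\<in>D. Sup K - Inf K) < \<delta>' \<Longrightarrow> (\<Sum>K\<in>D. norm (f (Sup K) - f (Inf K))) < e / 2"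
      by (rule absolutely_continuous_betweenD[OF ac e2]) (rule that; blast)
    show "\<exists>\<delta>>0. \<forall>D. D division_of \<Union>D \<and> \<Union>D \<subseteq> {c..d} \<and> (\<Sum>K\<in>D. Sup K - Inf K) < \<delta> \<longrightarrow>
      (\<Sum>K\<in>D. norm (variation f c (Sup K) - variation f c (Inf K))) < e"
    proof (intro exI[of _ \<delta>'] conjI allI impI)
      fix D assume D: "D division_of \<Union>D \<and> \<Union>D \<subseteq> {c..d} \<and> (\<Sum>K\<in>D. Sup K - Inf K) < \<delta>'"
      define \<eta> where "\<eta> = e / (2 * (real (card D) + 1))"
      have \<eta>: "\<eta> > 0" using \<open>e > 0\<close> by (simp add: \<eta>_def)
      have K: "c \<le> Inf K \<and> Inf K \<le> Sup K \<and> Sup K \<le> d" if "K \<in> D" for K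
      proof -
        obtain l u where K: "K = {l..u}" "l \<le> u" "Sup K = u" "Inf K = l"
          using division_of_realE D \<open>K \<in> D\<close> by metis
        moreover have "K \<subseteq> {c..d}" using D \<open>K \<in> D\<close> by blast
        ultimately show ?thesis by auto
      qed
      have "\<forall>K\<in>D. \<exists>n g. chain_in (Inf K) (Sup K) g \<and>
          variation f c (Sup K) - variation f c (Inf K) \<le> chain_sum f n g + \<eta>"
        using approx[OF _ _ _ \<eta>] K by blast
      then obtain n g where g: "\<And>K. K \<in> D \<Longrightarrow> chain_in (Inf K) (Sup K) (g K)"
        "\<And>K. K \<in> D \<Longrightarrow> variation f c (Sup K) - variation f c (Inf K) \<le> chain_sum f (n K) (g K) + \<eta>"
        by metis
      obtain D' where D': "D' division_of \<Union>D'" "\<Union>D' \<subseteq> \<Union>D"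
        "(\<Sum>K\<in>D'. Sup K - Inf K) \<le> (\<Sum>K\<in>D. Sup K - Inf K)"
        "(\<Sum>K\<in>D'. norm (f (Sup K) - f (Inf K))) = (\<Sum>K\<in>D. chain_sum f (n K) (g K))"
        by (rule chain_sums_to_division[of D g f n]) (use D g(1) in blast)+
      have "\<Union>D' \<subseteq> {c..d}" using order_trans[OF D'(2)] D by blast
      moreover have "(\<Sum>K\<in>D'. Sup K - Inf K) < \<delta>'" using le_less_trans[OF D'(3)] D by blast
      ultimately have "(\<Sum>K\<in>D'. norm (f (Sup K) - f (Inf K))) < e / 2" by (rule \<delta>'(2)[OF D'(1)])
      then have small: "(\<Sum>K\<in>D. chain_sum f (n K) (g K)) < e / 2" using D' by simp
      have "(\<Sum>K\<in>D. norm (variation f c (Sup K) - variation f c (Inf K)))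
          \<le> (\<Sum>K\<in>D. chain_sum f (n K) (g K) + \<eta>)"
      proof (rule sum_mono)
        fix K assume "K \<in> D"
        note Kc = K[OF this] and gK = g(2)[OF this]
        have "norm (f (Sup K) - f (Inf K)) \<le> variation f c (Sup K) - variation f c (Inf K)"
          using Kc by (intro var) auto
        then have "0 \<le> variation f c (Sup K) - variation f c (Inf K)"
          by (rule order_trans[OF norm_ge_zero])
        then show "norm (variation f c (Sup K) - variation f c (Inf K)) \<le> chain_sum f (n K) (g K) + \<eta>"
          using gK by simp
      qed
      also have "\<dots> = (\<Sum>K\<in>D. chain_sum f (n K) (g K)) + real (card D) * \<eta>"
        by (simp add: sum.distrib)
      also have "\<dots> < e / 2 + (real (card D) + 1) * \<eta>"
        using small \<eta> by (intro add_less_le_mono mult_right_mono) auto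
      also have "\<dots> = e" by (simp add: \<eta>_def field_simps)
      finally show "(\<Sum>K\<in>D. norm (variation f c (Sup K) - variation f c (Inf K))) < e" .
    qed (use \<delta>' in auto)
  qed
qed

section \<open>Densities of monotone functions\<close>

lemma sum_lengths_division:
  assumes "D division_of \<Union>D" "\<Union>D \<subseteq> {c..d::real}"
  shows "\<Union>D \<in> lmeasurable" "(\<Sum>K\<in>D. Sup K - Inf K) = measure lebesgue (\<Union>D)"
proof -
  have K: "K \<in> lmeasurable \<and> integral K (\<lambda>x. 1::real) = Sup K - Inf K" if K: "K \<in> D" for K
  proof -
    obtain l u where "K = {l..u}" "l \<le> u" "Sup K = u" "Inf K = l"
      using division_of_realE assms(1) K by metis
    then show ?thesis by auto
  qed
  have "finite D" using assms(1) by blast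
  then show UD: "\<Union>D \<in> lmeasurable" using K by (intro fmeasurable.finite_Union) auto
  have "measure lebesgue (\<Union>D) = integral (\<Union>D) (\<lambda>x. 1)" using UD by (rule lmeasure_integral)
  also have "\<dots> = (\<Sum>K\<in>D. integral K (\<lambda>x. 1))"
    using assms(1) UD by (intro integral_combine_division_topdown) (auto simp: lmeasurable_iff_integrable_on)
  also have "\<dots> = (\<Sum>K\<in>D. Sup K - Inf K)" using K by simp
  finally show "(\<Sum>K\<in>D. Sup K - Inf K) = measure lebesgue (\<Union>D)" by simp
qed

text \<open>Finite unions of compact intervals have divisions, and an open set is to be exhausted by such
  unions.\<close>

lemma open_real_eq_countable_Icc:
  fixes V :: "real set"
  assumes "open V"
  obtains C where "V = (\<Union>n::nat. C n)" "\<And>n. \<exists>s t. C n = {s..t}"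
proof -
  define \<C> where "\<C> = (\<lambda>(s, t). {s..t}) ` {st \<in> \<rat> \<times> \<rat>. {fst st..snd st} \<subseteq> V}"
  have "countable \<C>"
    unfolding \<C>_def by (intro countable_image countable_Collect countable_SIGMA countable_rat)
  moreover have "(1, 0) \<in> {st \<in> \<rat> \<times> \<rat>. {fst st..snd st::real} \<subseteq> V}" by auto
  then have ne: "\<C> \<noteq> {}" unfolding \<C>_def by blast
  ultimately have range: "range (from_nat_into \<C>) = \<C>" by (rule range_from_nat_into[rotated])
  have "V = \<Union>\<C>"
  proof
    show "\<Union>\<C> \<subseteq> V" by (auto simp: \<C>_def)
    show "V \<subseteq> \<Union>\<C>"
    proof
      fix x assume "x \<in> V"
      then obtain e where e: "e > 0" "cball x e \<subseteq> V" using assms open_contains_cball by blast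
      obtain s where s: "s \<in> \<rat>" "x - e < s" "s < x" using Rats_dense_in_real[of "x - e" x] e by auto
      obtain t where t: "t \<in> \<rat>" "x < t" "t < x + e" using Rats_dense_in_real[of x "x + e"] e by auto
      have "{s..t} \<subseteq> cball x e" using s t by (auto simp: cball_eq_atLeastAtMost)
      then have "{s..t} \<subseteq> V" using e(2) by (rule order_trans)
      then have "(s, t) \<in> {st \<in> \<rat> \<times> \<rat>. {fst st..snd st} \<subseteq> V}" using s t by simp
      then have "{s..t} \<in> \<C>" unfolding \<C>_def by (rule rev_image_eqI) simp
      then show "x \<in> \<Union>\<C>" using s t by (intro UnionI[of "{s..t}"]) auto
    qed
  qed
  then have "V = (\<Union>n. from_nat_into \<C> n)" using range by auto
  moreover have "\<exists>s t. from_nat_into \<C> n = {s..t}" for n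
    using from_nat_into[OF ne, of n] by (auto simp: \<C>_def)
  ultimately show ?thesis by (rule that)
qed

text \<open>A null set lies in an open set of small Lebesgue measure. The finite unions of intervals that
  exhaust the open set have divisions of small total length, so absolute continuity bounds the
  increments of \<open>G\<close> over them, and with these the Stieltjes measure of the open set. The function
  \<open>G\<close> continues \<open>g\<close> by constants, so the complement of the interval carries no measure.\<close>

lemma interval_measure_absolutely_continuous:
  fixes g G :: "real \<Rightarrow> real"
  assumes ac: "absolutely_continuous_between c d g"
    and mono: "mono G" and cont: "continuous_on UNIV G"
    and low: "\<And>x. x \<le> c \<Longrightarrow> G x = G c" and high: "\<And>x. d \<le> x \<Longrightarrow> G x = G d"
    and eq: "\<And>x. x \<in> {c..d} \<Longrightarrow> G x = g x"
  shows "absolutely_continuous lborel (interval_measure G)"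
proof -
  define \<mu> where "\<mu> = interval_measure G"
  have sets: "sets \<mu> = sets borel" by (simp add: \<mu>_def)
  have Icc: "emeasure \<mu> {x..y} = ennreal (G y - G x)" if "x \<le> y" for x y
    unfolding \<mu>_def using that mono cont by (intro emeasure_interval_measure_Icc) (auto dest: monoD)
  have out: "emeasure \<mu> (UNIV - {c<..<d}) = 0"
  proof -
    have "{min (- real n) c..c} \<union> {d..max (real n) d} \<in> null_sets \<mu>" for n
      using Icc[of "min (- real n) c" c] Icc[of d "max (real n) d"] low[of "min (- real n) c"] high[of "max (real n) d"]
      by (intro null_sets.Un null_setsI) (auto simp: sets)
    then have "(\<Union>n. {min (- real n) c..c} \<union> {d..max (real n) d}) \<in> null_sets \<mu>" by (rule null_sets_UN)
    moreover have "UNIV - {c<..<d} \<subseteq> (\<Union>n. {min (- real n) c..c} \<union> {d..max (real n) d})"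
    proof
      fix x assume "x \<in> UNIV - {c<..<d}"
      moreover obtain n :: nat where "\<bar>x\<bar> \<le> real n" using real_arch_simple by blast
      ultimately show "x \<in> (\<Union>n. {min (- real n) c..c} \<union> {d..max (real n) d})"
        by (intro UN_I[of n]) auto
    qed
    moreover have "UNIV - {c<..<d} \<in> sets \<mu>" by (simp add: sets borel_comp)
    ultimately have "UNIV - {c<..<d} \<in> null_sets \<mu>" by (metis null_sets_subset)
    then show ?thesis by auto
  qed
  have small: "emeasure \<mu> N \<le> ennreal e" if N: "N \<in> null_sets lborel" "N \<subseteq> {c<..<d}" and e: "e > 0" for N and e :: real
  proof -
    obtain \<delta> where \<delta>: "\<delta> > 0" "\<And>D. D division_of \<Union>D \<Longrightarrow> \<Union>D \<subseteq> {c..d} \<Longrightarrow>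
      (\<Sum>K\<in>D. Sup K - Inf K) < \<delta> \<Longrightarrow> (\<Sum>K\<in>D. norm (g (Sup K) - g (Inf K))) < e"
      by (rule absolutely_continuous_betweenD[OF ac e]) (rule that; blast)
    have Nb: "N \<in> sets borel" using N by auto
    obtain U where U: "open U" "N \<subseteq> U" "emeasure lborel (U - N) < ennreal \<delta>"
      using outer_regular_lborel[OF Nb \<delta>(1)] by metis
    define V where "V = U \<inter> {c<..<d}"
    have V: "open V" "N \<subseteq> V" "V \<subseteq> {c<..<d}" using U N by (auto simp: V_def)
    have "emeasure lborel V \<le> emeasure lborel ((U - N) \<union> N)"
      using U Nb by (intro emeasure_mono) (auto simp: V_def)
    also have "\<dots> = emeasure lborel (U - N)"
      using N U by (intro emeasure_Un_null_set) auto
    finally have Vs: "emeasure lborel V < ennreal \<delta>" using U(3) by simp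
    obtain C where C: "V = (\<Union>n::nat. C n)" "\<And>n. \<exists>s t. C n = {s..t}"
      using open_real_eq_countable_Icc[OF V(1)] by metis
    define W where "W n = (\<Union>i<n. C i)" for n
    have Wb: "W n \<in> sets borel" for n
      unfolding W_def using C(2) by (intro sets.finite_UN) (auto, metis borel_closed closed_atLeastAtMost)
    have WV: "W n \<subseteq> V" for n using C(1) by (auto simp: W_def)
    have Wm: "emeasure \<mu> (W n) \<le> ennreal e" for n
    proof -
      have "finite (C ` {..<n})" "\<And>s. s \<in> C ` {..<n} \<Longrightarrow> \<exists>a b. s = cbox a b"
        using C(2) by (auto simp: cbox_interval)
      then obtain p where "p division_of \<Union>(C ` {..<n})"
        using elementary_unions_intervals by metis
      then have p: "p division_of (W n)" by (simp add: W_def)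
      then have pW: "\<Union>p = W n" by auto
      then have p': "p division_of \<Union>p" "\<Union>p \<subseteq> {c..d}" using p WV[of n] V(3) by auto
      have "ennreal (measure lebesgue (\<Union>p)) = emeasure lebesgue (\<Union>p)"
        using sum_lengths_division(1)[OF p'] by (simp add: emeasure_eq_measure2)
      also have "\<dots> = emeasure lborel (W n)" using Wb[of n] by (simp add: pW)
      also have "\<dots> \<le> emeasure lborel V" using WV V by (intro emeasure_mono) auto
      finally have "measure lebesgue (\<Union>p) < \<delta>" using Vs \<delta>(1)
        by (metis ennreal_less_iff measure_nonneg order_le_less_trans)
      then have sm: "(\<Sum>K\<in>p. norm (g (Sup K) - g (Inf K))) < e"
        using sum_lengths_division(2)[OF p'] by (intro \<delta>(2)[OF p']) auto
      have pK: "K \<in> sets \<mu> \<and> emeasure \<mu> K = ennreal (norm (g (Sup K) - g (Inf K)))" if "K \<in> p" for K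
      proof -
        obtain l u where K: "K = {l..u}" "l \<le> u" "Sup K = u" "Inf K = l"
          using division_of_realE p' \<open>K \<in> p\<close> by metis
        moreover have "K \<subseteq> {c..d}" using p' \<open>K \<in> p\<close> by blast
        ultimately have "G u = g u" "G l = g l" "G l \<le> G u" using eq mono by (auto dest: monoD)
        then show ?thesis using Icc[OF K(2)] K by (auto simp: sets)
      qed
      have "emeasure \<mu> (\<Union>p) \<le> (\<Sum>K\<in>p. emeasure \<mu> K)"
        using emeasure_subadditive_finite[of p "\<lambda>K. K" \<mu>] p pK by auto
      also have "\<dots> = ennreal (\<Sum>K\<in>p. norm (g (Sup K) - g (Inf K)))"
        using pK by (simp add: sum_ennreal)
      also have "\<dots> \<le> ennreal e" using sm by (intro ennreal_leI) simp
      finally show ?thesis using pW by simp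
    qed
    have "incseq W" unfolding W_def by (intro incseq_SucI) (auto simp: less_Suc_eq)
    moreover have "(\<Union>n. W n) = V" using C(1) by (auto simp: W_def)
    ultimately have "emeasure \<mu> V = (SUP n. emeasure \<mu> (W n))"
      using SUP_emeasure_incseq[of W \<mu>] Wb sets by (metis image_subsetI)
    also have "\<dots> \<le> ennreal e" using Wm by (intro SUP_least) auto
    finally have "emeasure \<mu> V \<le> ennreal e" .
    moreover have "emeasure \<mu> N \<le> emeasure \<mu> V" using V sets by (intro emeasure_mono) auto
    ultimately show ?thesis by simp
  qed
  show ?thesis
    unfolding absolutely_continuous_def \<mu>_def[symmetric]
  proof
    fix N :: "real set" assume N: "N \<in> null_sets lborel"
    have "N \<inter> {c<..<d} \<in> null_sets lborel" using N by (auto intro: null_set_Int2)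
    then have "emeasure \<mu> (N \<inter> {c<..<d}) \<le> ennreal e" if "e > 0" for e using small that by simp
    then have "emeasure \<mu> (N \<inter> {c<..<d}) = 0"
      by (metis ennreal_0 ennreal_le_epsilon add.left_neutral le_zero_eq)
    moreover have "emeasure \<mu> (N - {c<..<d}) = 0"
    proof -
      have "emeasure \<mu> (N - {c<..<d}) \<le> emeasure \<mu> (UNIV - {c<..<d})"
        using sets by (intro emeasure_mono) auto
      then show ?thesis using out by simp
    qed
    ultimately have "N \<inter> {c<..<d} \<in> null_sets \<mu>" "N - {c<..<d} \<in> null_sets \<mu>"
      using N by (simp_all add: null_sets_def sets sets.Int sets.Diff)
    then have "(N \<inter> {c<..<d}) \<union> (N - {c<..<d}) \<in> null_sets \<mu>" by (rule null_sets.Un)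
    moreover have "(N \<inter> {c<..<d}) \<union> (N - {c<..<d}) = N" by blast
    ultimately show "N \<in> null_sets \<mu>" by simp
  qed
qed

text \<open>The density is the Radon-Nikodym derivative of the Stieltjes measure of \<open>g\<close>.\<close>

lemma monotone_absolutely_continuous_primitive:
  fixes g :: "real \<Rightarrow> real"
  assumes ac: "absolutely_continuous_between c d g" and mono: "mono_on {c..d} g" and cd: "c \<le> d"
  shows "\<exists>h. primitive_on {c..d} g h"
proof -
  define G where "G x = g (max c (min d x))" for x
  have G: "mono G"
    using cd unfolding G_def by (intro monoI monotone_onD[OF mono]) auto
  have contG: "continuous_on UNIV G"
    unfolding G_def
    by (rule continuous_on_compose2[OF absolutely_continuous_between_continuous[OF ac]])
      (use cd in \<open>auto intro!: continuous_intros\<close>)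
  have Geq: "G x = g x" if "x \<in> {c..d}" for x using that by (auto simp: G_def max_def min_def)
  have acl: "absolutely_continuous lborel (interval_measure G)"
    by (rule interval_measure_absolutely_continuous[OF ac G contG]) (use cd Geq in \<open>auto simp: G_def\<close>)
  obtain h0 where h0: "h0 \<in> borel_measurable lborel" "density lborel h0 = interval_measure G"
    using sigma_finite_measure.Radon_Nikodym[OF sigma_finite_lborel acl] by auto
  note h0(1)[measurable]
  have nn: "(\<integral>\<^sup>+t. h0 t * indicator {x..y} t \<partial>lborel) = ennreal (g y - g x)"
    if "c \<le> x" "x \<le> y" "y \<le> d" for x y
  proof -
    have "(\<integral>\<^sup>+t. h0 t * indicator {x..y} t \<partial>lborel) = emeasure (density lborel h0) {x..y}"
      by (simp add: emeasure_density)
    also have "\<dots> = ennreal (G y - G x)"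
      unfolding h0(2) using that G contG by (intro emeasure_interval_measure_Icc) (auto dest: monoD)
    finally show ?thesis using that Geq by simp
  qed
  have fin: "AE t in lborel. h0 t * indicator {c..d} t \<noteq> \<infinity>"
    using nn[of c d] cd by (intro nn_integral_PInf_AE) auto
  define h where "h t = enn2real (h0 t)" for t
  have [measurable]: "h \<in> borel_measurable lborel" unfolding h_def by measurable
  have "h absolutely_integrable_on {x..y} \<and> (h has_integral (g y - g x)) {x..y}"
    if xy: "x \<in> {c..d}" "y \<in> {c..d}" "x \<le> y" for x y
  proof -
    have le: "g x \<le> g y" using xy by (intro monotone_onD[OF mono]) auto
    have "(\<integral>\<^sup>+t. ennreal (h t * indicat_real {x..y} t) \<partial>lborel) = (\<integral>\<^sup>+t. h0 t * indicator {x..y} t \<partial>lborel)"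
      by (intro nn_integral_cong_AE, use fin in eventually_elim)
        (use xy in \<open>auto simp: h_def indicator_def ennreal_enn2real_if\<close>)
    also have "\<dots> = ennreal (g y - g x)" using nn xy by auto
    finally have "integrable lborel (\<lambda>t. h t * indicat_real {x..y} t) \<and>
        integral\<^sup>L lborel (\<lambda>t. h t * indicat_real {x..y} t) = g y - g x"
      using le by (subst (asm) nn_integral_eq_integrable) (auto simp: h_def)
    then have *: "set_integrable lborel {x..y} h" "(LINT t:{x..y}|lborel. h t) = g y - g x"
      by (auto simp: set_integrable_def set_lebesgue_integral_def mult.commute)
    then have "h absolutely_integrable_on {x..y}"
      unfolding set_integrable_def by (subst integrable_completion) auto
    then show ?thesis
      using set_borel_integral_eq_integral[OF *(1)] *(2) by (auto simp: has_integral_iff)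
  qed
  then show ?thesis unfolding primitive_on_def by blast
qed

section \<open>Calculus of primitives\<close>

lemma primitive_on_linear:
  assumes "bounded_linear T" "primitive_on S F f"
  shows "primitive_on S (\<lambda>x. T (F x)) (\<lambda>x. T (f x))"
  unfolding primitive_on_def
proof (intro ballI impI conjI)
  fix x y assume xy: "x \<in> S" "y \<in> S" "x \<le> y"
  note P = primitive_onD[OF assms(2) xy]
  show "(\<lambda>x. T (f x)) absolutely_integrable_on {x..y}"
    using absolutely_integrable_linear[OF P(1) assms(1)] by (simp add: o_def)
  show "((\<lambda>x. T (f x)) has_integral T (F y) - T (F x)) {x..y}"
    using has_integral_linear[OF P(2) assms(1)] by (simp add: o_def linear_diff[OF bounded_linear.linear[OF assms(1)]])
qed

lemma primitive_on_add:
  assumes "primitive_on S F f" "primitive_on S G g"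
  shows "primitive_on S (\<lambda>x. F x + G x) (\<lambda>x. f x + g x)"
  unfolding primitive_on_def
proof (intro ballI impI conjI)
  fix x y assume xy: "x \<in> S" "y \<in> S" "x \<le> y"
  note P = primitive_onD[OF assms(1) xy] and Q = primitive_onD[OF assms(2) xy]
  show "(\<lambda>x. f x + g x) absolutely_integrable_on {x..y}" using P(1) Q(1) by (rule set_integral_add)
  show "((\<lambda>x. f x + g x) has_integral (F y + G y) - (F x + G x)) {x..y}"
    using has_integral_add[OF P(2) Q(2)] by (simp add: algebra_simps)
qed

lemma primitive_on_diff:
  assumes "primitive_on S F f" "primitive_on S G g"
  shows "primitive_on S (\<lambda>x. F x - G x) (\<lambda>x. f x - g x)"
  using primitive_on_add[OF assms(1) primitive_on_linear[OF _ assms(2), of uminus]]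
  by (simp add: bounded_linear_minus bounded_linear_ident)

lemma primitive_on_spike:
  assumes F: "primitive_on S F f" and N: "negligible N"
    and eq: "\<And>x. x \<in> S - N \<Longrightarrow> g x = f x" and S: "is_interval S"
  shows "primitive_on S F g"
  unfolding primitive_on_def
proof (intro ballI impI conjI)
  fix x y assume xy: "x \<in> S" "y \<in> S" "x \<le> y"
  note P = primitive_onD[OF F xy]
  have "{x..y} \<subseteq> S" using S xy by (meson interval_subset_is_interval[of S x y] interval_cbox is_interval_1 subsetI atLeastAtMost_iff)
  then have e: "\<And>t. t \<in> {x..y} - N \<Longrightarrow> g t = f t" using eq by blast
  show "g absolutely_integrable_on {x..y}" using absolutely_integrable_spike[OF P(1) N] e by blast
  show "(g has_integral F y - F x) {x..y}" using has_integral_spike[OF N _ P(2)] e by blast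
qed

lemma primitive_on_cong:
  assumes "primitive_on S F f" "\<And>x. x \<in> S \<Longrightarrow> F x = G x"
  shows "primitive_on S G f"
  using assms unfolding primitive_on_def by simp

lemma primitive_on_combine:
  assumes F: "primitive_on {c..m} F f" "primitive_on {m..d} F f" and m: "c \<le> m" "m \<le> d"
  shows "primitive_on {c..d} F f"
  unfolding primitive_on_def
proof (intro ballI impI)
  fix x y assume xy: "x \<in> {c..d}" "y \<in> {c..d}" "x \<le> y"
  consider "y \<le> m" | "m \<le> x" | "x < m" "m < y" by linarith
  then show "f absolutely_integrable_on {x..y} \<and> (f has_integral (F y - F x)) {x..y}"
  proof cases
    case 1 then show ?thesis using primitive_onD[OF F(1), of x y] xy by auto
  next
    case 2 then show ?thesis using primitive_onD[OF F(2), of x y] xy by auto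
  next
    case 3
    note P = primitive_onD[OF F(1), of x m] and Q = primitive_onD[OF F(2), of m y]
    have U: "{x..m} \<union> {m..y} = {x..y}" using 3 by auto
    have "f absolutely_integrable_on {x..m} \<union> {m..y}"
      using P(1) Q(1) 3 xy by (intro absolutely_integrable_Un) auto
    moreover have "(f has_integral (F m - F x) + (F y - F m)) {x..y}"
      using P(2) Q(2) 3 xy by (intro has_integral_combine[of x m y]) auto
    ultimately show ?thesis unfolding U by simp
  qed
qed

section \<open>The fundamental theorem of calculus\<close>

text \<open>If \<open>V\<close> is the variation of \<open>f\<close>, then \<open>V\<close>, \<open>V + Re f\<close> and \<open>V + Im f\<close> are absolutely
  continuous and increasing, and \<open>f\<close> is a linear combination of them.\<close>

lemma absolutely_continuous_between_primitive_short:
  fixes f :: "real \<Rightarrow> complex"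
  assumes ac: "absolutely_continuous_between c d f"
    and \<delta>: "\<And>D. D division_of \<Union>D \<Longrightarrow> \<Union>D \<subseteq> {c..d} \<Longrightarrow>
     (\<Sum>K\<in>D. Sup K - Inf K) < \<delta> \<Longrightarrow> (\<Sum>K\<in>D. norm (f (Sup K) - f (Inf K))) < 1"
    and short: "d - c < \<delta>" "c \<le> d"
  shows "\<exists>h. primitive_on {c..d} f h"
proof -
  define V where "V = variation f c"
  have V: "norm (f y - f x) \<le> V y - V x" if "c \<le> x" "x \<le> y" "y \<le> d" for x y
    unfolding V_def by (rule variation_properties(1)[OF ac \<delta> short]) (use that in auto)
  have Vac: "absolutely_continuous_between c d V"
    unfolding V_def by (rule variation_properties(2)[OF ac \<delta> short]) auto
  have *: "\<exists>h. primitive_on {c..d} (\<lambda>x. V x + u (f x)) h"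
    if u: "\<And>z w. \<bar>u z - u w\<bar> \<le> norm (z - w)" for u :: "complex \<Rightarrow> real"
  proof (rule monotone_absolutely_continuous_primitive[OF _ _ short(2)])
    show "absolutely_continuous_between c d (\<lambda>x. V x + u (f x))"
    proof (rule absolutely_continuous_between_dominated_add[OF Vac ac, of 1])
      fix x y
      show "norm (V y + u (f y) - (V x + u (f x))) \<le> 1 * norm (V y - V x) + 1 * norm (f y - f x)"
        using u[of "f y" "f x"] by (simp add: abs_le_iff) linarith
    qed simp
    show "mono_on {c..d} (\<lambda>x. V x + u (f x))"
    proof (rule mono_onI)
      fix x y assume "x \<in> {c..d}" "y \<in> {c..d}" "x \<le> y"
      then show "V x + u (f x) \<le> V y + u (f y)"
        using V[of x y] u[of "f y" "f x"] by auto
    qed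
  qed
  obtain h0 where h0: "primitive_on {c..d} (\<lambda>x. V x + 0) h0" using *[of "\<lambda>_. 0"] by auto
  obtain h1 where h1: "primitive_on {c..d} (\<lambda>x. V x + Re (f x)) h1"
    using *[of Re] abs_Re_le_cmod by (metis minus_complex.sel(1))
  obtain h2 where h2: "primitive_on {c..d} (\<lambda>x. V x + Im (f x)) h2"
    using *[of Im] abs_Im_le_cmod by (metis minus_complex.sel(2))
  have R: "primitive_on {c..d} (\<lambda>x. complex_of_real ((V x + Re (f x)) - (V x + 0)))
      (\<lambda>x. complex_of_real (h1 x - h0 x))"
    by (rule primitive_on_linear[OF bounded_linear_of_real primitive_on_diff[OF h1 h0]])
  have I: "primitive_on {c..d} (\<lambda>x. \<i> * complex_of_real ((V x + Im (f x)) - (V x + 0)))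
      (\<lambda>x. \<i> * complex_of_real (h2 x - h0 x))"
    by (rule primitive_on_linear[OF bounded_linear_mult_right
          primitive_on_linear[OF bounded_linear_of_real primitive_on_diff[OF h2 h0]]])
  have "primitive_on {c..d} f (\<lambda>x. complex_of_real (h1 x - h0 x) + \<i> * complex_of_real (h2 x - h0 x))"
    by (rule primitive_on_cong[OF primitive_on_add[OF R I]]) (simp add: complex_eq_iff)
  then show ?thesis by blast
qed

lemma primitive_on_vector_derivative:
  fixes f :: "real \<Rightarrow> 'b::euclidean_space"
  assumes "primitive_on {c..d} f h"
  shows "primitive_on {c..d} f (\<lambda>x. vector_derivative f (at x))"
proof -
  obtain N where N: "negligible N" "\<And>x. x \<in> {c<..<d} - N \<Longrightarrow> (f has_vector_derivative h x) (at x)"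
    using has_vector_derivative_primitive_interval[OF assms] by blast
  show ?thesis
  proof (rule primitive_on_spike[OF assms])
    show "negligible (N \<union> {c, d})" using N(1) by auto
    show "vector_derivative f (at x) = h x" if "x \<in> {c..d} - (N \<union> {c, d})" for x
      using N(2)[of x] that by (intro vector_derivative_at) auto
    show "is_interval {c..d}" by (rule is_interval_cc)
  qed
qed

text \<open>On short intervals there is some density. Almost everywhere it is the derivative of \<open>f\<close>, and
  as the derivative does not refer to the interval, short intervals can be joined to long ones.\<close>

theorem absolutely_continuous_between_primitive:
  fixes f :: "real \<Rightarrow> complex"
  assumes ac: "absolutely_continuous_between c d f" and cd: "c \<le> d"
  shows "primitive_on {c..d} f (\<lambda>x. vector_derivative f (at x))"
proof -
  obtain \<delta> where \<delta>: "\<delta> > 0" "\<And>D. D division_of \<Union>D \<Longrightarrow> \<Union>D \<subseteq> {c..d} \<Longrightarrow>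
     (\<Sum>K\<in>D. Sup K - Inf K) < \<delta> \<Longrightarrow> (\<Sum>K\<in>D. norm (f (Sup K) - f (Inf K))) < 1"
    by (rule absolutely_continuous_betweenD[OF ac zero_less_one]) (rule that; blast)
  define P where "P s t \<longleftrightarrow>
    (c \<le> s \<and> s \<le> t \<and> t \<le> d \<longrightarrow> primitive_on {s..t} f (\<lambda>x. vector_derivative f (at x)))" for s t
  from cd have "P c d"
  proof (induct rule: Bolzano)
    case (trans s m t)
    then show ?case unfolding P_def
      using primitive_on_combine[of s m f "\<lambda>x. vector_derivative f (at x)" t] by auto
  next
    case (local x)
    show ?case
    proof (intro exI[of _ \<delta>] conjI allI impI)
      fix s t assume st: "s \<le> x \<and> x \<le> t \<and> t - s < \<delta>"
      show "P s t"
        unfolding P_def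
      proof
        assume st': "c \<le> s \<and> s \<le> t \<and> t \<le> d"
        then have "absolutely_continuous_between s t f"
          using absolutely_continuous_between_subset[OF ac] by blast
        then have "\<exists>h. primitive_on {s..t} f h"
        proof (rule absolutely_continuous_between_primitive_short[of s t f \<delta>])
          fix D assume D: "D division_of \<Union>D" "\<Union>D \<subseteq> {s..t}" "(\<Sum>K\<in>D. Sup K - Inf K) < \<delta>"
          have "{s..t} \<subseteq> {c..d}" using st' by auto
          with D(2) have "\<Union>D \<subseteq> {c..d}" by (rule order_trans)
          then show "(\<Sum>K\<in>D. norm (f (Sup K) - f (Inf K))) < 1" by (rule \<delta>(2)[OF D(1) _ D(3)])
        qed (use st st' in auto)
        then show "primitive_on {s..t} f (\<lambda>x. vector_derivative f (at x))"
          using primitive_on_vector_derivative by blast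
      qed
    qed (use \<delta> in auto)
  qed
  then show ?thesis using cd by (simp add: P_def)
qed

lemma primitive_on_Icc_iff:
  assumes "is_interval S"
  shows "primitive_on S F f \<longleftrightarrow> (\<forall>x\<in>S. \<forall>y\<in>S. x \<le> y \<longrightarrow> primitive_on {x..y} F f)"
proof
  have sub: "{x..y} \<subseteq> S" if "x \<in> S" "y \<in> S" for x y
    using mem_is_interval_1_I[OF assms that] by auto
  show "primitive_on S F f \<Longrightarrow> \<forall>x\<in>S. \<forall>y\<in>S. x \<le> y \<longrightarrow> primitive_on {x..y} F f"
    using sub primitive_on_subset by blast
  show "\<forall>x\<in>S. \<forall>y\<in>S. x \<le> y \<longrightarrow> primitive_on {x..y} F f \<Longrightarrow> primitive_on S F f"
    unfolding primitive_on_def[of S] by (meson primitive_onD atLeastAtMost_iff order_refl)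
qed

lemma primitive_on_continuous_on:
  fixes F f :: "real \<Rightarrow> 'b::euclidean_space"
  assumes F: "primitive_on S F f" and S: "open S"
  shows "continuous_on S F"
proof (rule continuous_at_imp_continuous_on, rule ballI)
  fix x assume "x \<in> S"
  then obtain e where e: "e > 0" "cball x e \<subseteq> S" using S open_contains_cball by blast
  have "primitive_on {x - e..x + e} F f"
    using primitive_on_subset[OF F] e by (simp add: cball_eq_atLeastAtMost)
  then have "continuous_on {x - e..x + e} F"
    by (intro absolutely_continuous_between_continuous primitive_on_absolutely_continuous)
  then have "continuous_on {x - e<..<x + e} F" by (rule continuous_on_subset) auto
  then show "isCont F x" using e by (simp add: continuous_on_eq_continuous_at)
qed

text \<open>A product of absolutely continuous functions is absolutely continuous, hence the primitive of
  its derivative, and the product rule gives this derivative almost everywhere.\<close>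

lemma primitive_on_mult:
  fixes F G f g :: "real \<Rightarrow> complex"
  assumes F: "primitive_on S F f" and G: "primitive_on S G g" and S: "is_interval S"
  shows "primitive_on S (\<lambda>x. F x * G x) (\<lambda>x. f x * G x + F x * g x)"
  unfolding primitive_on_Icc_iff[OF S]
proof (intro ballI impI)
  fix c d assume cd: "c \<in> S" "d \<in> S" "c \<le> d"
  then have F': "primitive_on {c..d} F f" and G': "primitive_on {c..d} G g"
    using F G unfolding primitive_on_Icc_iff[OF S] by auto
  have acF: "absolutely_continuous_between c d F" and acG: "absolutely_continuous_between c d G"
    using F' G' by (auto intro: primitive_on_absolutely_continuous)
  obtain B where B: "\<And>x. x \<in> {c..d} \<Longrightarrow> norm (F x) \<le> B"
    using compact_continuous_image[OF absolutely_continuous_between_continuous[OF acF]]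
    by (metis compact_Icc compact_imp_bounded bounded_iff image_eqI)
  obtain C where C: "\<And>x. x \<in> {c..d} \<Longrightarrow> norm (G x) \<le> C"
    using compact_continuous_image[OF absolutely_continuous_between_continuous[OF acG]]
    by (metis compact_Icc compact_imp_bounded bounded_iff image_eqI)
  have "absolutely_continuous_between c d (\<lambda>x. F x * G x)"
  proof (rule absolutely_continuous_between_dominated_add[OF acF acG, of "max B C"])
    have "0 \<le> norm (F c)" by simp
    also have "norm (F c) \<le> B" using B cd by auto
    finally show "0 \<le> max B C" by simp
    fix x y assume xy: "x \<in> {c..d}" "y \<in> {c..d}"
    have "norm (F y * G y - F x * G x) = norm ((F y - F x) * G y + F x * (G y - G x))"
      by (simp add: algebra_simps)
    also have "\<dots> \<le> norm (F y - F x) * norm (G y) + norm (F x) * norm (G y - G x)"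
      by (metis norm_mult norm_triangle_ineq)
    also have "\<dots> \<le> norm (F y - F x) * max B C + max B C * norm (G y - G x)"
      using B[OF xy(1)] C[OF xy(2)] by (intro add_mono mult_left_mono mult_right_mono) auto
    finally show "norm (F y * G y - F x * G x) \<le> max B C * norm (F y - F x) + max B C * norm (G y - G x)"
      by (simp add: mult.commute)
  qed
  then have FG: "primitive_on {c..d} (\<lambda>x. F x * G x) (\<lambda>x. vector_derivative (\<lambda>x. F x * G x) (at x))"
    using cd by (intro absolutely_continuous_between_primitive)
  obtain N1 where N1: "negligible N1" "\<And>x. x \<in> {c<..<d} - N1 \<Longrightarrow> (F has_vector_derivative f x) (at x)"
    using has_vector_derivative_primitive_interval[OF F'] by blast
  obtain N2 where N2: "negligible N2" "\<And>x. x \<in> {c<..<d} - N2 \<Longrightarrow> (G has_vector_derivative g x) (at x)"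
    using has_vector_derivative_primitive_interval[OF G'] by blast
  show "primitive_on {c..d} (\<lambda>x. F x * G x) (\<lambda>x. f x * G x + F x * g x)"
  proof (rule primitive_on_spike[OF FG])
    show "negligible (N1 \<union> N2 \<union> {c, d})" using N1(1) N2(1) by auto
    show "f x * G x + F x * g x = vector_derivative (\<lambda>x. F x * G x) (at x)"
      if "x \<in> {c..d} - (N1 \<union> N2 \<union> {c, d})" for x
    proof -
      have "((\<lambda>x. F x * G x) has_vector_derivative F x * g x + f x * G x) (at x)"
        using N1(2)[of x] N2(2)[of x] that by (intro has_vector_derivative_mult) auto
      then show ?thesis by (simp add: vector_derivative_at add.commute)
    qed
    show "is_interval {c..d}" by (rule is_interval_cc)
  qed
qed

lemma continuous_AE_eq_imp_eq:
  fixes f g :: "real \<Rightarrow> 'b::real_normed_vector"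
  assumes S: "open S" and f: "continuous_on S f" and g: "continuous_on S g"
    and ae: "AE x in lebesgue_on S. f x = g x" and x: "x \<in> S"
  shows "f x = g x"
proof (rule ccontr)
  assume ne: "f x \<noteq> g x"
  have Sl: "S \<in> sets lebesgue" using S by (simp add: borel_open sets_completionI_sets)
  obtain N where N: "negligible N" "\<forall>x\<in>S - N. f x = g x"
    using ae AE_lebesgue_on_iff_negligible[OF Sl] by blast
  have "continuous_on S (\<lambda>x. norm (f x - g x))" using f g by (intro continuous_intros)
  then have "open ((\<lambda>x. norm (f x - g x)) -` {0<..} \<inter> S)"
    using continuous_open_preimage[OF _ S open_greaterThan] by (metis Int_commute)
  moreover have "x \<in> (\<lambda>x. norm (f x - g x)) -` {0<..} \<inter> S" using x ne by simp
  moreover have "(\<lambda>x. norm (f x - g x)) -` {0<..} \<inter> S \<subseteq> N" using N(2) by auto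
  ultimately show False using N(1) open_not_negligible negligible_subset by blast
qed

section \<open>Quasi-derivatives\<close>

locale sturm_liouville =
  fixes a b :: ereal and p q r :: "real \<Rightarrow> real"
  assumes ab: "a < b" and coeff: "sl_coefficients a b p q r"
begin

abbreviation I :: "real set" where "I \<equiv> einterval a b"
abbreviation M :: "real measure" where "M \<equiv> sl_measure a b r"
abbreviation "\<D> \<equiv> max_dom a b p q r"
abbreviation "\<tau> \<equiv> sl_expr a b p q r"

text \<open>The equation \<open>\<tau> y = w\<close> as a first order system for \<open>y\<close> and its quasi-derivative \<open>y1\<close>. In
  integrated form the system has no exceptional null sets, and solutions can be combined and
  constructed without choosing representatives of derivatives.\<close>

definition sl_pair :: "(real \<Rightarrow> complex) \<Rightarrow> (real \<Rightarrow> complex) \<Rightarrow> (real \<Rightarrow> complex) \<Rightarrow> bool" where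
  "sl_pair y y1 w \<longleftrightarrow>
     primitive_on I y (\<lambda>x. y1 x / complex_of_real (p x)) \<and>
     primitive_on I y1 (\<lambda>x. complex_of_real (q x) * y x - complex_of_real (r x) * w x)"

lemma open_I: "open I" by (rule open_einterval)

lemma is_interval_I: "is_interval I"
  unfolding is_interval_1
proof (intro ballI allI impI)
  fix s t x assume "s \<in> I" "t \<in> I" "s \<le> x \<and> x \<le> t"
  then show "x \<in> I"
    using less_le_trans[of a "ereal s" "ereal x"] le_less_trans[of "ereal x" "ereal t" b]
    by (simp add: einterval_def)
qed

lemma I_sub: "x \<in> I \<Longrightarrow> y \<in> I \<Longrightarrow> {x..y} \<subseteq> I"
  using mem_is_interval_1_I[OF is_interval_I] by (meson atLeastAtMost_iff subsetI)

lemma I_lebesgue: "I \<in> sets lebesgue"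
  by (simp add: borel_einterval sets_completionI_sets)

lemma AE_pos: "AE x in lebesgue_on I. 0 < p x" "AE x in lebesgue_on I. 0 < r x"
  using coeff by (auto simp: sl_coefficients_def)

lemma AC_loc_imp_primitive:
  assumes "AC_loc a b f"
  shows "primitive_on I f (\<lambda>x. vector_derivative f (at x))"
  unfolding primitive_on_Icc_iff[OF is_interval_I]
proof (intro ballI impI)
  fix x y assume "x \<in> I" "y \<in> I" "x \<le> y"
  then show "primitive_on {x..y} f (\<lambda>x. vector_derivative f (at x))"
    using assms I_sub[of x y] unfolding AC_loc_def abs_cont_on_iff
    by (intro absolutely_continuous_between_primitive) auto
qed

lemma primitive_imp_AC_loc: "primitive_on I f h \<Longrightarrow> AC_loc a b f"
  unfolding AC_loc_def abs_cont_on_iff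
  by (auto intro: primitive_on_absolutely_continuous primitive_on_subset)

lemma primitive_on_AE_cong:
  assumes "primitive_on I F f" "AE x in lebesgue_on I. g x = f x"
  shows "primitive_on I F g"
proof -
  obtain N where "negligible N" "\<forall>x\<in>I - N. g x = f x"
    using assms(2) AE_lebesgue_on_iff_negligible[OF I_lebesgue] by blast
  then show ?thesis using primitive_on_spike[OF assms(1) _ _ is_interval_I] by blast
qed

lemma primitive_vector_derivative_AE:
  fixes F f :: "real \<Rightarrow> complex"
  assumes "primitive_on I F f"
  shows "AE x in lebesgue_on I. vector_derivative F (at x) = f x"
  using primitive_on_has_vector_derivative[OF assms open_I]
  by eventually_elim (rule vector_derivative_at)

lemma is_qderiv_qderiv: "sl_regular a b p y \<Longrightarrow> is_qderiv a b p y (qderiv a b p y)"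
  unfolding sl_regular_def qderiv_def by (rule someI_ex[of "is_qderiv a b p y"]) (erule conjunct2)

lemma sl_regular_pair:
  assumes "sl_regular a b p y"
  shows "sl_pair y (qderiv a b p y) (\<tau> y)"
proof -
  define h where "h = qderiv a b p y"
  have h: "AC_loc a b h" "AE x in lebesgue_on I. h x = p x *\<^sub>R vector_derivative y (at x)"
    using is_qderiv_qderiv[OF assms] by (auto simp: is_qderiv_def h_def)
  have y: "AC_loc a b y" using assms by (auto simp: sl_regular_def)
  have "primitive_on I y (\<lambda>x. h x / complex_of_real (p x))"
    by (rule primitive_on_AE_cong[OF AC_loc_imp_primitive[OF y]], use h(2) AE_pos(1) in eventually_elim)
      (simp add: scaleR_conv_of_real)
  moreover have "primitive_on I h (\<lambda>x. complex_of_real (q x) * y x - complex_of_real (r x) * \<tau> y x)"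
    by (rule primitive_on_AE_cong[OF AC_loc_imp_primitive[OF h(1)]], use AE_pos(2) in eventually_elim)
      (simp add: sl_expr_def h_def scaleR_conv_of_real)
  ultimately show ?thesis unfolding sl_pair_def h_def by blast
qed

text \<open>The chosen quasi-derivative and \<open>y1\<close> are continuous and agree almost everywhere, hence
  everywhere on the interval.\<close>

lemma sl_pairD:
  assumes "sl_pair y y1 w"
  shows "sl_regular a b p y" "\<And>x. x \<in> I \<Longrightarrow> qderiv a b p y x = y1 x"
    "AE x in lebesgue_on I. \<tau> y x = w x"
proof -
  have P: "primitive_on I y (\<lambda>x. y1 x / complex_of_real (p x))"
    "primitive_on I y1 (\<lambda>x. complex_of_real (q x) * y x - complex_of_real (r x) * w x)"
    using assms by (auto simp: sl_pair_def)
  have "AE x in lebesgue_on I. y1 x = p x *\<^sub>R vector_derivative y (at x)"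
    using primitive_vector_derivative_AE[OF P(1)] AE_pos(1)
    by eventually_elim (simp add: scaleR_conv_of_real)
  then have y1: "is_qderiv a b p y y1"
    using primitive_imp_AC_loc[OF P(2)] by (simp add: is_qderiv_def)
  then show reg: "sl_regular a b p y"
    using primitive_imp_AC_loc[OF P(1)] by (auto simp: sl_regular_def)
  define h where "h = qderiv a b p y"
  have h: "is_qderiv a b p y h" using is_qderiv_qderiv[OF reg] by (simp add: h_def)
  have hp: "primitive_on I h (\<lambda>x. vector_derivative h (at x))"
    using h by (auto simp: is_qderiv_def intro: AC_loc_imp_primitive)
  have "AE x in lebesgue_on I. h x = y1 x"
    using h y1 by (auto simp: is_qderiv_def elim: eventually_elim2)
  then show eq: "qderiv a b p y x = y1 x" if "x \<in> I" for x
    using continuous_AE_eq_imp_eq[OF open_I primitive_on_continuous_on[OF hp open_I]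
        primitive_on_continuous_on[OF P(2) open_I]] that by (simp add: h_def)
  then have "primitive_on I h (\<lambda>x. complex_of_real (q x) * y x - complex_of_real (r x) * w x)"
    by (intro primitive_on_cong[OF P(2)]) (simp add: h_def)
  from primitive_vector_derivative_AE[OF this]
  show "AE x in lebesgue_on I. \<tau> y x = w x"
    using AE_pos(2)
    by eventually_elim (simp add: sl_expr_def h_def scaleR_conv_of_real)
qed

lemma sl_pair_cong:
  assumes "sl_pair y y1 w" "\<And>x. x \<in> I \<Longrightarrow> y x = y' x" "\<And>x. x \<in> I \<Longrightarrow> y1 x = y1' x"
    and "AE x in lebesgue_on I. w' x = w x"
  shows "sl_pair y' y1' w'"
proof -
  have Iae: "AE x in lebesgue_on I. x \<in> I" by (rule AE_I2) (simp add: space_restrict_space)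
  have "primitive_on I y' (\<lambda>x. y1 x / complex_of_real (p x))"
    using assms by (auto simp: sl_pair_def intro: primitive_on_cong)
  then have "primitive_on I y' (\<lambda>x. y1' x / complex_of_real (p x))"
    by (rule primitive_on_AE_cong) (use Iae in eventually_elim, simp add: assms(3))
  moreover have "primitive_on I y1' (\<lambda>x. complex_of_real (q x) * y x - complex_of_real (r x) * w x)"
    using assms by (auto simp: sl_pair_def intro: primitive_on_cong)
  then have "primitive_on I y1' (\<lambda>x. complex_of_real (q x) * y' x - complex_of_real (r x) * w' x)"
    by (rule primitive_on_AE_cong) (use Iae assms(4) in eventually_elim, simp add: assms(2))
  ultimately show ?thesis by (simp add: sl_pair_def)
qed

lemma sl_pair_add:
  assumes "sl_pair y y1 w" "sl_pair u u1 v"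
  shows "sl_pair (\<lambda>x. y x + u x) (\<lambda>x. y1 x + u1 x) (\<lambda>x. w x + v x)"
  using primitive_on_add[of I y _ u] primitive_on_add[of I y1 _ u1] assms unfolding sl_pair_def
  by (fastforce simp: algebra_simps add_divide_distrib)

lemma sl_pair_scale:
  assumes "sl_pair y y1 w"
  shows "sl_pair (\<lambda>x. c * y x) (\<lambda>x. c * y1 x) (\<lambda>x. c * w x)"
proof -
  have P: "primitive_on I y (\<lambda>x. y1 x / complex_of_real (p x))"
    "primitive_on I y1 (\<lambda>x. complex_of_real (q x) * y x - complex_of_real (r x) * w x)"
    using assms by (auto simp: sl_pair_def)
  note primitive_on_linear[OF bounded_linear_mult_right P(1), of c]
    and primitive_on_linear[OF bounded_linear_mult_right P(2), of c]
  then show ?thesis by (simp add: sl_pair_def algebra_simps)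
qed

lemma sl_pair_cnj:
  assumes "sl_pair y y1 w"
  shows "sl_pair (\<lambda>x. cnj (y x)) (\<lambda>x. cnj (y1 x)) (\<lambda>x. cnj (w x))"
proof -
  have P: "primitive_on I y (\<lambda>x. y1 x / complex_of_real (p x))"
    "primitive_on I y1 (\<lambda>x. complex_of_real (q x) * y x - complex_of_real (r x) * w x)"
    using assms by (auto simp: sl_pair_def)
  note primitive_on_linear[OF bounded_linear_cnj P(1)] and primitive_on_linear[OF bounded_linear_cnj P(2)]
  then show ?thesis by (simp add: sl_pair_def)
qed

text \<open>Lagrange's identity: in the product rule the terms with \<open>p\<close> and with \<open>q\<close> cancel.\<close>

lemma sl_pair_wronskian:
  assumes "sl_pair f f1 u" "sl_pair g g1 v"
  shows "primitive_on I (\<lambda>x. f x * g1 x - f1 x * g x)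
     (\<lambda>x. complex_of_real (r x) * (u x * g x - f x * v x))"
proof -
  have P: "primitive_on I f (\<lambda>x. f1 x / complex_of_real (p x))"
    "primitive_on I f1 (\<lambda>x. complex_of_real (q x) * f x - complex_of_real (r x) * u x)"
    "primitive_on I g (\<lambda>x. g1 x / complex_of_real (p x))"
    "primitive_on I g1 (\<lambda>x. complex_of_real (q x) * g x - complex_of_real (r x) * v x)"
    using assms by (auto simp: sl_pair_def)
  show ?thesis
    using primitive_on_diff[OF primitive_on_mult[OF P(1,4) is_interval_I] primitive_on_mult[OF P(2,3) is_interval_I]]
    by (rule back_subst[of "\<lambda>h. primitive_on I (\<lambda>x. f x * g1 x - f1 x * g x) h"]) (auto simp: algebra_simps)
qed

end

section \<open>Square-integrable functions\<close>

definition inner_product :: "'a measure \<Rightarrow> ('a \<Rightarrow> complex) \<Rightarrow> ('a \<Rightarrow> complex) \<Rightarrow> complex" where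
  "inner_product M f g = (\<integral>x. cnj (f x) * g x \<partial>M)"

definition norm_sq :: "'a measure \<Rightarrow> ('a \<Rightarrow> complex) \<Rightarrow> real" where
  "norm_sq M f = (\<integral>x. (cmod (f x))\<^sup>2 \<partial>M)"

lemma borel_measurable_cnj: "f \<in> borel_measurable M \<Longrightarrow> (\<lambda>x. cnj (f x)) \<in> borel_measurable M"
  by (rule borel_measurable_continuous_on[of cnj]) (auto intro: continuous_intros)

lemma sq_integrableD:
  assumes "sq_integrable M f"
  shows "f \<in> borel_measurable M" "integrable M (\<lambda>x. (cmod (f x))\<^sup>2)"
  using assms by (auto simp: sq_integrable_def)

lemma sq_integrable_bound:
  assumes "sq_integrable M f" "sq_integrable M g" "h \<in> borel_measurable M"
    and "AE x in M. (cmod (h x))\<^sup>2 \<le> C * (cmod (f x))\<^sup>2 + C * (cmod (g x))\<^sup>2"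
  shows "sq_integrable M h"
  unfolding sq_integrable_def
proof
  have "integrable M (\<lambda>x. C * (cmod (f x))\<^sup>2 + C * (cmod (g x))\<^sup>2)"
    using assms by (auto simp: sq_integrable_def)
  then show "integrable M (\<lambda>x. (cmod (h x))\<^sup>2)"
    by (rule Bochner_Integration.integrable_bound)
      (use assms in \<open>auto elim!: eventually_mono\<close>)
qed (use assms in auto)

lemma cmod_add_sq_le: "(cmod (x + y))\<^sup>2 \<le> 2 * (cmod x)\<^sup>2 + 2 * (cmod y)\<^sup>2"
proof -
  have "(cmod (x + y))\<^sup>2 \<le> (cmod x + cmod y)\<^sup>2" by (intro power_mono norm_triangle_ineq) auto
  also have "\<dots> \<le> 2 * (cmod x)\<^sup>2 + 2 * (cmod y)\<^sup>2"
    using sum_squares_bound[of "cmod x" "cmod y"] by (simp add: power2_sum)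
  finally show ?thesis .
qed

lemma sq_integrable_add:
  assumes "sq_integrable M f" "sq_integrable M g"
  shows "sq_integrable M (\<lambda>x. f x + g x)"
  by (rule sq_integrable_bound[OF assms, of _ 2])
    (use assms in \<open>auto simp: sq_integrable_def cmod_add_sq_le\<close>)

lemma sq_integrable_scale: "sq_integrable M f \<Longrightarrow> sq_integrable M (\<lambda>x. c * f x)"
  by (auto simp: sq_integrable_def norm_mult power_mult_distrib)

lemma sq_integrable_diff:
  assumes "sq_integrable M f" "sq_integrable M g"
  shows "sq_integrable M (\<lambda>x. f x - g x)"
  using sq_integrable_add[OF assms(1) sq_integrable_scale[OF assms(2), of "-1"]] by simp

lemma sq_integrable_cnj: "sq_integrable M f \<Longrightarrow> sq_integrable M (\<lambda>x. cnj (f x))"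
  by (auto simp: sq_integrable_def intro!: borel_measurable_cnj)

lemma sq_integrable_zero: "sq_integrable M (\<lambda>x. 0)"
  by (simp add: sq_integrable_def)

lemma sq_integrable_AE_cong:
  assumes "sq_integrable M f" "g \<in> borel_measurable M" "AE x in M. g x = f x"
  shows "sq_integrable M g"
  by (rule sq_integrable_bound[OF assms(1,1,2), of 1]) (use assms(3) in \<open>auto elim!: eventually_mono\<close>)

lemma integrable_cnj_mult:
  assumes "sq_integrable M f" "sq_integrable M g"
  shows "integrable M (\<lambda>x. f x * g x)" "integrable M (\<lambda>x. cnj (f x) * g x)"
proof -
  have I: "integrable M (\<lambda>x. (cmod (f x))\<^sup>2 + (cmod (g x))\<^sup>2)"
    using assms by (auto simp: sq_integrable_def)
  have B: "norm (x * y) \<le> norm ((cmod x)\<^sup>2 + (cmod y)\<^sup>2)" for x y :: complex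
    using sum_squares_bound[of "cmod x" "cmod y"] zero_le_power2[of "cmod x"] zero_le_power2[of "cmod y"]
      mult_nonneg_nonneg[OF norm_ge_zero norm_ge_zero, of x y]
    unfolding norm_mult real_norm_def by linarith
  show "integrable M (\<lambda>x. f x * g x)"
    by (rule Bochner_Integration.integrable_bound[OF I]) (use assms B in \<open>auto simp: sq_integrable_def\<close>)
  show "integrable M (\<lambda>x. cnj (f x) * g x)"
    by (rule Bochner_Integration.integrable_bound[OF I])
      (use assms B[of "cnj (f x)" "g x" for x] in \<open>auto simp: sq_integrable_def intro!: borel_measurable_times borel_measurable_cnj\<close>)
qed

lemma inner_product_diff_right:
  assumes "sq_integrable M f" "sq_integrable M g" "sq_integrable M h"
  shows "inner_product M f (\<lambda>x. g x - h x) = inner_product M f g - inner_product M f h"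
  using assms unfolding inner_product_def
  by (simp add: right_diff_distrib integrable_cnj_mult)

lemma inner_product_self: "inner_product M f f = complex_of_real (norm_sq M f)"
  unfolding inner_product_def norm_sq_def
  by (simp add: mult.commute complex_norm_square[symmetric] flip: integral_complex_of_real of_real_power)

lemma inner_product_commute: "inner_product M g f = cnj (inner_product M f g)"
proof -
  have "cnj (inner_product M f g) = (\<integral>x. cnj (cnj (f x) * g x) \<partial>M)"
    unfolding inner_product_def by (rule Bochner_Integration.integral_cnj[symmetric])
  also have "\<dots> = inner_product M g f" unfolding inner_product_def by (simp add: mult.commute)
  finally show ?thesis by simp
qed

lemma norm_sq_nonneg [simp]: "0 \<le> norm_sq M f"
  unfolding norm_sq_def by simp

lemma norm_sq_diff_commute: "norm_sq M (\<lambda>x. f x - g x) = norm_sq M (\<lambda>x. g x - f x)"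
  unfolding norm_sq_def by (simp add: norm_minus_commute)

lemma norm_sq_scale: "norm_sq M (\<lambda>x. c * f x) = (cmod c)\<^sup>2 * norm_sq M f"
  unfolding norm_sq_def by (simp add: norm_mult power_mult_distrib)

lemma norm_sq_diff_scale:
  assumes h: "sq_integrable M h" and f: "sq_integrable M f"
  shows "norm_sq M (\<lambda>x. h x - c * f x) =
    norm_sq M h - 2 * Re (c * inner_product M h f) + (cmod c)\<^sup>2 * norm_sq M f"
proof -
  have e: "(cmod (x - c * y))\<^sup>2 = (cmod x)\<^sup>2 - 2 * Re (c * (cnj x * y)) + (cmod c)\<^sup>2 * (cmod y)\<^sup>2" for x y
    unfolding cmod_power2 by (simp add: power2_eq_square algebra_simps)
  have i: "integrable M (\<lambda>x. c * (cnj (h x) * f x))" using integrable_cnj_mult[OF h f] by simp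
  define k where "k x = Re (c * (cnj (h x) * f x))" for x
  have k: "integrable M k" unfolding k_def[abs_def] using i by (rule integrable_Re)
  have "norm_sq M (\<lambda>x. h x - c * f x) =
    (\<integral>x. (cmod (h x))\<^sup>2 - 2 * k x + (cmod c)\<^sup>2 * (cmod (f x))\<^sup>2 \<partial>M)"
    unfolding norm_sq_def e k_def ..
  also have "\<dots> = norm_sq M h - 2 * (\<integral>x. k x \<partial>M) + (cmod c)\<^sup>2 * norm_sq M f"
    unfolding norm_sq_def
    using sq_integrableD(2)[OF h] sq_integrableD(2)[OF f] k by simp
  also have "(\<integral>x. k x \<partial>M) = Re (c * inner_product M h f)"
    unfolding inner_product_def k_def integral_mult_right_zero[symmetric] using i by (rule integral_Re)
  finally show ?thesis .
qed

lemma norm_sq_add_le: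
  assumes "sq_integrable M f" "sq_integrable M g"
  shows "norm_sq M (\<lambda>x. f x + g x) \<le> 2 * norm_sq M f + 2 * norm_sq M g"
proof -
  have "norm_sq M (\<lambda>x. f x + g x) \<le> (\<integral>x. 2 * (cmod (f x))\<^sup>2 + 2 * (cmod (g x))\<^sup>2 \<partial>M)"
    unfolding norm_sq_def
    using assms sq_integrable_add[OF assms] by (intro integral_mono cmod_add_sq_le) (auto simp: sq_integrable_def)
  also have "\<dots> = 2 * norm_sq M f + 2 * norm_sq M g"
    using assms unfolding norm_sq_def by (simp add: sq_integrable_def)
  finally show ?thesis .
qed

lemma norm_sq_parallelogram:
  assumes "sq_integrable M f" "sq_integrable M g"
  shows "norm_sq M (\<lambda>x. f x - g x) + norm_sq M (\<lambda>x. f x + g x) = 2 * norm_sq M f + 2 * norm_sq M g"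
  using norm_sq_diff_scale[OF assms, of 1] norm_sq_diff_scale[OF assms, of "-1"] by simp

lemma norm_sq_eq_0_iff:
  assumes "sq_integrable M f"
  shows "norm_sq M f = 0 \<longleftrightarrow> (AE x in M. f x = 0)"
  unfolding norm_sq_def using integral_nonneg_eq_0_iff_AE[OF sq_integrableD(2)[OF assms]] by simp

text \<open>The Cauchy-Schwarz inequality, from the optimal \<open>t\<close> in the norm of \<open>f - t * cnj S * g\<close>, where
  \<open>S\<close> is the inner product.\<close>

lemma inner_product_bound:
  assumes f: "sq_integrable M f" and g: "sq_integrable M g"
  shows "(cmod (inner_product M f g))\<^sup>2 \<le> norm_sq M f * norm_sq M g"
proof -
  let ?S = "inner_product M f g"
  have *: "2 * t * (cmod ?S)\<^sup>2 \<le> norm_sq M f + t\<^sup>2 * (cmod ?S)\<^sup>2 * norm_sq M g" for t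
  proof -
    have "0 \<le> norm_sq M (\<lambda>x. f x - (of_real t * cnj ?S) * g x)" by simp
    also have "\<dots> = norm_sq M f - 2 * Re ((of_real t * cnj ?S) * ?S) + (cmod (of_real t * cnj ?S))\<^sup>2 * norm_sq M g"
      by (rule norm_sq_diff_scale[OF f g])
    also have "(of_real t * cnj ?S) * ?S = of_real t * (?S * cnj ?S)" by (simp only: mult_ac)
    also have "\<dots> = of_real (t * (cmod ?S)\<^sup>2)"
      by (simp only: complex_norm_square[symmetric] of_real_mult)
    finally show ?thesis by (simp add: norm_mult power_mult_distrib)
  qed
  show ?thesis
  proof (cases "norm_sq M g = 0")
    case True
    have "(cmod ?S)\<^sup>2 = 0"
    proof (rule ccontr)
      assume "(cmod ?S)\<^sup>2 \<noteq> 0"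
      then have "(cmod ?S)\<^sup>2 > 0" by simp
      then show False
        using *[of "(norm_sq M f + 1) / (2 * (cmod ?S)\<^sup>2)"] True by (simp add: field_simps)
    qed
    then show ?thesis using True by simp
  next
    case False
    then have p: "norm_sq M g > 0" using norm_sq_nonneg[of M g] by linarith
    have "2 * (cmod ?S)\<^sup>2 / norm_sq M g \<le> norm_sq M f + (cmod ?S)\<^sup>2 / norm_sq M g"
      using *[of "1 / norm_sq M g"] p by (simp add: field_simps power2_eq_square)
    then show ?thesis using p by (simp add: field_simps)
  qed
qed

lemma inner_product_tendsto:
  assumes f: "sq_integrable M f" and g: "\<And>n. sq_integrable M (g n)" "sq_integrable M h"
    and lim: "(\<lambda>n. norm_sq M (\<lambda>x. g n x - h x)) \<longlonglongrightarrow> 0"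
  shows "(\<lambda>n. inner_product M f (g n)) \<longlonglongrightarrow> inner_product M f h"
proof -
  have "(\<lambda>n. norm_sq M f * norm_sq M (\<lambda>x. g n x - h x)) \<longlonglongrightarrow> 0"
    using tendsto_mult_right_zero[OF lim] by simp
  then have "(\<lambda>n. (cmod (inner_product M f (\<lambda>x. g n x - h x)))\<^sup>2) \<longlonglongrightarrow> 0"
    by (rule Lim_null_comparison[rotated])
      (use inner_product_bound[OF f sq_integrable_diff[OF g]] in simp)
  then have "(\<lambda>n. cmod (inner_product M f (\<lambda>x. g n x - h x))) \<longlonglongrightarrow> 0"
    using tendsto_real_sqrt by fastforce
  then have "(\<lambda>n. inner_product M f (g n) - inner_product M f h) \<longlonglongrightarrow> 0"
    using g f by (simp add: inner_product_diff_right tendsto_norm_zero_iff)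
  then show ?thesis by (rule LIM_zero_cancel)
qed

section \<open>Completeness and orthogonal projection\<close>

text \<open>Along a rapidly converging subsequence with differences \<open>\<Delta> j\<close> the sum of \<open>2^j * (cmod (\<Delta> j x))\<^sup>2\<close>
  is integrable, hence finite for almost every \<open>x\<close>. As \<open>cmod (\<Delta> j x)\<close> is at most
  \<open>2^j * (cmod (\<Delta> j x))\<^sup>2 + (1/2)^j\<close>, the subsequence converges almost everywhere, and Fatou's lemma
  turns this into convergence of the whole sequence in the mean.\<close>

lemma riesz_fischer:
  assumes f: "\<And>n. sq_integrable M (f n)"
    and cauchy: "\<And>e. e > 0 \<Longrightarrow> \<exists>N. \<forall>m\<ge>N. \<forall>n\<ge>N. norm_sq M (\<lambda>x. f m x - f n x) < e"
  obtains g where "sq_integrable M g" "(\<lambda>n. norm_sq M (\<lambda>x. f n x - g x)) \<longlonglongrightarrow> 0"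
proof -
  have [measurable]: "f n \<in> borel_measurable M" for n using f by (auto simp: sq_integrable_def)
  have nn: "(\<integral>\<^sup>+x. ennreal ((cmod (f m x - f n x))\<^sup>2) \<partial>M) = ennreal (norm_sq M (\<lambda>x. f m x - f n x))" for m n
    unfolding norm_sq_def using sq_integrable_diff[OF f f, of m n]
    by (intro nn_integral_eq_integral) (auto simp: sq_integrable_def)
  have "\<forall>j. \<exists>N. \<forall>m\<ge>N. \<forall>n\<ge>N. norm_sq M (\<lambda>x. f m x - f n x) < (1/8)^j"
    using cauchy by simp
  then obtain N where N: "\<And>j m n. m \<ge> N j \<Longrightarrow> n \<ge> N j \<Longrightarrow> norm_sq M (\<lambda>x. f m x - f n x) < (1/8)^j"
    by metis
  \<comment> \<open>the sum dominates every \<open>N i\<close> with \<open>i \<le> j\<close>, so \<open>k j\<close> and \<open>k (Suc j)\<close> are both past \<open>N j\<close>\<close>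
  define k where "k j = (\<Sum>i\<le>j. N i) + j" for j :: nat
  have kN: "k j \<ge> N j" "k (Suc j) \<ge> N j" "k j \<ge> j" for j
    using member_le_sum[of j "{..j}" N] by (auto simp: k_def)
  define s where "s j = f (k j)" for j
  have [measurable]: "s j \<in> borel_measurable M" for j by (simp add: s_def)
  define \<Delta> where "\<Delta> j x = s (Suc j) x - s j x" for j x
  have [measurable]: "\<Delta> j \<in> borel_measurable M" for j by (simp add: \<Delta>_def[abs_def])
  have "(\<integral>\<^sup>+x. (\<Sum>j. ennreal (2^j * (cmod (\<Delta> j x))\<^sup>2)) \<partial>M) =
      (\<Sum>j. \<integral>\<^sup>+x. ennreal (2^j * (cmod (\<Delta> j x))\<^sup>2) \<partial>M)"
    by (intro nn_integral_suminf) measurable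
  also have "\<dots> \<le> (\<Sum>j. ennreal ((1/4)^j))"
  proof (intro suminf_le)
    fix j
    have "(\<integral>\<^sup>+x. ennreal (2^j * (cmod (\<Delta> j x))\<^sup>2) \<partial>M) = ennreal (2^j) * (\<integral>\<^sup>+x. ennreal ((cmod (\<Delta> j x))\<^sup>2) \<partial>M)"
      by (subst nn_integral_cmult[symmetric]) (auto simp: ennreal_mult)
    also have "\<dots> = ennreal (2^j * norm_sq M (\<lambda>x. f (k (Suc j)) x - f (k j) x))"
      unfolding \<Delta>_def s_def nn by (simp add: ennreal_mult)
    also have "\<dots> \<le> ennreal (2^j * (1/8)^j)"
      using N[of j "k (Suc j)" "k j"] kN by (intro ennreal_leI mult_left_mono) auto
    also have "(2::real)^j * (1/8)^j = (1/4)^j" by (simp flip: power_mult_distrib)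
    finally show "(\<integral>\<^sup>+x. ennreal (2^j * (cmod (\<Delta> j x))\<^sup>2) \<partial>M) \<le> ennreal ((1/4)^j)" .
  qed auto
  also have "\<dots> = ennreal (\<Sum>j. (1/4)^j)"
    by (intro suminf_ennreal2) (auto intro: summable_geometric)
  finally have fin: "(\<integral>\<^sup>+x. (\<Sum>j. ennreal (2^j * (cmod (\<Delta> j x))\<^sup>2)) \<partial>M) \<noteq> \<infinity>"
    by (auto simp: top_unique)
  have "AE x in M. (\<Sum>j. ennreal (2^j * (cmod (\<Delta> j x))\<^sup>2)) \<noteq> \<infinity>"
    by (rule nn_integral_PInf_AE[OF _ fin]) measurable
  then have conv: "AE x in M. convergent (\<lambda>j. s j x)"
  proof eventually_elim
    case (elim x)
    have s1: "summable (\<lambda>j. 2^j * (cmod (\<Delta> j x))\<^sup>2)"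
      by (rule summable_suminf_not_top) (use elim in auto)
    have "summable (\<lambda>j. 2^j * (cmod (\<Delta> j x))\<^sup>2 + (1/2)^j)"
      by (intro summable_add s1 summable_geometric) simp
    then have "summable (\<lambda>j. \<Delta> j x)"
    proof (rule summable_comparison_test')
      fix j :: nat
      have key: "2 * c \<le> A * c\<^sup>2 + B" if "A * B = 1" "0 \<le> A" for A B c :: real
      proof -
        have "2 * c = A * (2 * c * B)" "B = A * B\<^sup>2"
          using that(1) by (simp_all add: power2_eq_square mult.assoc[symmetric])
        moreover have "A * (2 * c * B) \<le> A * (c\<^sup>2 + B\<^sup>2)"
          using sum_squares_bound[of c B] that(2) by (intro mult_left_mono) auto
        ultimately show ?thesis unfolding distrib_left by linarith
      qed
      have "2^j * (1/2::real)^j = 1" by (simp flip: power_mult_distrib)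
      from key[OF this, of "cmod (\<Delta> j x)"]
      have "2 * cmod (\<Delta> j x) \<le> 2^j * (cmod (\<Delta> j x))\<^sup>2 + (1/2)^j" by simp
      then show "norm (\<Delta> j x) \<le> 2^j * (cmod (\<Delta> j x))\<^sup>2 + (1/2)^j"
        by (smt (verit) norm_ge_zero)
    qed
    then have "convergent (\<lambda>n. \<Sum>j<n. \<Delta> j x)" by (simp add: summable_iff_convergent)
    then have "convergent (\<lambda>n. s n x - s 0 x)"
      by (simp add: \<Delta>_def sum_lessThan_telescope[of "\<lambda>j. s j x"])
    then have "convergent (\<lambda>n. (s n x - s 0 x) + s 0 x)" by (intro convergent_add convergent_const)
    then show ?case by simp
  qed
  define g where "g x = lim (\<lambda>j. s j x)" for x
  have [measurable]: "g \<in> borel_measurable M"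
    unfolding g_def[abs_def] by (rule borel_measurable_lim_metric) measurable
  have close: "(\<integral>\<^sup>+x. ennreal ((cmod (f m x - g x))\<^sup>2) \<partial>M) \<le> ennreal ((1/8)^j)" if m: "m \<ge> N j" for m j
  proof -
    have "(\<integral>\<^sup>+x. ennreal ((cmod (f m x - g x))\<^sup>2) \<partial>M) =
        (\<integral>\<^sup>+x. liminf (\<lambda>i. ennreal ((cmod (f m x - s i x))\<^sup>2)) \<partial>M)"
    proof (rule nn_integral_cong_AE, use conv in eventually_elim)
      case (elim x)
      then have "(\<lambda>i. s i x) \<longlonglongrightarrow> g x" by (simp add: g_def convergent_LIMSEQ_iff)
      then have "(\<lambda>i. ennreal ((cmod (f m x - s i x))\<^sup>2)) \<longlonglongrightarrow> ennreal ((cmod (f m x - g x))\<^sup>2)"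
        by (intro tendsto_ennrealI tendsto_intros)
      then show ?case by (rule lim_imp_Liminf[OF sequentially_bot, symmetric])
    qed
    also have "\<dots> \<le> liminf (\<lambda>i. \<integral>\<^sup>+x. ennreal ((cmod (f m x - s i x))\<^sup>2) \<partial>M)"
      by (intro nn_integral_liminf) measurable
    also have "\<dots> \<le> ennreal ((1/8)^j)"
    proof (rule Liminf_le)
      show "\<forall>\<^sub>F i in sequentially. (\<integral>\<^sup>+x. ennreal ((cmod (f m x - s i x))\<^sup>2) \<partial>M) \<le> ennreal ((1/8)^j)"
        using eventually_ge_at_top[of "N j"]
      proof eventually_elim
        case (elim i)
        then have "k i \<ge> N j" using kN(3)[of i] by simp
        then show ?case
          unfolding s_def nn using N[OF m, of "k i"] by (intro ennreal_leI) simp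
      qed
    qed simp
    finally show ?thesis .
  qed
  have sqd: "sq_integrable M (\<lambda>x. f m x - g x)" if "m \<ge> N j" for m j
    unfolding sq_integrable_def
  proof
    show "integrable M (\<lambda>x. (cmod (f m x - g x))\<^sup>2)"
      using close[OF that] by (intro integrableI_bounded) (auto simp: le_less_trans)
  qed measurable
  have "sq_integrable M (\<lambda>x. f (N 0) x - (f (N 0) x - g x))"
    by (rule sq_integrable_diff[OF f sqd[OF order_refl]])
  then have g: "sq_integrable M g" by simp
  have "(\<lambda>n. norm_sq M (\<lambda>x. f n x - g x)) \<longlonglongrightarrow> 0"
  proof (rule LIMSEQ_I)
    fix e :: real assume "e > 0"
    then obtain j where j: "(1/8)^j < e" using real_arch_pow_inv[of e "1/8"] by auto
    show "\<exists>n0. \<forall>n\<ge>n0. norm (norm_sq M (\<lambda>x. f n x - g x) - 0) < e"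
    proof (intro exI allI impI)
      fix n assume n: "n \<ge> N j"
      have "ennreal (norm_sq M (\<lambda>x. f n x - g x)) \<le> ennreal ((1/8)^j)"
        using close[OF n] sqd[OF n] unfolding norm_sq_def
        by (subst nn_integral_eq_integral[symmetric]) (auto simp: sq_integrable_def)
      then show "norm (norm_sq M (\<lambda>x. f n x - g x) - 0) < e" using j by (simp add: ennreal_le_iff)
    qed
  qed
  with g show ?thesis by (rule that)
qed

text \<open>The projection theorem in the product of two \<open>L2\<close> spaces. By the parallelogram law a sequence in
  \<open>T\<close> that minimizes the distance to \<open>(u, w)\<close> is a Cauchy sequence. Its limit differs from
  \<open>(u, w)\<close> by a pair \<open>(d, e)\<close> orthogonal to \<open>T\<close>, hence orthogonal to \<open>(u, w)\<close> by assumption and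
  so to itself.\<close>

lemma pair_separation:
  assumes T: "\<And>f g. (f, g) \<in> T \<Longrightarrow> sq_integrable M f \<and> sq_integrable M g" and ne: "T \<noteq> {}"
    and lin: "\<And>f g f' g' c. (f, g) \<in> T \<Longrightarrow> (f', g') \<in> T \<Longrightarrow> ((\<lambda>x. f x + c * f' x), (\<lambda>x. g x + c * g' x)) \<in> T"
    and u: "sq_integrable M u" and w: "sq_integrable M w"
    and sep: "\<And>d e. sq_integrable M d \<Longrightarrow> sq_integrable M e \<Longrightarrow>
      (\<And>f g. (f, g) \<in> T \<Longrightarrow> inner_product M d f + inner_product M e g = 0) \<Longrightarrow>
      inner_product M d u + inner_product M e w = 0"
  obtains F G where "\<And>n::nat. (F n, G n) \<in> T"
    "(\<lambda>n. norm_sq M (\<lambda>x. F n x - u x)) \<longlonglongrightarrow> 0" "(\<lambda>n. norm_sq M (\<lambda>x. G n x - w x)) \<longlonglongrightarrow> 0"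
proof -
  define D where "D f g = norm_sq M (\<lambda>x. u x - f x) + norm_sq M (\<lambda>x. w x - g x)" for f g
  define m where "m = Inf ((\<lambda>(f, g). D f g) ` T)"
  have bdd: "bdd_below ((\<lambda>(f, g). D f g) ` T)" by (rule bdd_belowI[of _ 0]) (auto simp: D_def)
  have m_le: "m \<le> D f g" if "(f, g) \<in> T" for f g
    unfolding m_def using that by (intro cInf_lower bdd) force
  have "\<exists>f g. (f, g) \<in> T \<and> D f g < m + 1 / real (Suc n)" for n
  proof -
    have "m < m + 1 / real (Suc n)" by simp
    then show ?thesis unfolding m_def using cInf_lessD[of "(\<lambda>(f, g). D f g) ` T"] ne by fastforce
  qed
  then obtain F G where FG: "\<And>n. (F n, G n) \<in> T" "\<And>n. D (F n) (G n) < m + 1 / real (Suc n)"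
    by metis
  have F: "sq_integrable M (F n)" and G: "sq_integrable M (G n)" for n using T FG(1) by auto
  have uF: "sq_integrable M (\<lambda>x. u x - F n x)" and wG: "sq_integrable M (\<lambda>x. w x - G n x)" for n
    using u w F G by (auto intro: sq_integrable_diff)
  have para: "norm_sq M (\<lambda>x. F i x - F j x) + norm_sq M (\<lambda>x. G i x - G j x) \<le> 2 / real (Suc i) + 2 / real (Suc j)" for i j
  proof -
    have mid: "norm_sq M (\<lambda>x. h i x - h j x) =
      2 * norm_sq M (\<lambda>x. v x - h i x) + 2 * norm_sq M (\<lambda>x. v x - h j x)
      - 4 * norm_sq M (\<lambda>x. v x - ((1/2) * h i x + (1/2) * h j x))"
      if h: "\<And>n. sq_integrable M (\<lambda>x. v x - h n x)" for h :: "nat \<Rightarrow> 'a \<Rightarrow> complex" and v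
    proof -
      have "norm_sq M (\<lambda>x. (v x - h j x) - (v x - h i x)) + norm_sq M (\<lambda>x. (v x - h j x) + (v x - h i x)) =
        2 * norm_sq M (\<lambda>x. v x - h j x) + 2 * norm_sq M (\<lambda>x. v x - h i x)"
        by (rule norm_sq_parallelogram[OF h h])
      moreover have "(\<lambda>x. (v x - h j x) + (v x - h i x)) = (\<lambda>x. 2 * (v x - ((1/2) * h i x + (1/2) * h j x)))"
        by (auto simp: algebra_simps)
      moreover have "(\<lambda>x. (v x - h j x) - (v x - h i x)) = (\<lambda>x. h i x - h j x)" by auto
      ultimately show ?thesis by (simp only: norm_sq_scale) simp
    qed
    have half: "((\<lambda>x. (1/2) * F i x + (1/2) * F j x), (\<lambda>x. (1/2) * G i x + (1/2) * G j x)) \<in> T"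
    proof -
      have "((\<lambda>x. F i x + (-1) * F i x), (\<lambda>x. G i x + (-1) * G i x)) \<in> T" by (rule lin[OF FG(1) FG(1)])
      from lin[OF lin[OF this FG(1), of "1/2" i] FG(1), of "1/2" j] show ?thesis by simp
    qed
    show ?thesis
    proof -
      have "2 / real (Suc i) = 2 * (1 / real (Suc i))" "2 / real (Suc j) = 2 * (1 / real (Suc j))" by simp_all
      then show ?thesis
        using mid[where v=u and h=F, OF uF] mid[where v=w and h=G, OF wG] m_le[OF half] FG(2)[of i] FG(2)[of j] unfolding D_def by linarith
    qed
  qed
  have small: "\<exists>N. \<forall>i\<ge>N. \<forall>j\<ge>N. 2 / real (Suc i) + 2 / real (Suc j) < e" if "e > 0" for e :: real
  proof -
    have "e / 4 > 0" using that by simp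
    then obtain N where "inverse (real (Suc N)) < e / 4" using reals_Archimedean by blast
    then have N: "1 / real (Suc N) < e / 4" by (simp add: inverse_eq_divide)
    have h: "2 / real (Suc i) < e / 2" if "i \<ge> N" for i
    proof -
      have "1 / real (Suc i) \<le> 1 / real (Suc N)" using that by (intro divide_left_mono) auto
      then show ?thesis using N by simp
    qed
    then show ?thesis
    proof (intro exI[of _ N] allI impI)
      fix i j assume "N \<le> i" "N \<le> j"
      then have "2 / real (Suc i) < e / 2" "2 / real (Suc j) < e / 2" using h by blast+
      then show "2 / real (Suc i) + 2 / real (Suc j) < e" by linarith
    qed
  qed
  obtain u0 where u0: "sq_integrable M u0" "(\<lambda>n. norm_sq M (\<lambda>x. F n x - u0 x)) \<longlonglongrightarrow> 0"
  proof (rule riesz_fischer[OF F])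
    fix e :: real assume "e > 0"
    then obtain N where "\<forall>i\<ge>N. \<forall>j\<ge>N. 2 / real (Suc i) + 2 / real (Suc j) < e" using small by blast
    moreover have "norm_sq M (\<lambda>x. F i x - F j x) \<le> 2 / real (Suc i) + 2 / real (Suc j)" for i j
      using para[of i j] norm_sq_nonneg[of M "\<lambda>x. G i x - G j x"] by linarith
    ultimately have "\<forall>i\<ge>N. \<forall>j\<ge>N. norm_sq M (\<lambda>x. F i x - F j x) < e" by (meson le_less_trans)
    then show "\<exists>N. \<forall>i\<ge>N. \<forall>j\<ge>N. norm_sq M (\<lambda>x. F i x - F j x) < e" by blast
  qed
  obtain w0 where w0: "sq_integrable M w0" "(\<lambda>n. norm_sq M (\<lambda>x. G n x - w0 x)) \<longlonglongrightarrow> 0"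
  proof (rule riesz_fischer[OF G])
    fix e :: real assume "e > 0"
    then obtain N where "\<forall>i\<ge>N. \<forall>j\<ge>N. 2 / real (Suc i) + 2 / real (Suc j) < e" using small by blast
    moreover have "norm_sq M (\<lambda>x. G i x - G j x) \<le> 2 / real (Suc i) + 2 / real (Suc j)" for i j
      using para[of i j] norm_sq_nonneg[of M "\<lambda>x. F i x - F j x"] by linarith
    ultimately have "\<forall>i\<ge>N. \<forall>j\<ge>N. norm_sq M (\<lambda>x. G i x - G j x) < e" by (meson le_less_trans)
    then show "\<exists>N. \<forall>i\<ge>N. \<forall>j\<ge>N. norm_sq M (\<lambda>x. G i x - G j x) < e" by blast
  qed
  define d where "d x = u x - u0 x" for x
  define e where "e x = w x - w0 x" for x
  have d: "sq_integrable M d" and e: "sq_integrable M e"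
    unfolding d_def e_def using u w u0 w0 by (auto intro: sq_integrable_diff)
  have lim_d: "(\<lambda>n. inner_product M (\<lambda>x. u x - F n x) f) \<longlonglongrightarrow> inner_product M d f"
    and lim_e: "(\<lambda>n. inner_product M (\<lambda>x. w x - G n x) f) \<longlonglongrightarrow> inner_product M e f"
    if f: "sq_integrable M f" for f
  proof -
    have "(\<lambda>n. inner_product M f (\<lambda>x. u x - F n x)) \<longlonglongrightarrow> inner_product M f d"
      by (rule inner_product_tendsto[OF f uF d])
        (use u0(2) in \<open>simp add: d_def norm_sq_diff_commute[of M "F _"]\<close>)
    then show "(\<lambda>n. inner_product M (\<lambda>x. u x - F n x) f) \<longlonglongrightarrow> inner_product M d f"
      by (subst (1 2) inner_product_commute) (rule tendsto_cnj)
    have "(\<lambda>n. inner_product M f (\<lambda>x. w x - G n x)) \<longlonglongrightarrow> inner_product M f e"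
      by (rule inner_product_tendsto[OF f wG e])
        (use w0(2) in \<open>simp add: e_def norm_sq_diff_commute[of M "G _"]\<close>)
    then show "(\<lambda>n. inner_product M (\<lambda>x. w x - G n x) f) \<longlonglongrightarrow> inner_product M e f"
      by (subst (1 2) inner_product_commute) (rule tendsto_cnj)
  qed
  have orth: "inner_product M d f + inner_product M e g = 0" if fg: "(f, g) \<in> T" for f g
  proof -
    have f: "sq_integrable M f" and g: "sq_integrable M g" using T fg by auto
    define S where "S = inner_product M d f + inner_product M e g"
    define N where "N = norm_sq M f + norm_sq M g"
    have N: "N \<ge> 0" by (simp add: N_def)
    have "2 * Re (c * S) \<le> (cmod c)\<^sup>2 * N" for c
    proof -
      have "2 * Re (c * (inner_product M (\<lambda>x. u x - F n x) f + inner_product M (\<lambda>x. w x - G n x) g))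
          \<le> 1 / real (Suc n) + (cmod c)\<^sup>2 * N" for n
      proof -
        have "m \<le> D (\<lambda>x. F n x + c * f x) (\<lambda>x. G n x + c * g x)" by (rule m_le[OF lin[OF FG(1) fg]])
        also have "\<dots> = norm_sq M (\<lambda>x. (u x - F n x) - c * f x) + norm_sq M (\<lambda>x. (w x - G n x) - c * g x)"
          by (simp add: D_def algebra_simps)
        also have "\<dots> = D (F n) (G n) - 2 * Re (c * (inner_product M (\<lambda>x. u x - F n x) f + inner_product M (\<lambda>x. w x - G n x) g))
            + (cmod c)\<^sup>2 * N"
          unfolding norm_sq_diff_scale[OF uF f] norm_sq_diff_scale[OF wG g] D_def N_def
          by (simp add: algebra_simps)
        finally show ?thesis using FG(2)[of n] by simp
      qed
      moreover have "(\<lambda>n. 2 * Re (c * (inner_product M (\<lambda>x. u x - F n x) f + inner_product M (\<lambda>x. w x - G n x) g)))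
          \<longlonglongrightarrow> 2 * Re (c * S)"
        unfolding S_def using lim_d[OF f] lim_e[OF g] by (intro tendsto_intros)
      moreover have "(\<lambda>n. 1 / real (Suc n) + (cmod c)\<^sup>2 * N) \<longlonglongrightarrow> 0 + (cmod c)\<^sup>2 * N"
        using LIMSEQ_inverse_real_of_nat by (intro tendsto_intros) (simp add: inverse_eq_divide)
      ultimately show ?thesis by (intro LIMSEQ_le) auto
    qed
    note bound = this
    have "2 * t * (cmod S)\<^sup>2 \<le> t\<^sup>2 * (cmod S)\<^sup>2 * N" for t
    proof -
      have "(of_real t * cnj S) * S = of_real t * (S * cnj S)" by (simp only: mult_ac)
      also have "\<dots> = of_real (t * (cmod S)\<^sup>2)"
        by (simp only: complex_norm_square[symmetric] of_real_mult)
      finally have eq: "(of_real t * cnj S) * S = of_real (t * (cmod S)\<^sup>2)" .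
      show ?thesis using bound[of "of_real t * cnj S", unfolded eq] by (simp add: norm_mult power_mult_distrib)
    qed
    then have "2 * (1 / (N + 1)) * (cmod S)\<^sup>2 \<le> (1 / (N + 1))\<^sup>2 * (cmod S)\<^sup>2 * N" .
    also have "\<dots> = (1 / (N + 1)) * (cmod S)\<^sup>2 * (N / (N + 1))" by (simp add: power2_eq_square)
    also have "\<dots> \<le> (1 / (N + 1)) * (cmod S)\<^sup>2 * 1" using N by (intro mult_left_mono) auto
    finally have "(1 / (N + 1)) * (cmod S)\<^sup>2 \<le> 0" by simp
    then have "(cmod S)\<^sup>2 \<le> 0" using N by (simp add: mult_le_0_iff divide_le_0_iff)
    then show ?thesis by (simp add: S_def)
  qed
  have "inner_product M d u0 + inner_product M e w0 = 0"
  proof (rule LIMSEQ_unique)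
    show "(\<lambda>n. inner_product M d (F n) + inner_product M e (G n)) \<longlonglongrightarrow> inner_product M d u0 + inner_product M e w0"
      by (intro tendsto_add inner_product_tendsto d e F G u0 w0)
    show "(\<lambda>n. inner_product M d (F n) + inner_product M e (G n)) \<longlonglongrightarrow> 0"
      using orth[OF FG(1)] by simp
  qed
  moreover have "inner_product M d u + inner_product M e w = 0" by (rule sep[OF d e orth])
  ultimately have "inner_product M d (\<lambda>x. u x - u0 x) + inner_product M e (\<lambda>x. w x - w0 x) = 0"
    using d e u w u0 w0 by (simp add: inner_product_diff_right algebra_simps add_eq_0_iff)
  then have "complex_of_real (norm_sq M d + norm_sq M e) = 0"
    by (simp add: d_def[abs_def] e_def[abs_def] flip: inner_product_self)
  then have "norm_sq M d + norm_sq M e = 0" by (simp only: of_real_eq_0_iff)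
  then have de: "norm_sq M d = 0" "norm_sq M e = 0"
    using norm_sq_nonneg[of M d] norm_sq_nonneg[of M e] by linarith+
  have "(\<lambda>n. norm_sq M (\<lambda>x. F n x - u x)) \<longlonglongrightarrow> 0"
  proof (rule Lim_null_comparison)
    have "norm_sq M (\<lambda>x. F n x - u x) \<le> 2 * norm_sq M (\<lambda>x. F n x - u0 x) + 2 * norm_sq M (\<lambda>x. u0 x - u x)" for n
      using norm_sq_add_le[OF sq_integrable_diff[OF F u0(1)] sq_integrable_diff[OF u0(1) u], of n] by simp
    then show "\<forall>\<^sub>F n in sequentially. norm (norm_sq M (\<lambda>x. F n x - u x)) \<le> 2 * norm_sq M (\<lambda>x. F n x - u0 x)"
      using de(1) norm_sq_diff_commute[of M u0 u] by (simp add: d_def[abs_def])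
    show "(\<lambda>n. 2 * norm_sq M (\<lambda>x. F n x - u0 x)) \<longlonglongrightarrow> 0" using tendsto_mult_right_zero[OF u0(2)] by simp
  qed
  moreover have "(\<lambda>n. norm_sq M (\<lambda>x. G n x - w x)) \<longlonglongrightarrow> 0"
  proof (rule Lim_null_comparison)
    have "norm_sq M (\<lambda>x. G n x - w x) \<le> 2 * norm_sq M (\<lambda>x. G n x - w0 x) + 2 * norm_sq M (\<lambda>x. w0 x - w x)" for n
      using norm_sq_add_le[OF sq_integrable_diff[OF G w0(1)] sq_integrable_diff[OF w0(1) w], of n] by simp
    then show "\<forall>\<^sub>F n in sequentially. norm (norm_sq M (\<lambda>x. G n x - w x)) \<le> 2 * norm_sq M (\<lambda>x. G n x - w0 x)"
      using de(2) norm_sq_diff_commute[of M w0 w] by (simp add: e_def[abs_def])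
    show "(\<lambda>n. 2 * norm_sq M (\<lambda>x. G n x - w0 x)) \<longlonglongrightarrow> 0" using tendsto_mult_right_zero[OF w0(2)] by simp
  qed
  ultimately show ?thesis using FG(1) that by blast
qed

section \<open>Operators between classes of functions\<close>

lemma l2_class_cong:
  assumes "AE x in M. f x = g x"
  shows "l2_class M f = l2_class M g"
  unfolding l2_class_def using assms by (auto elim: eventually_elim2)

lemma l2_class_eq_iff:
  assumes "sq_integrable M f" "sq_integrable M g"
  shows "l2_class M f = l2_class M g \<longleftrightarrow> (AE x in M. f x = g x)"
proof
  assume "l2_class M f = l2_class M g"
  moreover have "f \<in> l2_class M f" using assms by (simp add: l2_class_def)
  ultimately show "AE x in M. f x = g x" by (simp add: l2_class_def)
qed (rule l2_class_cong)

lemma l2_class_in_L2: "sq_integrable M f \<Longrightarrow> l2_class M f \<in> L2 M"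
  by (auto simp: L2_def)

lemma L2E:
  assumes "u \<in> L2 M"
  obtains f where "sq_integrable M f" "u = l2_class M f"
  using assms by (auto simp: L2_def)

lemma l2_rep_class:
  assumes "sq_integrable M f"
  shows "sq_integrable M (l2_rep (l2_class M f))" "AE x in M. l2_rep (l2_class M f) x = f x"
proof -
  have "f \<in> l2_class M f" using assms by (simp add: l2_class_def)
  then have "l2_rep (l2_class M f) \<in> l2_class M f" unfolding l2_rep_def by (rule someI[where P="\<lambda>h. h \<in> l2_class M f"])
  then show "sq_integrable M (l2_rep (l2_class M f))" "AE x in M. l2_rep (l2_class M f) x = f x"
    by (simp_all add: l2_class_def)
qed

lemma l2_add_class:
  assumes "sq_integrable M f" "sq_integrable M g"
  shows "l2_add M (l2_class M f) (l2_class M g) = l2_class M (\<lambda>x. f x + g x)"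
  unfolding l2_add_def using l2_rep_class(2)[OF assms(1)] l2_rep_class(2)[OF assms(2)]
  by (intro l2_class_cong) (auto elim: eventually_elim2)

lemma l2_diff_class:
  assumes "sq_integrable M f" "sq_integrable M g"
  shows "l2_diff M (l2_class M f) (l2_class M g) = l2_class M (\<lambda>x. f x - g x)"
  unfolding l2_diff_def using l2_rep_class(2)[OF assms(1)] l2_rep_class(2)[OF assms(2)]
  by (intro l2_class_cong) (auto elim: eventually_elim2)

lemma l2_scale_class:
  assumes "sq_integrable M f"
  shows "l2_scale M c (l2_class M f) = l2_class M (\<lambda>x. c * f x)"
  unfolding l2_scale_def using l2_rep_class(2)[OF assms]
  by (intro l2_class_cong) (auto elim: eventually_mono)

lemma l2_inner_class:
  assumes "sq_integrable M f" "sq_integrable M g"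
  shows "l2_inner M (l2_class M f) (l2_class M g) = inner_product M f g"
proof -
  note f = l2_rep_class[OF assms(1)] and g = l2_rep_class[OF assms(2)]
  have m: "(\<lambda>x. cnj (h x) * k x) \<in> borel_measurable M" if "sq_integrable M h" "sq_integrable M k" for h k
    using integrable_cnj_mult(2)[OF that] by auto
  show ?thesis
    unfolding l2_inner_def inner_product_def
    by (rule integral_cong_AE[OF m[OF f(1) g(1)] m[OF assms]], use f(2) g(2) in eventually_elim) simp
qed

lemma l2_norm_class:
  assumes "sq_integrable M f"
  shows "l2_norm M (l2_class M f) = sqrt (norm_sq M f)"
  by (simp add: l2_norm_def l2_inner_class assms inner_product_self)

text \<open>Differential operators are given by pairs of functions, whose classes form the graph.\<close>

definition class_graph :: "'a measure \<Rightarrow> (('a \<Rightarrow> complex) \<times> ('a \<Rightarrow> complex)) set \<Rightarrow> 'a l2_op" where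
  "class_graph M G = (\<lambda>(f, g). (l2_class M f, l2_class M g)) ` G"

definition linear_pairs :: "'a measure \<Rightarrow> (('a \<Rightarrow> complex) \<times> ('a \<Rightarrow> complex)) set \<Rightarrow> bool" where
  "linear_pairs M G \<longleftrightarrow> G \<noteq> {} \<and> (\<forall>(f, g)\<in>G. sq_integrable M f \<and> sq_integrable M g) \<and>
     (\<forall>(f, g)\<in>G. \<forall>(f', g')\<in>G. \<forall>c. ((\<lambda>x. f x + c * f' x), (\<lambda>x. g x + c * g' x)) \<in> G)"

lemma linear_pairsD:
  assumes "linear_pairs M G"
  shows "G \<noteq> {}" "(f, g) \<in> G \<Longrightarrow> sq_integrable M f" "(f, g) \<in> G \<Longrightarrow> sq_integrable M g"
    "(f, g) \<in> G \<Longrightarrow> (f', g') \<in> G \<Longrightarrow> ((\<lambda>x. f x + c * f' x), (\<lambda>x. g x + c * g' x)) \<in> G"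
  using assms unfolding linear_pairs_def by blast+

lemma linear_pairs_zero:
  assumes "linear_pairs M G"
  shows "((\<lambda>x. 0), (\<lambda>x. 0)) \<in> G"
proof -
  obtain f g where "(f, g) \<in> G" using linear_pairsD(1)[OF assms] by auto
  then show ?thesis using linear_pairsD(4)[OF assms, of f g f g "-1"] by simp
qed

lemma linear_operator_class_graph:
  assumes G: "linear_pairs M G"
    and sv: "\<And>f g. (f, g) \<in> G \<Longrightarrow> AE x in M. f x = 0 \<Longrightarrow> AE x in M. g x = 0"
  shows "linear_operator M (class_graph M G)"
  unfolding linear_operator_def
proof (intro conjI allI impI)
  note sq = linear_pairsD(2,3)[OF G]
  show "class_graph M G \<subseteq> L2 M \<times> L2 M" using sq by (auto simp: class_graph_def intro: l2_class_in_L2)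
  show "class_graph M G \<noteq> {}" using linear_pairsD(1)[OF G] by (simp add: class_graph_def)
  show "single_valued (class_graph M G)"
  proof (rule single_valuedI)
    fix u v v' assume "(u, v) \<in> class_graph M G" "(u, v') \<in> class_graph M G"
    then obtain f g f' g' where fg: "(f, g) \<in> G" "u = l2_class M f" "v = l2_class M g"
      "(f', g') \<in> G" "u = l2_class M f'" "v' = l2_class M g'" by (auto simp: class_graph_def)
    have "AE x in M. f x = f' x" using fg sq l2_class_eq_iff by metis
    then have "AE x in M. f x + (-1) * f' x = 0" by (auto elim: eventually_mono)
    then have "AE x in M. g x + (-1) * g' x = 0" by (rule sv[OF linear_pairsD(4)[OF G fg(1,4)]])
    then have "AE x in M. g x = g' x" by (auto elim: eventually_mono)
    then show "v = v'" using fg l2_class_cong by metis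
  qed
  fix u v u' v' assume "(u, v) \<in> class_graph M G" "(u', v') \<in> class_graph M G"
  then obtain f g f' g' where fg: "(f, g) \<in> G" "u = l2_class M f" "v = l2_class M g"
    "(f', g') \<in> G" "u' = l2_class M f'" "v' = l2_class M g'" by (auto simp: class_graph_def)
  have "(l2_class M (\<lambda>x. f x + f' x), l2_class M (\<lambda>x. g x + g' x)) \<in> class_graph M G"
    using linear_pairsD(4)[OF G fg(1,4), of 1] by (force simp: class_graph_def)
  then show "(l2_add M u u', l2_add M v v') \<in> class_graph M G"
    using fg sq[OF fg(1)] sq[OF fg(4)] by (simp add: l2_add_class)
next
  note sq = linear_pairsD(2,3)[OF G]
  fix c u v assume "(u, v) \<in> class_graph M G"
  then obtain f g where fg: "(f, g) \<in> G" "u = l2_class M f" "v = l2_class M g" by (auto simp: class_graph_def)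
  have "(l2_class M (\<lambda>x. c * f x), l2_class M (\<lambda>x. c * g x)) \<in> class_graph M G"
    using linear_pairsD(4)[OF G linear_pairs_zero[OF G] fg(1), of c] by (force simp: class_graph_def)
  then show "(l2_scale M c u, l2_scale M c v) \<in> class_graph M G"
    using fg sq[OF fg(1)] by (simp add: l2_scale_class)
qed

lemma op_adjoint_class_graph:
  assumes G: "\<And>f g. (f, g) \<in> G \<Longrightarrow> sq_integrable M f \<and> sq_integrable M g"
    and u: "sq_integrable M u" and w: "sq_integrable M w"
  shows "(l2_class M u, l2_class M w) \<in> op_adjoint M (class_graph M G) \<longleftrightarrow>
    (\<forall>(f, g)\<in>G. inner_product M u g = inner_product M w f)"
  using G u w l2_class_in_L2[OF u] l2_class_in_L2[OF w]
  by (fastforce simp: op_adjoint_def class_graph_def l2_inner_class)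

text \<open>The projection theorem for the domain, each of its elements being paired with zero.\<close>

lemma densely_defined_class_graph:
  assumes G: "linear_pairs M G"
    and total: "\<And>h. sq_integrable M h \<Longrightarrow> (\<And>f g. (f, g) \<in> G \<Longrightarrow> inner_product M h f = 0) \<Longrightarrow> AE x in M. h x = 0"
  shows "densely_defined M (class_graph M G)"
  unfolding densely_defined_def
proof (intro ballI allI impI)
  fix u and e :: real assume "u \<in> L2 M" and e: "e > 0"
  then obtain f where f: "sq_integrable M f" "u = l2_class M f" by (auto elim: L2E)
  define T where "T = (\<lambda>(f, g). (f, \<lambda>x::'a. 0::complex)) ` G"
  obtain F H where FH: "\<And>n::nat. (F n, H n) \<in> T" "(\<lambda>n. norm_sq M (\<lambda>x. F n x - f x)) \<longlonglongrightarrow> 0"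
  proof (rule pair_separation[of T M f "\<lambda>x. 0"])
    show "sq_integrable M f \<and> sq_integrable M g" if "(f, g) \<in> T" for f g
      using that linear_pairsD(2)[OF G] by (auto simp: T_def sq_integrable_zero)
    show "T \<noteq> {}" using linear_pairsD(1)[OF G] by (auto simp: T_def)
    show "((\<lambda>x. f x + c * f' x), (\<lambda>x. g x + c * g' x)) \<in> T" if "(f, g) \<in> T" "(f', g') \<in> T" for f g f' g' c
      using that linear_pairsD(4)[OF G] by (force simp: T_def)
    show "inner_product M d f + inner_product M e (\<lambda>x. 0) = 0"
      if d: "sq_integrable M d" and 0: "\<And>f g. (f, g) \<in> T \<Longrightarrow> inner_product M d f + inner_product M e g = 0" for d e
    proof -
      have "inner_product M d f = 0" if "(f, g) \<in> G" for f g
        using 0[of f "\<lambda>x. 0"] that by (force simp: T_def inner_product_def)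
      then have "AE x in M. d x = 0" by (rule total[OF d])
      then have "norm_sq M d = 0" using norm_sq_eq_0_iff[OF d] by simp
      then have "inner_product M d f = 0" using inner_product_bound[OF d f(1)] by simp
      then show ?thesis by (simp add: inner_product_def)
    qed
  qed (use f sq_integrable_zero in auto)
  then have "(\<lambda>n. sqrt (norm_sq M (\<lambda>x. F n x - f x))) \<longlonglongrightarrow> 0" using tendsto_real_sqrt by fastforce
  then have "\<forall>\<^sub>F n in sequentially. sqrt (norm_sq M (\<lambda>x. F n x - f x)) < e"
    using e by (rule order_tendstoD)
  then obtain n where n: "sqrt (norm_sq M (\<lambda>x. F n x - f x)) < e"
    by (auto simp: eventually_sequentially)
  obtain g where g: "(F n, g) \<in> G" using FH(1)[of n] by (auto simp: T_def)
  have "l2_class M (F n) \<in> Domain (class_graph M G)" using g by (force simp: class_graph_def)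
  moreover have "l2_norm M (l2_diff M (l2_class M (F n)) u) < e"
    using n f linear_pairsD(2)[OF G g] by (simp add: l2_diff_class l2_norm_class sq_integrable_diff)
  ultimately show "\<exists>v\<in>Domain (class_graph M G). l2_norm M (l2_diff M v u) < e" by blast
qed

lemma op_closureI:
  assumes "u \<in> L2 M" "v \<in> L2 M" "\<And>n::nat. (f n, g n) \<in> T"
    "(\<lambda>n. l2_norm M (l2_diff M (f n) u)) \<longlonglongrightarrow> 0" "(\<lambda>n. l2_norm M (l2_diff M (g n) v)) \<longlonglongrightarrow> 0"
  shows "(u, v) \<in> op_closure M T"
  using assms unfolding op_closure_def by blast

text \<open>The double adjoint is the closure: a pair \<open>(d, e)\<close> is orthogonal to the graph if and only if
  \<open>(e, - d)\<close> belongs to the adjoint.\<close>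

lemma biadjoint_imp_closure:
  assumes G: "linear_pairs M G" and u: "sq_integrable M u" and w: "sq_integrable M w"
    and bi: "\<And>x y. sq_integrable M x \<Longrightarrow> sq_integrable M y \<Longrightarrow>
      (\<And>f g. (f, g) \<in> G \<Longrightarrow> inner_product M x g = inner_product M y f) \<Longrightarrow>
      inner_product M x w = inner_product M y u"
  shows "(l2_class M u, l2_class M w) \<in> op_closure M (class_graph M G)"
proof -
  note sq = linear_pairsD(2,3)[OF G]
  obtain F H where FH: "\<And>n::nat. (F n, H n) \<in> G"
    "(\<lambda>n. norm_sq M (\<lambda>x. F n x - u x)) \<longlonglongrightarrow> 0" "(\<lambda>n. norm_sq M (\<lambda>x. H n x - w x)) \<longlonglongrightarrow> 0"
  proof (rule pair_separation[of G M u w])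
    show "inner_product M d u + inner_product M e w = 0"
      if d: "sq_integrable M d" and e: "sq_integrable M e"
        and 0: "\<And>f g. (f, g) \<in> G \<Longrightarrow> inner_product M d f + inner_product M e g = 0" for d e
    proof -
      have neg: "inner_product M (\<lambda>x. - d x) h = - inner_product M d h" for h by (simp add: inner_product_def)
      have "inner_product M e w = inner_product M (\<lambda>x. - d x) u"
      proof (rule bi[OF e])
        show "sq_integrable M (\<lambda>x. - d x)" using sq_integrable_scale[OF d, of "-1"] by simp
        show "inner_product M e g = inner_product M (\<lambda>x. - d x) f" if "(f, g) \<in> G" for f g
          using 0[OF that] by (simp add: neg add_eq_0_iff)
      qed
      then show ?thesis by (simp add: neg)
    qed
  qed (use sq linear_pairsD(1,4)[OF G] u w in auto)
  have "(l2_class M (F n), l2_class M (H n)) \<in> class_graph M G" for n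
    using FH(1)[of n] by (force simp: class_graph_def)
  moreover have "(\<lambda>n. l2_norm M (l2_diff M (l2_class M (F n)) (l2_class M u))) \<longlonglongrightarrow> 0"
    using tendsto_real_sqrt[OF FH(2)] sq(1)[OF FH(1)] u by (simp add: l2_diff_class l2_norm_class sq_integrable_diff)
  moreover have "(\<lambda>n. l2_norm M (l2_diff M (l2_class M (H n)) (l2_class M w))) \<longlonglongrightarrow> 0"
    using tendsto_real_sqrt[OF FH(3)] sq(2)[OF FH(1)] w by (simp add: l2_diff_class l2_norm_class sq_integrable_diff)
  ultimately show ?thesis
    by (intro op_closureI[where f="\<lambda>n. l2_class M (F n)" and g="\<lambda>n. l2_class M (H n)"] l2_class_in_L2 u w)
qed

text \<open>Adjoints are closed, because the inner product is continuous.\<close>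

lemma op_closure_subset_adjoint:
  assumes T: "T \<subseteq> op_adjoint M S" "T \<subseteq> L2 M \<times> L2 M" and S: "S \<subseteq> L2 M \<times> L2 M"
  shows "op_closure M T \<subseteq> op_adjoint M S"
proof clarify
  fix u v assume "(u, v) \<in> op_closure M T"
  then obtain f g where uv: "u \<in> L2 M" "v \<in> L2 M" and fg: "\<And>n::nat. (f n, g n) \<in> T"
    "(\<lambda>n. l2_norm M (l2_diff M (f n) u)) \<longlonglongrightarrow> 0" "(\<lambda>n. l2_norm M (l2_diff M (g n) v)) \<longlonglongrightarrow> 0"
    by (auto simp: op_closure_def)
  have lim: "(\<lambda>n. l2_inner M (f n) x) \<longlonglongrightarrow> l2_inner M u x"
    if u: "u \<in> L2 M" and x: "x \<in> L2 M" and f: "\<And>n. f n \<in> L2 M"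
      and l: "(\<lambda>n. l2_norm M (l2_diff M (f n) u)) \<longlonglongrightarrow> 0" for u x and f :: "nat \<Rightarrow> _"
  proof -
    obtain u' where u': "sq_integrable M u'" "u = l2_class M u'" using u by (auto elim: L2E)
    obtain x' where x': "sq_integrable M x'" "x = l2_class M x'" using x by (auto elim: L2E)
    have "\<forall>n. \<exists>f'. sq_integrable M f' \<and> f n = l2_class M f'" using f by (metis L2E)
    then obtain f' where f': "\<And>n. sq_integrable M (f' n)" "\<And>n. f n = l2_class M (f' n)" by metis
    have "(\<lambda>n. sqrt (norm_sq M (\<lambda>x. f' n x - u' x))) \<longlonglongrightarrow> 0"
      using l f' u' by (simp add: l2_diff_class l2_norm_class sq_integrable_diff)
    then have "(\<lambda>n. (sqrt (norm_sq M (\<lambda>x. f' n x - u' x)))\<^sup>2) \<longlonglongrightarrow> 0\<^sup>2" by (rule tendsto_power)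
    then have "(\<lambda>n. norm_sq M (\<lambda>x. f' n x - u' x)) \<longlonglongrightarrow> 0" by simp
    then have "(\<lambda>n. inner_product M x' (f' n)) \<longlonglongrightarrow> inner_product M x' u'"
      by (rule inner_product_tendsto[OF x'(1) f'(1) u'(1)])
    then have "(\<lambda>n. cnj (inner_product M x' (f' n))) \<longlonglongrightarrow> cnj (inner_product M x' u')" by (rule tendsto_cnj)
    then show ?thesis using f' u' x' by (simp add: l2_inner_class flip: inner_product_commute)
  qed
  have "l2_inner M u y = l2_inner M v x" if xy: "(x, y) \<in> S" for x y
  proof (rule LIMSEQ_unique)
    have xy2: "x \<in> L2 M" "y \<in> L2 M" using xy S by auto
    have fg2: "f n \<in> L2 M" "g n \<in> L2 M" for n using fg(1)[of n] T(2) by auto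
    show "(\<lambda>n. l2_inner M (f n) y) \<longlonglongrightarrow> l2_inner M u y" by (rule lim[OF uv(1) xy2(2) fg2(1) fg(2)])
    have "l2_inner M (f n) y = l2_inner M (g n) x" for n
      using fg(1)[of n] T(1) xy unfolding op_adjoint_def by blast
    then show "(\<lambda>n. l2_inner M (f n) y) \<longlonglongrightarrow> l2_inner M v x"
      using lim[OF uv(2) xy2(1) fg2(2) fg(3)] by simp
  qed
  then show "(u, v) \<in> op_adjoint M S" using uv by (auto simp: op_adjoint_def)
qed

section \<open>Integration against the weight\<close>

text \<open>Subsets of null sets are Lebesgue measurable.\<close>

lemma borel_measurable_lebesgue_on_AE_cong:
  fixes f g :: "real \<Rightarrow> complex"
  assumes S: "S \<in> sets lebesgue" and f: "f \<in> borel_measurable (lebesgue_on S)"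
    and eq: "AE x in lebesgue_on S. g x = f x"
  shows "g \<in> borel_measurable (lebesgue_on S)"
proof -
  obtain N where N: "negligible N" "\<forall>x\<in>S - N. g x = f x"
    using eq AE_lebesgue_on_iff_negligible[OF S] by blast
  define F where "F x = (if x \<in> S then f x else 0)" for x
  define G where "G x = (if x \<in> S then g x else 0)" for x
  have F: "F \<in> borel_measurable lebesgue"
    unfolding F_def[abs_def] using borel_measurable_if[OF S] f by blast
  have "G \<in> borel_measurable lebesgue"
  proof (rule measurableI)
    fix A :: "complex set" assume A: "A \<in> sets borel"
    have "G -` A \<inter> space lebesgue = (F -` A \<inter> space lebesgue - N) \<union> (G -` A \<inter> N)"
      using N(2) by (auto simp: F_def G_def split: if_splits)
    moreover have "G -` A \<inter> N \<in> sets lebesgue"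
      using N(1) by (intro negligible_imp_sets) (rule negligible_subset, auto)
    moreover have "F -` A \<inter> space lebesgue - N \<in> sets lebesgue"
      using measurable_sets[OF F A] negligible_imp_sets[OF N(1)] by blast
    ultimately show "G -` A \<inter> space lebesgue \<in> sets lebesgue" by (metis sets.Un)
  qed simp
  then show ?thesis unfolding G_def[abs_def] using borel_measurable_if[OF S] by blast
qed

lemma weighted_integrable_iff:
  fixes h :: "real \<Rightarrow> 'b::euclidean_space"
  assumes J: "J \<in> sets lebesgue" and r: "r \<in> borel_measurable (lebesgue_on J)"
    "AE x in lebesgue_on J. 0 < r x" and h: "h \<in> borel_measurable (lebesgue_on J)"
  shows "integrable (density (lebesgue_on J) (\<lambda>x. ennreal (r x))) h \<longleftrightarrow>
      (\<lambda>x. r x *\<^sub>R h x) absolutely_integrable_on J"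
    and "integrable (density (lebesgue_on J) (\<lambda>x. ennreal (r x))) h \<Longrightarrow>
      integral\<^sup>L (density (lebesgue_on J) (\<lambda>x. ennreal (r x))) h = integral J (\<lambda>x. r x *\<^sub>R h x)"
proof -
  have nn: "AE x in lebesgue_on J. 0 \<le> r x" using r(2) by (auto elim: eventually_mono)
  show iff: "integrable (density (lebesgue_on J) (\<lambda>x. ennreal (r x))) h \<longleftrightarrow>
      (\<lambda>x. r x *\<^sub>R h x) absolutely_integrable_on J"
    using integrable_density[OF h r(1) nn] integrable_restrict_space[of J lebesgue "\<lambda>x. r x *\<^sub>R h x"] J
    by (simp add: set_integrable_def)
  assume "integrable (density (lebesgue_on J) (\<lambda>x. ennreal (r x))) h"
  then have ai: "(\<lambda>x. r x *\<^sub>R h x) absolutely_integrable_on J" using iff by simp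
  have "integral\<^sup>L (density (lebesgue_on J) (\<lambda>x. ennreal (r x))) h = (LINT x:J|lebesgue. r x *\<^sub>R h x)"
    using integral_density[OF h r(1) nn] integral_restrict_space[of J lebesgue "\<lambda>x. r x *\<^sub>R h x"] J
    by (simp add: set_lebesgue_integral_def)
  also have "\<dots> = integral J (\<lambda>x. r x *\<^sub>R h x)" by (rule set_lebesgue_integral_eq_integral(2)[OF ai])
  finally show "integral\<^sup>L (density (lebesgue_on J) (\<lambda>x. ennreal (r x))) h = integral J (\<lambda>x. r x *\<^sub>R h x)" .
qed

definition oriented_integral :: "real \<Rightarrow> (real \<Rightarrow> 'b::euclidean_space) \<Rightarrow> real \<Rightarrow> 'b" where
  "oriented_integral x0 f x = (if x0 \<le> x then integral {x0..x} f else - integral {x..x0} f)"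

lemma oriented_integral_refl [simp]: "oriented_integral x0 f x0 = 0"
  by (simp add: oriented_integral_def)

lemma primitive_on_oriented_integral:
  fixes f :: "real \<Rightarrow> 'b::euclidean_space"
  assumes S: "is_interval S" "x0 \<in> S"
    and f: "\<And>x y. x \<in> S \<Longrightarrow> y \<in> S \<Longrightarrow> f absolutely_integrable_on {x..y}"
  shows "primitive_on S (oriented_integral x0 f) f"
  unfolding primitive_on_def
proof (intro ballI impI conjI)
  fix x y assume xy: "x \<in> S" "y \<in> S" "x \<le> y"
  show "f absolutely_integrable_on {x..y}" by (rule f[OF xy(1,2)])
  have fi: "f integrable_on {s..t}" if "s \<in> S" "t \<in> S" for s t
    using f[OF that] by (simp add: absolutely_integrable_on_def)
  have c: "integral {s..m} f + integral {m..t} f = integral {s..t} f"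
    if "s \<in> S" "t \<in> S" "s \<le> m" "m \<le> t" for s m t
    using that fi by (intro Henstock_Kurzweil_Integration.integral_combine) auto
  have "integral {x..y} f = oriented_integral x0 f y - oriented_integral x0 f x"
    using c[where s=x and m=y and t=x0] c[where s=x and m=x0 and t=y] c[where s=x0 and m=x and t=y] xy S(2) unfolding oriented_integral_def
    by (auto simp: algebra_simps)
  then show "(f has_integral oriented_integral x0 f y - oriented_integral x0 f x) {x..y}"
    using fi[OF xy(1,2)] by (simp add: has_integral_iff)
qed

lemma einterval_at_right_neq_bot:
  fixes a b :: ereal
  assumes "a < b"
  shows "at_right a \<noteq> bot" "at_left b \<noteq> bot"
proof -
  show "at_right a \<noteq> bot"
    unfolding trivial_limit_def eventually_at_right[OF assms] using dense by blast
  show "at_left b \<noteq> bot"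
    unfolding trivial_limit_def eventually_at_left[OF assms] using dense by blast
qed

text \<open>Up to the constant \<open>L\<close>, the value \<open>H x\<close> is the integral of \<open>k\<close> over the part of the interval
  to the left of \<open>x\<close>. Dominated convergence applies to this integral at both ends.\<close>

lemma primitive_limits:
  fixes a b :: ereal and H k :: "real \<Rightarrow> 'b::euclidean_space"
  assumes ab: "a < b" and H: "primitive_on (einterval a b) H k"
    and k: "k absolutely_integrable_on (einterval a b)"
  obtains L where "((\<lambda>x. H (real_of_ereal x)) \<longlongrightarrow> L) (at_right a)"
    "((\<lambda>x. H (real_of_ereal x)) \<longlongrightarrow> L + integral (einterval a b) k) (at_left b)"
proof -
  let ?I = "einterval a b"
  define J where "J x = ?I \<inter> {..x}" for x
  have I: "?I \<in> sets lebesgue" by (simp add: borel_einterval sets_completionI_sets)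
  have J: "J x \<in> sets lebesgue" for x unfolding J_def using I by auto
  have kJ: "k absolutely_integrable_on J x" for x
    by (rule set_integrable_subset[OF k J]) (auto simp: J_def)
  have step: "integral (J y) k - integral (J x) k = H y - H x" if xy: "x \<in> ?I" "y \<in> ?I" "x \<le> y" for x y
  proof -
    have sub: "{x..y} \<subseteq> ?I"
      using xy less_le_trans[of a "ereal x"] le_less_trans[of _ "ereal y" b] by (force simp: einterval_def)
    have 1: "(k has_integral integral (J x) k) (J x)"
      using kJ[of x] by (simp add: absolutely_integrable_on_def has_integral_integral)
    have 2: "(k has_integral (H y - H x)) {x..y}" by (rule primitive_onD(2)[OF H xy])
    have "negligible (J x \<inter> {x..y})" by (rule negligible_subset[of "{x}"]) (auto simp: J_def)
    then have "(k has_integral (integral (J x) k + (H y - H x))) (J x \<union> {x..y})"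
      by (rule has_integral_Un[OF 1 2])
    moreover have "J x \<union> {x..y} = J y" using sub xy by (auto simp: J_def)
    ultimately have "integral (J y) k = integral (J x) k + (H y - H x)" by (auto intro: integral_unique)
    then show ?thesis by simp
  qed
  obtain x0 where x0: "x0 \<in> ?I" using einterval_nonempty[OF ab] by blast
  define L where "L = H x0 - integral (J x0) k"
  have HJ: "H x = L + integral (J x) k" if "x \<in> ?I" for x
    using step[of x x0] step[of x0 x] that x0 by (cases "x \<le> x0") (auto simp: L_def algebra_simps)
  have Jint: "integral (J x) k = (\<integral>t. indicator {..x} t *\<^sub>R (indicator ?I t *\<^sub>R k t) \<partial>lebesgue)" for x
  proof -
    have "integral (J x) k = (LINT t:J x|lebesgue. k t)" using set_lebesgue_integral_eq_integral(2)[OF kJ] by simp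
    also have "\<dots> = (\<integral>t. indicator {..x} t *\<^sub>R (indicator ?I t *\<^sub>R k t) \<partial>lebesgue)"
      unfolding set_lebesgue_integral_def J_def by (intro Bochner_Integration.integral_cong) (auto simp: indicator_def)
    finally show ?thesis .
  qed
  have Ik: "integrable lebesgue (\<lambda>t. indicator ?I t *\<^sub>R k t)" using k by (simp add: set_integrable_def)
  have lim: "(\<lambda>n. integral (J (s n)) k) \<longlonglongrightarrow> (\<integral>t. m t *\<^sub>R (indicator ?I t *\<^sub>R k t) \<partial>lebesgue)"
    if s: "\<And>t. t \<in> ?I \<Longrightarrow> (\<lambda>n. indicat_real {..s n} t) \<longlonglongrightarrow> m t" and m: "m \<in> borel_measurable lebesgue" for s m
    unfolding Jint
  proof (rule integral_dominated_convergence[where w="\<lambda>t. norm (indicator ?I t *\<^sub>R k t)"])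
    show "(\<lambda>t. m t *\<^sub>R (indicator ?I t *\<^sub>R k t)) \<in> borel_measurable lebesgue"
      by (rule borel_measurable_scaleR[OF m borel_measurable_integrable[OF Ik]])
    show "(\<lambda>t. indicat_real {..s n} t *\<^sub>R (indicator ?I t *\<^sub>R k t)) \<in> borel_measurable lebesgue" for n
      by (rule borel_measurable_scaleR[OF borel_measurable_indicator borel_measurable_integrable[OF Ik]]) simp
    show "integrable lebesgue (\<lambda>t. norm (indicator ?I t *\<^sub>R k t))" using Ik by (rule integrable_norm)
    show "AE t in lebesgue. (\<lambda>n. indicat_real {..s n} t *\<^sub>R (indicator ?I t *\<^sub>R k t)) \<longlonglongrightarrow> m t *\<^sub>R (indicator ?I t *\<^sub>R k t)"
    proof (rule AE_I2)
      fix t show "(\<lambda>n. indicat_real {..s n} t *\<^sub>R (indicator ?I t *\<^sub>R k t)) \<longlonglongrightarrow> m t *\<^sub>R (indicator ?I t *\<^sub>R k t)"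
        by (cases "t \<in> ?I") (auto intro!: tendsto_scaleR s)
    qed
  qed (auto simp: indicator_def)
  have real_S: "S = ereal (real_of_ereal S) \<and> real_of_ereal S \<in> ?I" if "a < S" "S < b" for S
    using that by (cases S) (auto simp: einterval_def)
  show ?thesis
  proof (rule that)
    show "((\<lambda>x. H (real_of_ereal x)) \<longlongrightarrow> L) (at_right a)"
    proof (rule tendsto_at_right_sequentially[OF ab])
      fix S :: "nat \<Rightarrow> ereal" assume S: "\<And>n. a < S n" "\<And>n. S n < b" "S \<longlonglongrightarrow> a"
      have "(\<lambda>n. integral (J (real_of_ereal (S n))) k) \<longlonglongrightarrow> (\<integral>t. 0 *\<^sub>R (indicator ?I t *\<^sub>R k t) \<partial>lebesgue)"
      proof (rule lim)
        fix t assume "t \<in> ?I"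
        then have "a < ereal t" by (simp add: einterval_def)
        then have "\<forall>\<^sub>F n in sequentially. S n < ereal t" using S(3) by (rule order_tendstoD(2)[rotated])
        then have "\<forall>\<^sub>F n in sequentially. indicat_real {..real_of_ereal (S n)} t = 0"
        proof eventually_elim
          case (elim n)
          then have "real_of_ereal (S n) < t" using real_S[OF S(1,2), of n] by (metis ereal_less(2) less_ereal.simps(1))
          then show ?case by simp
        qed
        then show "(\<lambda>n. indicat_real {..real_of_ereal (S n)} t) \<longlonglongrightarrow> 0" by (rule tendsto_eventually)
      qed simp
      then have "(\<lambda>n. L + integral (J (real_of_ereal (S n))) k) \<longlonglongrightarrow> L + 0"
        by (intro tendsto_add tendsto_const) simp
      then show "(\<lambda>n. H (real_of_ereal (S n))) \<longlonglongrightarrow> L" using HJ real_S[OF S(1,2)] by simp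
    qed
    show "((\<lambda>x. H (real_of_ereal x)) \<longlongrightarrow> L + integral ?I k) (at_left b)"
    proof (rule tendsto_at_left_sequentially[OF ab])
      fix S :: "nat \<Rightarrow> ereal" assume S: "\<And>n. S n < b" "\<And>n. a < S n" "S \<longlonglongrightarrow> b"
      have "(\<lambda>n. integral (J (real_of_ereal (S n))) k) \<longlonglongrightarrow> (\<integral>t. 1 *\<^sub>R (indicator ?I t *\<^sub>R k t) \<partial>lebesgue)"
      proof (rule lim)
        fix t assume "t \<in> ?I"
        then have "ereal t < b" by (simp add: einterval_def)
        then have "\<forall>\<^sub>F n in sequentially. ereal t < S n" using S(3) by (rule order_tendstoD(1)[rotated])
        then have "\<forall>\<^sub>F n in sequentially. indicat_real {..real_of_ereal (S n)} t = 1"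
        proof eventually_elim
          case (elim n)
          then have "t < real_of_ereal (S n)" using real_S[OF S(2,1), of n] by (metis less_ereal.simps(1))
          then show ?case by simp
        qed
        then show "(\<lambda>n. indicat_real {..real_of_ereal (S n)} t) \<longlonglongrightarrow> 1" by (rule tendsto_eventually)
      qed simp
      also have "(\<integral>t. 1 *\<^sub>R (indicator ?I t *\<^sub>R k t) \<partial>lebesgue) = integral ?I k"
        using set_lebesgue_integral_eq_integral(2)[OF k] by (simp add: set_lebesgue_integral_def)
      finally have "(\<lambda>n. L + integral (J (real_of_ereal (S n))) k) \<longlonglongrightarrow> L + integral ?I k"
        by (intro tendsto_add tendsto_const)
      then show "(\<lambda>n. H (real_of_ereal (S n))) \<longlonglongrightarrow> L + integral ?I k" using HJ real_S[OF S(2,1)] by simp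
    qed
  qed
qed

context sturm_liouville
begin

lemma r_measurable: "r \<in> borel_measurable (lebesgue_on I)"
  using coeff by (simp add: sl_coefficients_def)

lemma AE_M_iff: "(AE x in M. P x) \<longleftrightarrow> (AE x in lebesgue_on I. P x)"
proof -
  have "(AE x in M. P x) \<longleftrightarrow> (AE x in lebesgue_on I. 0 < ennreal (r x) \<longrightarrow> P x)"
    unfolding sl_measure_def by (rule AE_density) (intro measurable_compose[OF r_measurable] measurable_ennreal)
  also have "\<dots> \<longleftrightarrow> (AE x in lebesgue_on I. P x)"
    using AE_pos(2) by (auto elim: eventually_elim2)
  finally show ?thesis .
qed

lemma borel_measurable_M_iff: "f \<in> borel_measurable M \<longleftrightarrow> f \<in> borel_measurable (lebesgue_on I)"
  unfolding sl_measure_def by simp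

lemma integrable_M_iff:
  fixes h :: "real \<Rightarrow> 'b::euclidean_space"
  assumes "h \<in> borel_measurable M"
  shows "integrable M h \<longleftrightarrow> (\<lambda>x. r x *\<^sub>R h x) absolutely_integrable_on I"
  using weighted_integrable_iff(1)[OF I_lebesgue r_measurable AE_pos(2)] assms
  unfolding borel_measurable_M_iff by (simp add: sl_measure_def)

lemma integral_M:
  fixes h :: "real \<Rightarrow> 'b::euclidean_space"
  assumes "integrable M h"
  shows "(\<lambda>x. r x *\<^sub>R h x) absolutely_integrable_on I" "integral\<^sup>L M h = integral I (\<lambda>x. r x *\<^sub>R h x)"
proof -
  have m: "h \<in> borel_measurable (lebesgue_on I)" using borel_measurable_integrable[OF assms] by (simp add: borel_measurable_M_iff)
  show "(\<lambda>x. r x *\<^sub>R h x) absolutely_integrable_on I"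
    using assms integrable_M_iff[OF borel_measurable_integrable[OF assms]] by simp
  show "integral\<^sup>L M h = integral I (\<lambda>x. r x *\<^sub>R h x)"
    using weighted_integrable_iff(2)[OF I_lebesgue r_measurable AE_pos(2) m] assms by (simp add: sl_measure_def)
qed

lemma sq_integrable_indicator:
  assumes "x \<in> I" "y \<in> I"
  shows "sq_integrable M (\<lambda>t. indicator {x..y} t)"
  unfolding sq_integrable_def
proof
  have Is: "{x..y} \<in> sets (lebesgue_on I)"
    using I_sub[OF assms] by (simp add: sets_restrict_space_iff I_lebesgue)
  show "(\<lambda>t. indicator {x..y} t) \<in> borel_measurable M"
    unfolding borel_measurable_M_iff using Is by (rule borel_measurable_indicator)
  have "set_integrable lebesgue {x..y} r"
    using coeff I_sub[OF assms] by (auto simp: sl_coefficients_def loc_integrable_def)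
  then have "(\<lambda>t. indicat_real {x..y} t *\<^sub>R r t) absolutely_integrable_on I"
  proof -
    have "(\<lambda>t. indicat_real I t *\<^sub>R indicat_real {x..y} t *\<^sub>R r t) = (\<lambda>t. indicat_real {x..y} t *\<^sub>R r t)"
      using I_sub[OF assms] by (auto simp: indicator_def fun_eq_iff)
    then show ?thesis using \<open>set_integrable lebesgue {x..y} r\<close> by (simp add: set_integrable_def)
  qed
  then have "(\<lambda>t. r t *\<^sub>R indicat_real {x..y} t) absolutely_integrable_on I"
    by (simp add: mult.commute)
  then have "integrable M (indicat_real {x..y})"
    by (subst integrable_M_iff) (use borel_measurable_indicator[OF Is, where 'b=real] in
      \<open>auto simp: borel_measurable_M_iff\<close>)
  moreover have "(\<lambda>t. (cmod (indicator {x..y} t))\<^sup>2) = indicat_real {x..y}"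
    by (auto simp: indicator_def)
  ultimately show "integrable M (\<lambda>t. (cmod (indicator {x..y} t))\<^sup>2)" by simp
qed

text \<open>The weight is integrable on compact intervals, so their indicators are square-integrable.\<close>

lemma sq_integrable_local:
  assumes f: "sq_integrable M f" and xy: "x \<in> I" "y \<in> I"
  shows "(\<lambda>t. complex_of_real (r t) * f t) absolutely_integrable_on {x..y}"
proof -
  have "integrable M (\<lambda>t. indicator {x..y} t * f t)"
    by (rule integrable_cnj_mult(1)[OF sq_integrable_indicator[OF xy] f])
  from integral_M(1)[OF this]
  have "(\<lambda>t. r t *\<^sub>R (indicator {x..y} t * f t)) absolutely_integrable_on {x..y}"
    by (rule set_integrable_subset) (use I_sub[OF xy] in auto)
  then show ?thesis
    by (rule back_subst[of "\<lambda>P. P", OF _ set_integrable_cong]) (auto simp: scaleR_conv_of_real)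
qed

section \<open>The maximal domain and its Wronskians\<close>

lemma max_domD:
  assumes "y \<in> \<D>"
  shows "sq_integrable M y" "sq_integrable M (\<tau> y)"
    "sl_pair y (qderiv a b p y) (\<tau> y)"
  using assms by (auto simp: max_dom_def intro: sl_regular_pair)

lemma max_domI:
  assumes "sl_pair y y1 w" "sq_integrable M y" "sq_integrable M w"
  shows "y \<in> \<D>" "AE x in M. \<tau> y x = w x"
proof -
  note P = sl_pairD[OF assms(1)]
  show ae: "AE x in M. \<tau> y x = w x" unfolding AE_M_iff by (rule P(3))
  have "\<tau> y \<in> borel_measurable M"
    using borel_measurable_lebesgue_on_AE_cong[OF I_lebesgue _ P(3)] assms(3)
    by (auto simp: sq_integrable_def borel_measurable_M_iff)
  then have "sq_integrable M (\<tau> y)" using ae by (rule sq_integrable_AE_cong[OF assms(3)])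
  then show "y \<in> \<D>" using assms P(1) by (simp add: max_dom_def)
qed

lemma sl_pair_measurable:
  assumes "sl_pair y y1 w"
  shows "y \<in> borel_measurable M"
proof -
  have "continuous_on I y" using assms by (auto simp: sl_pair_def intro: primitive_on_continuous_on open_I)
  then show ?thesis
    unfolding borel_measurable_M_iff by (rule continuous_imp_measurable_on_sets_lebesgue) (rule I_lebesgue)
qed

lemma sl_pair_unique:
  assumes "sl_pair y y1 w" "sl_pair u u1 v" "AE x in M. y x = u x"
  shows "\<And>x. x \<in> I \<Longrightarrow> y x = u x" "\<And>x. x \<in> I \<Longrightarrow> y1 x = u1 x" "AE x in M. w x = v x"
proof -
  have c: "continuous_on I y" "continuous_on I u"
    using assms(1,2) by (auto simp: sl_pair_def intro: primitive_on_continuous_on open_I)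
  show eq: "y x = u x" if "x \<in> I" for x
    using continuous_AE_eq_imp_eq[OF open_I c _ that] assms(3) by (simp add: AE_M_iff)
  have "sl_pair u y1 w" by (rule sl_pair_cong[OF assms(1)]) (use eq in auto)
  from sl_pairD[OF this] sl_pairD[OF assms(2)]
  show "\<And>x. x \<in> I \<Longrightarrow> y1 x = u1 x" "AE x in M. w x = v x"
    unfolding AE_M_iff by (auto elim: eventually_elim2)
qed

lemma max_dom_lin:
  assumes y: "y \<in> \<D>" and u: "u \<in> \<D>"
  shows "(\<lambda>x. y x + c * u x) \<in> \<D>"
    "AE x in M. \<tau> (\<lambda>x. y x + c * u x) x = \<tau> y x + c * \<tau> u x"
proof -
  note Y = max_domD[OF y] and U = max_domD[OF u]
  note P = sl_pair_add[OF Y(3) sl_pair_scale[OF U(3), of c]]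
  show "(\<lambda>x. y x + c * u x) \<in> \<D>"
    "AE x in M. \<tau> (\<lambda>x. y x + c * u x) x = \<tau> y x + c * \<tau> u x"
    by (rule max_domI[OF P]; intro sq_integrable_add sq_integrable_scale Y U)+
qed

lemma max_dom_cnj:
  assumes y: "y \<in> \<D>"
  shows "(\<lambda>x. cnj (y x)) \<in> \<D>"
    "AE x in M. \<tau> (\<lambda>x. cnj (y x)) x = cnj (\<tau> y x)"
  using max_domI[OF sl_pair_cnj[OF max_domD(3)[OF y]] sq_integrable_cnj[OF max_domD(1)[OF y]]
      sq_integrable_cnj[OF max_domD(2)[OF y]]] by auto

definition lagrange :: "(real \<Rightarrow> complex) \<Rightarrow> (real \<Rightarrow> complex) \<Rightarrow> real \<Rightarrow> complex" where
  "lagrange f g x = \<tau> f x * g x - f x * \<tau> g x"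

text \<open>By Lagrange's identity the Wronskian is a primitive of a function that is integrable up to both
  ends of the interval.\<close>

lemma wronskian_limits:
  assumes f: "f \<in> \<D>" and g: "g \<in> \<D>"
  shows "integrable M (lagrange f g)"
    and "((\<lambda>x. wronskian a b p f g (real_of_ereal x)) \<longlongrightarrow> wronskian_at_left_end a b p f g) (at_right a)"
    and "((\<lambda>x. wronskian a b p f g (real_of_ereal x)) \<longlongrightarrow>
      wronskian_at_left_end a b p f g + integral\<^sup>L M (lagrange f g)) (at_left b)"
proof -
  note F = max_domD[OF f] and G = max_domD[OF g]
  show i: "integrable M (lagrange f g)"
    unfolding lagrange_def[abs_def]
    by (intro Bochner_Integration.integrable_diff integrable_cnj_mult(1) F G)
  have W: "primitive_on I (wronskian a b p f g) (\<lambda>x. r x *\<^sub>R lagrange f g x)"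
    using sl_pair_wronskian[OF F(3) G(3)]
    by (simp add: wronskian_def[abs_def] lagrange_def scaleR_conv_of_real)
  obtain L where L: "((\<lambda>x. wronskian a b p f g (real_of_ereal x)) \<longlongrightarrow> L) (at_right a)"
    "((\<lambda>x. wronskian a b p f g (real_of_ereal x)) \<longlongrightarrow> L + integral I (\<lambda>x. r x *\<^sub>R lagrange f g x)) (at_left b)"
    using primitive_limits[OF ab W integral_M(1)[OF i]] by blast
  have "L = wronskian_at_left_end a b p f g"
    unfolding wronskian_at_left_end_def
    by (rule tendsto_Lim[OF einterval_at_right_neq_bot(1)[OF ab] L(1), symmetric])
  then show "((\<lambda>x. wronskian a b p f g (real_of_ereal x)) \<longlongrightarrow> wronskian_at_left_end a b p f g) (at_right a)"
    "((\<lambda>x. wronskian a b p f g (real_of_ereal x)) \<longlongrightarrow>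
      wronskian_at_left_end a b p f g + integral\<^sup>L M (lagrange f g)) (at_left b)"
    using L integral_M(2)[OF i] by simp_all
qed

section \<open>Wronskians at a limit point endpoint\<close>

lemma eventually_at_left_I:
  assumes "eventually P (at_left b)"
  obtains c where "c \<in> I" "\<And>x. x \<in> I \<Longrightarrow> c \<le> x \<Longrightarrow> P (ereal x)"
proof -
  obtain B where B: "B < b" "\<And>y. B < y \<Longrightarrow> y < b \<Longrightarrow> P y"
    using assms unfolding eventually_at_left[OF ab] by blast
  obtain C where C: "max a B < C" "C < b" using dense[of "max a B" b] ab B(1) by auto
  then obtain c where c: "C = ereal c" by (cases C) auto
  show ?thesis
  proof (rule that[of c])
    show "c \<in> I" using C c by (simp add: einterval_def)
    fix x assume "x \<in> I" "c \<le> x"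
    moreover have "B < ereal c" using C c by simp
    ultimately have "B < ereal x" by (meson ereal_less_eq(3) less_le_trans)
    then show "P (ereal x)" using \<open>x \<in> I\<close> by (intro B(2)) (auto simp: einterval_def)
  qed
qed

text \<open>Where \<open>W(f,g)\<close> does not vanish, \<open>f\<close> and \<open>g\<close> serve as a basis:
  \<open>u * W(f,g) = f * W(u,g) - g * W(u,f)\<close>. By Lagrange's identity the coefficients \<open>W(u,g)\<close> and
  \<open>W(u,f)\<close> satisfy a linear system of integral equations, and its kernel is integrable up to \<open>b\<close>,
  being made of products of functions from \<open>L2\<close>. Hence the coefficients are bounded near \<open>b\<close>, and \<open>u\<close>
  is dominated by \<open>f\<close> and \<open>g\<close>.\<close>

lemma wronskian_nonzero_imp_solution_sq_integrable:
  assumes f: "f \<in> \<D>" and g: "g \<in> \<D>"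
    and W: "((\<lambda>x. wronskian a b p f g (real_of_ereal x)) \<longlongrightarrow> L) (at_left b)" and L: "L \<noteq> 0"
    and u: "sl_solution a b p q r z u"
  shows "\<exists>c\<in>I. sq_integrable (sl_measure (ereal c) b r) u"
proof -
  note F = max_domD[OF f] and G = max_domD[OF g]
  define f1 g1 u1 where "f1 = qderiv a b p f" and "g1 = qderiv a b p g" and "u1 = qderiv a b p u"
  define tf tg where "tf = \<tau> f" and "tg = \<tau> g"
  define \<delta> where "\<delta> = cmod L / 2"
  have \<delta>: "\<delta> > 0" using L by (simp add: \<delta>_def)
  have fp: "sl_pair f f1 tf" and gp: "sl_pair g g1 tg" using F(3) G(3) by (simp_all add: f1_def g1_def tf_def tg_def)
  have up: "sl_pair u u1 (\<lambda>x. z * u x)"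
    unfolding u1_def using u by (intro sl_pair_cong[OF sl_regular_pair[of u]])
      (auto simp: sl_solution_def elim: eventually_mono)
  define A B D where "A x = u x * g1 x - u1 x * g x" and "B x = u x * f1 x - u1 x * f x"
    and "D x = f x * g1 x - f1 x * g x" for x
  have expand: "u x * D x = f x * A x - g x * B x" for x
    by (simp add: A_def B_def D_def algebra_simps)
  have A: "primitive_on I A (\<lambda>x. complex_of_real (r x) * (u x * (z * g x - tg x)))"
    unfolding A_def[abs_def] using sl_pair_wronskian[OF up gp] by (simp add: algebra_simps)
  have B: "primitive_on I B (\<lambda>x. complex_of_real (r x) * (u x * (z * f x - tf x)))"
    unfolding B_def[abs_def] using sl_pair_wronskian[OF up fp] by (simp add: algebra_simps)
  have "\<forall>\<^sub>F x in at_left b. \<delta> < cmod (wronskian a b p f g (real_of_ereal x))"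
    using tendsto_norm[OF W] by (rule order_tendstoD) (use L in \<open>simp add: \<delta>_def\<close>)
  then obtain c0 where c0: "c0 \<in> I" "\<And>x. x \<in> I \<Longrightarrow> c0 \<le> x \<Longrightarrow> \<delta> < cmod (D x)"
    by (rule eventually_at_left_I) (simp add: D_def wronskian_def f1_def g1_def)
  define S where "S x = cmod (f x) + cmod (g x)" for x
  define Z where "Z x = cmod (z * g x - tg x) + cmod (z * f x - tf x)" for x
  have u_le: "cmod (u x) \<le> S x * (cmod (A x) + cmod (B x)) / \<delta>" if x: "x \<in> I" "c0 \<le> x" for x
  proof -
    have "\<delta> * cmod (u x) \<le> cmod (u x) * cmod (D x)"
      using mult_right_mono[of \<delta> "cmod (D x)" "cmod (u x)"] c0(2)[OF x] by (simp add: mult.commute)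
    also have "\<dots> = cmod (f x * A x - g x * B x)" by (simp flip: expand norm_mult)
    also have "\<dots> \<le> cmod (f x) * cmod (A x) + cmod (g x) * cmod (B x)"
      by (metis norm_mult norm_triangle_ineq4)
    also have "\<dots> \<le> S x * cmod (A x) + S x * cmod (B x)"
      unfolding S_def by (intro add_mono mult_right_mono) auto
    finally show ?thesis using \<delta> by (simp add: field_simps)
  qed
  have zg: "sq_integrable M (\<lambda>x. z * g x - tg x)" and zf: "sq_integrable M (\<lambda>x. z * f x - tf x)"
    unfolding tf_def tg_def using F G by (auto intro: sq_integrable_diff sq_integrable_scale)
  have i: "integrable M (\<lambda>x. cmod (h x) * cmod (k x))" if "sq_integrable M h" "sq_integrable M k" for h k
    using integrable_norm[OF integrable_cnj_mult(1)[OF that]] by (simp add: norm_mult)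
  have SZ: "integrable M (\<lambda>x. S x * Z x / \<delta>)"
    unfolding S_def Z_def using i[OF F(1) zg] i[OF F(1) zf] i[OF G(1) zg] i[OF G(1) zf]
    by (simp add: distrib_left distrib_right)
  define k where "k x = \<bar>r x\<bar> * (S x * Z x / \<delta>)" for x
  have SZ0: "0 \<le> S x * Z x / \<delta>" for x using \<delta> by (simp add: S_def Z_def)
  have kI: "k absolutely_integrable_on I"
  proof -
    have "\<bar>S x\<bar> = S x" "\<bar>Z x\<bar> = Z x" for x by (simp_all add: S_def Z_def)
    then show ?thesis
      using set_integrable_norm[OF integral_M(1)[OF SZ]] \<delta> by (simp add: k_def[abs_def] abs_mult)
  qed
  obtain x0 where x0: "x0 \<in> I" using c0 by blast
  have kxy: "k absolutely_integrable_on {x..y}" if "x \<in> I" "y \<in> I" for x y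
    by (rule set_integrable_subset[OF kI]) (use I_sub[OF that] in auto)
  define K where "K = oriented_integral x0 k"
  have K: "primitive_on I K k"
    unfolding K_def by (rule primitive_on_oriented_integral[OF is_interval_I x0 kxy])
  obtain KL where "((\<lambda>x. K (real_of_ereal x)) \<longlongrightarrow> KL) (at_left b)"
    using primitive_limits[OF ab K kI] by blast
  then have "\<forall>\<^sub>F x in at_left b. dist (K (real_of_ereal x)) KL < 1/4" by (rule tendstoD) simp
  then obtain c1 where c1: "c1 \<in> I" "\<And>x. x \<in> I \<Longrightarrow> c1 \<le> x \<Longrightarrow> dist (K x) KL < 1/4"
    by (rule eventually_at_left_I) simp
  \<comment> \<open>from \<open>c\<close> on the kernel has total mass at most one half\<close>
  define c where "c = max c0 c1"
  have c: "c \<in> I" "c0 \<le> c" "c1 \<le> c" using c0 c1 by (auto simp: c_def max_def)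
  have half: "integral {c..x} k \<le> 1/2" if "x \<in> I" "c \<le> x" for x
    using primitive_onD(3)[OF K c(1) that] c1(2)[OF c(1,3)] c1(2)[OF that(1) order_trans[OF c(3) that(2)]]
    unfolding dist_real_def by linarith
  define N where "N x = cmod (A x) + cmod (B x)" for x
  have Nbound: "N x \<le> 2 * N c" if X: "x \<in> I" "c \<le> x" for x
  proof -
    have "continuous_on {c..x} N"
      unfolding N_def[abs_def] using I_sub[OF c(1) X(1)] A B
      by (intro continuous_intros) (auto intro: continuous_on_subset primitive_on_continuous_on[OF _ open_I])
    \<comment> \<open>at the maximum of \<open>N\<close> the integral inequality gives \<open>N m \<le> N c + N m / 2\<close>\<close>
    then obtain m where m: "m \<in> {c..x}" "\<And>t. t \<in> {c..x} \<Longrightarrow> N t \<le> N m"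
      using continuous_attains_sup[of "{c..x}" N] X by auto
    have mI: "m \<in> I" "c \<le> m" using m I_sub[OF c(1) X(1)] by auto
    have int: "(\<lambda>t. N m * (\<bar>r t\<bar> * (S t * cmod (h t) / \<delta>))) integrable_on {c..m}" if h: "sq_integrable M h" for h
    proof -
      have "integrable M (\<lambda>t. S t * cmod (h t) / \<delta>)"
        unfolding S_def using i[OF F(1) h] i[OF G(1) h] by (simp add: distrib_right)
      from set_integrable_norm[OF integral_M(1)[OF this]]
      have "(\<lambda>t. \<bar>r t\<bar> * (S t * cmod (h t) / \<delta>)) absolutely_integrable_on I"
        using \<delta> by (simp add: abs_mult S_def)
      then have "(\<lambda>t. \<bar>r t\<bar> * (S t * cmod (h t) / \<delta>)) absolutely_integrable_on {c..m}"
        by (rule set_integrable_subset) (use I_sub[OF c(1) mI(1)] in auto)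
      then show ?thesis
        by (intro integrable_on_mult_right) (simp add: absolutely_integrable_on_def)
    qed
    have est: "cmod (E m - E c) \<le> integral {c..m} (\<lambda>t. N m * (\<bar>r t\<bar> * (S t * cmod (h t) / \<delta>)))"
      if E: "primitive_on I E (\<lambda>x. complex_of_real (r x) * (u x * h x))" and h: "sq_integrable M h" for E h
    proof -
      note P = primitive_onD[OF E c(1) mI]
      show ?thesis
        unfolding P(3)[symmetric]
      proof (rule Henstock_Kurzweil_Integration.integral_norm_bound_integral[OF _ int[OF h]])
        show "(\<lambda>x. complex_of_real (r x) * (u x * h x)) integrable_on {c..m}"
          using P(1) by (simp add: absolutely_integrable_on_def)
        fix t assume t: "t \<in> {c..m}"
        then have tI: "t \<in> I" "c0 \<le> t" "t \<in> {c..x}" using I_sub[OF c(1) mI(1)] c m by auto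
        have "cmod (u t) \<le> S t * N t / \<delta>" using u_le[OF tI(1,2)] by (simp add: N_def)
        also have "\<dots> \<le> S t * N m / \<delta>"
          using m(2)[OF tI(3)] \<delta> by (intro divide_right_mono mult_left_mono) (auto simp: S_def)
        finally have "cmod (u t) \<le> S t * N m / \<delta>" .
        then have "\<bar>r t\<bar> * (cmod (u t) * cmod (h t)) \<le> \<bar>r t\<bar> * ((S t * N m / \<delta>) * cmod (h t))"
          by (intro mult_left_mono mult_right_mono) auto
        then show "cmod (complex_of_real (r t) * (u t * h t)) \<le> N m * (\<bar>r t\<bar> * (S t * cmod (h t) / \<delta>))"
          by (simp add: norm_mult field_simps)
      qed
    qed
    have "N m \<le> N c + (cmod (A m - A c) + cmod (B m - B c))"
      unfolding N_def using norm_triangle_ineq2[of "A m" "A c"] norm_triangle_ineq2[of "B m" "B c"] by linarith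
    also have "cmod (A m - A c) + cmod (B m - B c) \<le>
        integral {c..m} (\<lambda>t. N m * (\<bar>r t\<bar> * (S t * cmod (z * g t - tg t) / \<delta>)))
        + integral {c..m} (\<lambda>t. N m * (\<bar>r t\<bar> * (S t * cmod (z * f t - tf t) / \<delta>)))"
      by (intro add_mono est A B zf zg)
    also have "\<dots> = integral {c..m} (\<lambda>t. N m * k t)"
      unfolding Henstock_Kurzweil_Integration.integral_add[OF int[OF zg] int[OF zf], symmetric]
      by (rule Henstock_Kurzweil_Integration.integral_cong) (simp add: k_def Z_def algebra_simps add_divide_distrib)
    also have "\<dots> = N m * integral {c..m} k" by simp
    also have "\<dots> \<le> N m * (1/2)" using half[OF mI] by (intro mult_left_mono) (auto simp: N_def)
    finally have "N m \<le> 2 * N c" by simp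
    then show ?thesis using m(2)[of x] X by simp
  qed
  have sub: "einterval (ereal c) b \<subseteq> I" using c(1) by (auto simp: einterval_def intro: less_trans)
  have ub: "(cmod (u x))\<^sup>2 \<le> C * (cmod (f x))\<^sup>2 + C * (cmod (g x))\<^sup>2"
    if "x \<in> I" "c \<le> x" "C = 2 * (2 * N c / \<delta>)\<^sup>2" for x C
  proof -
    have "cmod (u x) \<le> S x * N x / \<delta>" using u_le[of x] that c by (simp add: N_def)
    also have "\<dots> \<le> S x * (2 * N c) / \<delta>"
      using Nbound[of x] that \<delta> by (intro divide_right_mono mult_left_mono) (auto simp: S_def)
    finally have "(cmod (u x))\<^sup>2 \<le> (S x * (2 * N c) / \<delta>)\<^sup>2" by (intro power_mono) auto
    also have "\<dots> = (2 * N c / \<delta>)\<^sup>2 * (S x)\<^sup>2" by (simp add: power_mult_distrib power_divide)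
    also have "\<dots> \<le> (2 * N c / \<delta>)\<^sup>2 * (2 * (cmod (f x))\<^sup>2 + 2 * (cmod (g x))\<^sup>2)"
      unfolding S_def using sum_squares_bound[of "cmod (f x)" "cmod (g x)"]
      by (intro mult_left_mono) (auto simp: power2_sum)
    finally show ?thesis using that(3) by (simp add: algebra_simps)
  qed
  define Jc where "Jc = einterval (ereal c) b"
  have Jl: "Jc \<in> sets lebesgue" by (simp add: Jc_def borel_einterval sets_completionI_sets)
  have JI: "Jc \<subseteq> I" using sub by (simp add: Jc_def)
  have meas: "h \<in> borel_measurable (lebesgue_on Jc)" if "h \<in> borel_measurable (lebesgue_on I)"
    for h :: "real \<Rightarrow> 'c::euclidean_space"
    using measurable_restrict_mono[OF that JI] .
  have rJ: "AE x in lebesgue_on Jc. 0 < r x"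
    using AE_pos(2) JI Jl I_lebesgue by (auto simp: AE_restrict_space_iff elim: eventually_mono)
  define M' where "M' = sl_measure (ereal c) b r"
  have M': "M' = density (lebesgue_on Jc) (\<lambda>x. ennreal (r x))" by (simp add: M'_def sl_measure_def Jc_def)
  have restr: "sq_integrable M' h" if h: "sq_integrable M h" for h
    unfolding sq_integrable_def
  proof
    have hm: "h \<in> borel_measurable (lebesgue_on I)"
      using h by (simp add: sq_integrable_def borel_measurable_M_iff)
    show "h \<in> borel_measurable M'" using meas[OF hm] by (simp add: M')
    have "(\<lambda>x. r x *\<^sub>R (cmod (h x))\<^sup>2) absolutely_integrable_on Jc"
      by (rule set_integrable_subset[OF integral_M(1)[OF sq_integrableD(2)[OF h]] Jl JI])
    moreover have "(\<lambda>x. (cmod (h x))\<^sup>2) \<in> borel_measurable (lebesgue_on Jc)"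
      using meas[OF hm] by measurable
    ultimately show "integrable M' (\<lambda>x. (cmod (h x))\<^sup>2)"
      using weighted_integrable_iff(1)[OF Jl meas[OF r_measurable] rJ] unfolding M' by blast
  qed
  have um: "u \<in> borel_measurable M'"
    using sl_pair_measurable[OF up] meas unfolding M' borel_measurable_M_iff by simp
  have "sq_integrable M' u"
  proof (rule sq_integrable_bound[OF restr[OF F(1)] restr[OF G(1)] um], rule AE_I2)
    fix x assume "x \<in> space M'"
    then have "x \<in> I" "c \<le> x"
      using JI by (auto simp: M' space_restrict_space Jc_def einterval_def)
    then show "(cmod (u x))\<^sup>2 \<le> 2 * (2 * N c / \<delta>)\<^sup>2 * (cmod (f x))\<^sup>2 + 2 * (2 * N c / \<delta>)\<^sup>2 * (cmod (g x))\<^sup>2"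
      by (rule ub) simp
  qed
  then show ?thesis using c(1) unfolding M'_def by blast
qed

text \<open>The Wronskian vanishes at \<open>b\<close>, since otherwise all solutions would be square-integrable there.
  So its value at \<open>a\<close> alone accounts for the integral in Green's formula.\<close>

lemma wronskian_vanishes_at_limit_point:
  assumes lp: "limit_point_right a b p q r"
    and f: "f \<in> \<D>" and g: "g \<in> \<D>"
  shows "wronskian_at_left_end a b p f g = - integral\<^sup>L M (lagrange f g)"
proof (rule ccontr)
  assume "wronskian_at_left_end a b p f g \<noteq> - integral\<^sup>L M (lagrange f g)"
  then have "wronskian_at_left_end a b p f g + integral\<^sup>L M (lagrange f g) \<noteq> 0"
    by (simp add: eq_neg_iff_add_eq_0)
  then show False
    using wronskian_nonzero_imp_solution_sq_integrable[OF f g wronskian_limits(3)[OF f g]] lp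
    unfolding limit_point_right_def limit_circle_right_def by blast
qed

end

section \<open>Existence of solutions\<close>

lemma absolutely_integrable_mult_continuous:
  fixes f g :: "real \<Rightarrow> complex"
  assumes g: "g absolutely_integrable_on {x..y}" and f: "continuous_on {x..y} f"
  shows "(\<lambda>t. g t * f t) absolutely_integrable_on {x..y}"
proof -
  have "(\<lambda>t. (*) (f t) (g t)) absolutely_integrable_on {x..y}"
  proof (rule absolutely_integrable_bounded_measurable_product[where h="(*)" and f=f and g=g and S="{x..y}"])
    show "bilinear ((*) :: complex \<Rightarrow> complex \<Rightarrow> complex)"
      by (simp add: bilinear_conv_bounded_bilinear bounded_bilinear_mult)
    show "f \<in> borel_measurable (lebesgue_on {x..y})"
      using f by (rule continuous_imp_measurable_on_sets_lebesgue) simp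
    show "bounded (f ` {x..y})"
      using compact_continuous_image[OF f] by (simp add: compact_imp_bounded)
  qed (use g in auto)
  then show ?thesis by (simp add: mult.commute)
qed

lemma primitive_norm_bound:
  fixes F f :: "real \<Rightarrow> 'b::euclidean_space" and G g :: "real \<Rightarrow> real"
  assumes F: "primitive_on S F f" and G: "primitive_on S G g" and x: "x0 \<in> S" "x \<in> S"
    and 0: "F x0 = 0" "G x0 = 0"
    and le: "\<And>t. t \<in> {min x0 x..max x0 x} \<Longrightarrow> norm (f t) \<le> g t"
  shows "norm (F x) \<le> \<bar>G x\<bar>"
proof (cases "x0 \<le> x")
  case True
  note P = primitive_onD[OF F x True] and Q = primitive_onD[OF G x True]
  have "norm (integral {x0..x} f) \<le> integral {x0..x} g"
    using P(2) Q(2) le True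
    by (intro Henstock_Kurzweil_Integration.integral_norm_bound_integral) (auto simp: has_integral_iff)
  then show ?thesis using P(3) Q(3) 0 by simp
next
  case False
  then have "x \<le> x0" by simp
  note P = primitive_onD[OF F x(2,1) this] and Q = primitive_onD[OF G x(2,1) this]
  have "norm (integral {x..x0} f) \<le> integral {x..x0} g"
    using P(2) Q(2) le False
    by (intro Henstock_Kurzweil_Integration.integral_norm_bound_integral) (auto simp: has_integral_iff)
  then show ?thesis using P(3) Q(3) 0 by simp
qed

lemma primitive_on_power:
  fixes B k :: "real \<Rightarrow> real"
  assumes B: "primitive_on S B k" and S: "is_interval S"
  shows "primitive_on S (\<lambda>x. B x ^ Suc n / real (Suc n)) (\<lambda>x. B x ^ n * k x)"
proof -
  let ?B = "\<lambda>x. complex_of_real (B x)"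
  have C: "primitive_on S ?B (\<lambda>x. complex_of_real (k x))"
    by (rule primitive_on_linear[OF bounded_linear_of_real B])
  have "primitive_on S (\<lambda>x. ?B x ^ Suc n) (\<lambda>x. of_nat (Suc n) * (?B x ^ n * complex_of_real (k x)))"
  proof (induction n)
    case 0
    then show ?case using C by simp
  next
    case (Suc n)
    have "(\<lambda>x. ?B x ^ Suc n * ?B x) = (\<lambda>x. ?B x ^ Suc (Suc n))" by (simp add: mult.commute fun_eq_iff)
    moreover have "(\<lambda>x. of_nat (Suc n) * (?B x ^ n * complex_of_real (k x)) * ?B x + ?B x ^ Suc n * complex_of_real (k x))
        = (\<lambda>x. of_nat (Suc (Suc n)) * (?B x ^ Suc n * complex_of_real (k x)))"
      by (auto simp: algebra_simps fun_eq_iff)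
    ultimately show ?case using primitive_on_mult[OF Suc C S] by metis
  qed
  from primitive_on_linear[OF bounded_linear_const_mult[OF bounded_linear_Re, of "1 / real (Suc n)"] this]
  have "primitive_on S (\<lambda>x. 1 / real (Suc n) * Re (?B x ^ Suc n))
     (\<lambda>x. 1 / real (Suc n) * Re (of_nat (Suc n) * (?B x ^ n * complex_of_real (k x))))" .
  moreover have "1 / real (Suc n) * Re (?B x ^ Suc n) = B x ^ Suc n / real (Suc n)" for x
    by (simp only: of_real_power[symmetric] Re_complex_of_real) simp
  moreover have "1 / real (Suc n) * Re (of_nat (Suc n) * (?B x ^ n * complex_of_real (k x))) = B x ^ n * k x" for x
  proof -
    have "of_nat (Suc n) * (?B x ^ n * complex_of_real (k x)) = complex_of_real (real (Suc n) * (B x ^ n * k x))"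
      by (simp only: of_real_power of_real_mult of_real_of_nat_eq)
    then show ?thesis by (simp only: Re_complex_of_real) simp
  qed
  ultimately show ?thesis by simp
qed

lemma primitive_on_sum:
  fixes N :: nat
  assumes "\<And>n. n < N \<Longrightarrow> primitive_on S (F n) (f n)"
  shows "primitive_on S (\<lambda>x. \<Sum>n<N. F n x) (\<lambda>x. \<Sum>n<N. f n x)"
  using assms
proof (induction N)
  case 0
  show ?case by (simp add: primitive_on_def)
next
  case (Suc N)
  then show ?case using primitive_on_add[of S "\<lambda>x. \<Sum>n<N. F n x" "\<lambda>x. \<Sum>n<N. f n x" "F N" "f N"] by simp
qed

lemma primitive_eq_oriented_integral:
  assumes "primitive_on S F f" "x0 \<in> S" "x \<in> S" "F x0 = 0"
  shows "F x = oriented_integral x0 f x"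
  using primitive_onD(3)[OF assms(1,2,3)] primitive_onD(3)[OF assms(1,3,2)] assms(4)
  by (auto simp: oriented_integral_def)

lemma oriented_integral_dominated_convergence:
  fixes f :: "nat \<Rightarrow> real \<Rightarrow> complex"
  assumes f: "\<And>n. (f n) absolutely_integrable_on {c..d}" and h: "h integrable_on {c..d}"
    and le: "\<And>n t. t \<in> {c..d} \<Longrightarrow> norm (f n t) \<le> h t"
    and lim: "\<And>t. t \<in> {c..d} \<Longrightarrow> (\<lambda>n. f n t) \<longlonglongrightarrow> g t"
    and x: "x0 \<in> {c..d}" "x \<in> {c..d}"
  shows "(\<lambda>n. oriented_integral x0 (f n) x) \<longlonglongrightarrow> oriented_integral x0 g x"
proof -
  have *: "(\<lambda>n. integral {s..t} (f n)) \<longlonglongrightarrow> integral {s..t} g" if "c \<le> s" "t \<le> d" for s t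
  proof (rule dominated_convergence(2))
    have sub: "{s..t} \<subseteq> {c..d}" using that by auto
    show "f n integrable_on {s..t}" for n
      using f[of n] by (intro integrable_subinterval_real[OF _ sub]) (simp add: absolutely_integrable_on_def)
    show "h integrable_on {s..t}" by (rule integrable_subinterval_real[OF h sub])
  qed (use le lim that in auto)
  show ?thesis
    using *[of x0 x] *[of x x0] x by (auto simp: oriented_integral_def intro: tendsto_minus)
qed

text \<open>Picard iteration for the Volterra equation that is equivalent to a second order equation. On a
  compact interval the \<open>n\<close>-th iterate is at most \<open>C * (\<alpha> * \<bar>B x\<bar>)^n / fact n\<close>, where \<open>B\<close> is the
  primitive of the norm of \<open>kp\<close> and \<open>\<alpha>\<close> bounds the primitive of the norm of \<open>kq\<close>.\<close>

lemma linear_volterra_solution: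
  fixes kp kq Y0 :: "real \<Rightarrow> complex"
  assumes S: "open S" "is_interval S" "x0 \<in> S"
    and kp: "\<And>x y. x \<in> S \<Longrightarrow> y \<in> S \<Longrightarrow> kp absolutely_integrable_on {x..y}"
    and kq: "\<And>x y. x \<in> S \<Longrightarrow> y \<in> S \<Longrightarrow> kq absolutely_integrable_on {x..y}"
    and Y0: "continuous_on S Y0"
  obtains y s where "primitive_on S s (\<lambda>t. kq t * y t)"
    "primitive_on S (\<lambda>x. y x - Y0 x) (\<lambda>t. kp t * s t)" "s x0 = 0" "y x0 = Y0 x0"
proof -
  have sub: "{x..y} \<subseteq> S" if "x \<in> S" "y \<in> S" for x y
    using mem_is_interval_1_I[OF S(2) that] by (meson atLeastAtMost_iff subsetI)
  define e where "e = rec_nat Y0 (\<lambda>_ h. oriented_integral x0 (\<lambda>t. kp t * oriented_integral x0 (\<lambda>t. kq t * h t) t))"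
  define s where "s n = oriented_integral x0 (\<lambda>t. kq t * e n t)" for n
  have e0: "e 0 = Y0" and eS: "e (Suc n) = oriented_integral x0 (\<lambda>t. kp t * s n t)" for n
    by (simp_all add: e_def s_def)
  have ai: "(\<lambda>t. k t * h t) absolutely_integrable_on {x..y}"
    if "\<And>x y. x \<in> S \<Longrightarrow> y \<in> S \<Longrightarrow> k absolutely_integrable_on {x..y}" "continuous_on S h" "x \<in> S" "y \<in> S" for k h :: "real \<Rightarrow> complex" and x y
    by (intro absolutely_integrable_mult_continuous that(1,3,4) continuous_on_subset[OF that(2) sub])
  have opr: "primitive_on S (oriented_integral x0 (\<lambda>t. k t * h t)) (\<lambda>t. k t * h t)"
    if "\<And>x y. x \<in> S \<Longrightarrow> y \<in> S \<Longrightarrow> k absolutely_integrable_on {x..y}" "continuous_on S h" for k h :: "real \<Rightarrow> complex"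
    by (rule primitive_on_oriented_integral[OF S(2,3) ai[OF that]])
  have es: "continuous_on S (e n) \<and> primitive_on S (s n) (\<lambda>t. kq t * e n t) \<and> continuous_on S (s n)
      \<and> primitive_on S (e (Suc n)) (\<lambda>t. kp t * s n t)" for n
  proof (induction n)
    case 0
    have 1: "continuous_on S (e 0)" using Y0 by (simp add: e0)
    have 2: "primitive_on S (s 0) (\<lambda>t. kq t * e 0 t)" unfolding s_def by (rule opr[OF kq 1])
    have 3: "continuous_on S (s 0)" by (rule primitive_on_continuous_on[OF 2 S(1)])
    have "primitive_on S (e (Suc 0)) (\<lambda>t. kp t * s 0 t)" unfolding eS by (rule opr[OF kp 3])
    then show ?case using 1 2 3 by blast
  next
    case (Suc n)
    then have 1: "continuous_on S (e (Suc n))" using primitive_on_continuous_on S(1) by blast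
    have 2: "primitive_on S (s (Suc n)) (\<lambda>t. kq t * e (Suc n) t)" unfolding s_def by (rule opr[OF kq 1])
    have 3: "continuous_on S (s (Suc n))" by (rule primitive_on_continuous_on[OF 2 S(1)])
    have "primitive_on S (e (Suc (Suc n))) (\<lambda>t. kp t * s (Suc n) t)" unfolding eS[of "Suc n"] by (rule opr[OF kp 3])
    then show ?case using 1 2 3 by blast
  qed
  have esc: "continuous_on S (e n)" "continuous_on S (s n)" for n using es[of n] by simp_all
  have s0: "s n x0 = 0" and eS0: "e (Suc n) x0 = 0" for n by (simp_all add: s_def eS)
  define B where "B = oriented_integral x0 (\<lambda>t. norm (kp t))"
  define Q where "Q = oriented_integral x0 (\<lambda>t. norm (kq t))"
  have B: "primitive_on S B (\<lambda>t. norm (kp t))" and Q: "primitive_on S Q (\<lambda>t. norm (kq t))"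
    unfolding B_def Q_def using kp kq by (auto intro!: primitive_on_oriented_integral S set_integrable_norm)
  have B0: "B x0 = 0" "Q x0 = 0" by (simp_all add: B_def Q_def)
  have Bmono: "B x \<le> B y" if "x \<in> S" "y \<in> S" "x \<le> y" for x y
    using has_integral_nonneg[OF primitive_onD(2)[OF B that]] by simp
  have local: "\<exists>K. summable K \<and> (\<forall>n. \<forall>x\<in>{c..d}. norm (e n x) \<le> K n) \<and> (\<exists>\<gamma>\<ge>0. \<forall>n. \<forall>x\<in>{c..d}. norm (s n x) \<le> \<gamma> * K n)"
    if cd: "c \<in> S" "d \<in> S" "x0 \<in> {c..d}" for c d
  proof -
    have bd: "\<exists>C\<ge>0. \<forall>x\<in>{c..d}. norm (h x) \<le> C" if "continuous_on S h" for h :: "real \<Rightarrow> 'z::real_normed_vector"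
    proof -
      have "compact (h ` {c..d})"
        by (rule compact_continuous_image[OF continuous_on_subset[OF that sub[OF cd(1,2)]]]) simp
      then obtain C where "\<forall>z\<in>h ` {c..d}. norm z \<le> C"
        using compact_imp_bounded bounded_iff by metis
      then have C: "\<forall>x\<in>{c..d}. norm (h x) \<le> C" by blast
      then have "\<forall>x\<in>{c..d}. norm (h x) \<le> max 0 C" by (meson le_max_iff_disj)
      then show ?thesis by (meson max.cobounded1)
    qed
    obtain C where C: "C \<ge> 0" "\<And>x. x \<in> {c..d} \<Longrightarrow> norm (Y0 x) \<le> C" using bd[OF Y0] by blast
    obtain \<alpha> where \<alpha>: "\<alpha> \<ge> 0" "\<And>x. x \<in> {c..d} \<Longrightarrow> norm (Q x) \<le> \<alpha>"
      using bd[OF primitive_on_continuous_on[OF Q S(1)]] by blast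
    obtain \<beta> where \<beta>: "\<beta> \<ge> 0" "\<And>x. x \<in> {c..d} \<Longrightarrow> norm (B x) \<le> \<beta>"
      using bd[OF primitive_on_continuous_on[OF B S(1)]] by blast
    have inS: "x \<in> S" if "x \<in> {c..d}" for x using sub[OF cd(1,2)] that by blast
    have between: "t \<in> {c..d}" if "t \<in> {min x0 x..max x0 x}" "x \<in> {c..d}" for t x
      using that cd(3) by (auto simp: min_def max_def split: if_splits)
    have Babs: "\<bar>B t\<bar> \<le> \<bar>B x\<bar>" if "t \<in> {min x0 x..max x0 x}" "x \<in> {c..d}" for t x
      using Bmono[of x0 t] Bmono[of t x] Bmono[of x t] Bmono[of t x0] that inS[OF between[OF that]] inS[OF that(2)] S(3) B0(1)
      by (cases "x0 \<le> x") auto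
    have sbound: "norm (s n x) \<le> \<alpha> * (C * \<alpha>^n * \<bar>B x\<bar>^n / fact n)"
      if IH: "\<And>x. x \<in> {c..d} \<Longrightarrow> norm (e n x) \<le> C * \<alpha>^n * \<bar>B x\<bar>^n / fact n" and x: "x \<in> {c..d}" for n x
    proof -
      define m where "m = C * \<alpha>^n * \<bar>B x\<bar>^n / fact n"
      have m: "m \<ge> 0" unfolding m_def using C(1) \<alpha>(1) by simp
      have G: "primitive_on S (\<lambda>x. m * Q x) (\<lambda>t. m * norm (kq t))"
        by (rule primitive_on_linear[OF bounded_linear_mult_right Q])
      have "norm (s n x) \<le> \<bar>m * Q x\<bar>"
      proof (rule primitive_norm_bound[where F="s n" and G="\<lambda>x. m * Q x", OF _ G S(3) inS[OF x] s0])
        show "primitive_on S (s n) (\<lambda>t. kq t * e n t)" using es by blast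
        show "m * Q x0 = 0" by (simp add: B0)
        fix t assume t: "t \<in> {min x0 x..max x0 x}"
        have "norm (e n t) \<le> C * \<alpha>^n * \<bar>B t\<bar>^n / fact n" by (rule IH[OF between[OF t x]])
        also have "\<dots> \<le> m"
          unfolding m_def using Babs[OF t x] C(1) \<alpha>(1)
          by (intro divide_right_mono mult_left_mono power_mono) auto
        finally have "norm (e n t) \<le> m" .
        from mult_right_mono[OF this, of "norm (kq t)"]
        show "norm (kq t * e n t) \<le> m * norm (kq t)" by (simp add: norm_mult mult.commute)
      qed
      also have "\<dots> \<le> m * \<alpha>" using \<alpha>(2)[OF x] m by (simp add: abs_mult mult_left_mono)
      finally show ?thesis by (simp add: m_def mult.commute)
    qed
    have ebound: "norm (e n x) \<le> C * \<alpha>^n * \<bar>B x\<bar>^n / fact n" if "x \<in> {c..d}" for n x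
      using that
    proof (induction n arbitrary: x)
      case 0
      then show ?case using C(2) by (simp add: e0)
    next
      case (Suc n)
      define m where "m = C * \<alpha>^Suc n / fact n"
      have m: "m \<ge> 0" unfolding m_def using C(1) \<alpha>(1) by simp
      \<comment> \<open>the sign of \<open>B t ^ n\<close> for \<open>t\<close> between \<open>x0\<close> and \<open>x\<close>\<close>
      define \<sigma> :: real where "\<sigma> = (if x0 \<le> x then 1 else (-1)^n)"
      have \<sigma>: "\<bar>\<sigma>\<bar> = 1" by (simp add: \<sigma>_def power_abs)
      have G: "primitive_on S (\<lambda>x. (m * \<sigma>) * (B x ^ Suc n / real (Suc n))) (\<lambda>t. (m * \<sigma>) * (B t ^ n * norm (kp t)))"
        by (rule primitive_on_linear[OF bounded_linear_mult_right primitive_on_power[OF B S(2)]])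
      have "norm (e (Suc n) x) \<le> \<bar>(m * \<sigma>) * (B x ^ Suc n / real (Suc n))\<bar>"
      proof (rule primitive_norm_bound[where F="e (Suc n)" and G="\<lambda>x. (m * \<sigma>) * (B x ^ Suc n / real (Suc n))", OF _ G S(3) inS[OF Suc.prems] eS0])
        show "primitive_on S (e (Suc n)) (\<lambda>t. kp t * s n t)" using es by blast
        show "m * \<sigma> * (B x0 ^ Suc n / real (Suc n)) = 0" by (simp add: B0)
        fix t assume t: "t \<in> {min x0 x..max x0 x}"
        have tcd: "t \<in> {c..d}" by (rule between[OF t Suc.prems])
        have "\<bar>B t\<bar>^n = \<sigma> * B t ^ n"
        proof (cases "x0 \<le> x")
          case True
          then have "0 \<le> B t" using Bmono[OF S(3) inS[OF tcd]] t B0(1) by auto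
          then show ?thesis using True by (simp add: \<sigma>_def)
        next
          case False
          then have "B t \<le> 0" using Bmono[OF inS[OF tcd] S(3)] t B0(1) by auto
          then show ?thesis using False by (simp add: \<sigma>_def power_minus[of "B t"])
        qed
        moreover have "norm (s n t) \<le> \<alpha> * (C * \<alpha>^n * \<bar>B t\<bar>^n / fact n)" by (rule sbound[OF Suc.IH tcd])
        ultimately have "norm (s n t) \<le> m * \<sigma> * B t ^ n" by (simp add: m_def mult_ac)
        then have "norm (s n t) * norm (kp t) \<le> m * \<sigma> * B t ^ n * norm (kp t)" by (rule mult_right_mono) simp
        then show "norm (kp t * s n t) \<le> m * \<sigma> * (B t ^ n * norm (kp t))" by (simp add: norm_mult mult_ac)
      qed
      also have "\<dots> = C * \<alpha>^Suc n * \<bar>B x\<bar>^Suc n / fact (Suc n)"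
        using m \<sigma> by (simp add: abs_mult power_abs m_def C(1) \<alpha>(1) mult_ac)
      finally show ?case .
    qed
    define K where "K n = C * ((\<alpha> * \<beta>)^n / fact n)" for n
    have "summable K"
      unfolding K_def using summable_exp[of "\<alpha> * \<beta>"] by (intro summable_mult) (simp add: divide_inverse mult.commute)
    moreover have K: "C * \<alpha>^n * \<bar>B x\<bar>^n / fact n \<le> K n" if "x \<in> {c..d}" for n x
    proof -
      have "\<bar>B x\<bar>^n \<le> \<beta>^n" using \<beta>(2)[OF that] by (intro power_mono) auto
      then have "(C * \<alpha>^n / fact n) * \<bar>B x\<bar>^n \<le> (C * \<alpha>^n / fact n) * \<beta>^n"
        using C(1) \<alpha>(1) by (intro mult_left_mono) auto
      then show ?thesis by (simp add: K_def power_mult_distrib mult_ac)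
    qed
    moreover have "norm (e n x) \<le> K n" if "x \<in> {c..d}" for n x
      using ebound[OF that] K[OF that] by (rule order_trans)
    moreover have "norm (s n x) \<le> \<alpha> * K n" if "x \<in> {c..d}" for n x
      using sbound[OF ebound that] mult_left_mono[OF K[OF that] \<alpha>(1)] by (rule order_trans)
    ultimately show ?thesis using \<alpha>(1) by blast
  qed
  define y where "y x = (\<Sum>n. e n x)" for x
  have ycont: "continuous_on S y"
  proof (rule continuous_at_imp_continuous_on, rule ballI)
    fix x assume "x \<in> S"
    then obtain \<epsilon> where \<epsilon>: "\<epsilon> > 0" "cball x \<epsilon> \<subseteq> S" using S(1) open_contains_cball by blast
    have xe: "x - \<epsilon> \<in> S" "x + \<epsilon> \<in> S" using \<epsilon> by (auto simp: cball_eq_atLeastAtMost)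
    define c d where "c = min x0 (x - \<epsilon>)" and "d = max x0 (x + \<epsilon>)"
    have cd: "c \<in> S" "d \<in> S" "x0 \<in> {c..d}" using xe S(3) \<epsilon>(1) by (auto simp: c_def d_def min_def max_def)
    obtain K where K: "summable K" "\<And>n x. x \<in> {c..d} \<Longrightarrow> norm (e n x) \<le> K n" using local[OF cd] by blast
    have "uniform_limit {c..d} (\<lambda>n x. \<Sum>i<n. e i x) y sequentially"
      unfolding y_def[abs_def] by (rule Weierstrass_m_test[OF K(2,1)])
    moreover have "\<forall>\<^sub>F n in sequentially. continuous_on {c..d} (\<lambda>x. \<Sum>i<n. e i x)"
      using es sub[OF cd(1,2)] by (intro always_eventually allI continuous_on_sum) (blast intro: continuous_on_subset)
    ultimately have "continuous_on {c..d} y" by (intro uniform_limit_theorem) auto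
    then have "continuous_on {x - \<epsilon><..<x + \<epsilon>} y"
      by (rule continuous_on_subset) (auto simp: c_def d_def)
    then show "isCont y x" using \<epsilon>(1) by (simp add: continuous_on_eq_continuous_at)
  qed
  define \<tau> where "\<tau> = oriented_integral x0 (\<lambda>t. kq t * y t)"
  have \<tau>: "primitive_on S \<tau> (\<lambda>t. kq t * y t)" unfolding \<tau>_def by (rule opr[OF kq ycont])
  have \<tau>cont: "continuous_on S \<tau>" by (rule primitive_on_continuous_on[OF \<tau> S(1)])
  have main: "y x - Y0 x = oriented_integral x0 (\<lambda>t. kp t * \<tau> t) x" if x: "x \<in> S" for x
  proof -
    define c d where "c = min x0 x" and "d = max x0 x"
    have cd: "c \<in> S" "d \<in> S" "x0 \<in> {c..d}" "x \<in> {c..d}" using x S(3) by (auto simp: c_def d_def min_def max_def)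
    obtain K \<gamma> where K: "summable K" "\<And>n x. x \<in> {c..d} \<Longrightarrow> norm (e n x) \<le> K n"
      and \<gamma>: "\<gamma> \<ge> 0" "\<And>n x. x \<in> {c..d} \<Longrightarrow> norm (s n x) \<le> \<gamma> * K n" using local[OF cd(1-3)] by blast
    have K0: "K n \<ge> 0" for n using K(2)[OF cd(3), of n] norm_ge_zero order_trans by blast
    have esum: "(\<lambda>N. \<Sum>n<N. e n t) \<longlonglongrightarrow> y t" if "t \<in> {c..d}" for t
      unfolding y_def using K that
      by (intro summable_LIMSEQ) (rule summable_comparison_test', auto)
    have ebd: "norm (\<Sum>n<N. e n t) \<le> (\<Sum>n. K n)" if "t \<in> {c..d}" for N t
    proof -
      have "norm (\<Sum>n<N. e n t) \<le> (\<Sum>n<N. K n)" using K(2)[OF that] by (rule sum_norm_le)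
      also have "\<dots> \<le> (\<Sum>n. K n)" using K(1) K0 by (intro sum_le_suminf) auto
      finally show ?thesis .
    qed
    have sbd: "norm (\<Sum>n<N. s n t) \<le> \<gamma> * (\<Sum>n. K n)" if "t \<in> {c..d}" for N t
    proof -
      have "norm (\<Sum>n<N. s n t) \<le> (\<Sum>n<N. \<gamma> * K n)" using \<gamma>(2)[OF that] by (rule sum_norm_le)
      also have "\<dots> = \<gamma> * (\<Sum>n<N. K n)" by (simp add: sum_distrib_left)
      also have "\<dots> \<le> \<gamma> * (\<Sum>n. K n)" using K(1) K0 \<gamma>(1) by (intro mult_left_mono sum_le_suminf) auto
      finally show ?thesis .
    qed
    have dom: "(\<lambda>t. norm (k t) * C) integrable_on {c..d}" if "k absolutely_integrable_on {c..d}" for k :: "real \<Rightarrow> complex" and C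
      using that by (intro integrable_on_mult_left) (simp add: absolutely_integrable_on_def)
    have ssum: "(\<lambda>N. \<Sum>n<N. s n t) \<longlonglongrightarrow> \<tau> t" if t: "t \<in> {c..d}" for t
    proof -
      have eq: "(\<Sum>n<N. s n t) = oriented_integral x0 (\<lambda>t. kq t * (\<Sum>n<N. e n t)) t" for N
      proof -
        have "primitive_on S (\<lambda>x. \<Sum>n<N. s n x) (\<lambda>x. \<Sum>n<N. kq x * e n x)"
          using es by (intro primitive_on_sum) blast
        then show ?thesis
          using primitive_eq_oriented_integral[of S "\<lambda>x. \<Sum>n<N. s n x" _ x0 t] sub[OF cd(1,2)] t S(3)
          by (auto simp: s0 sum_distrib_left)
      qed
      show ?thesis
        unfolding eq \<tau>_def
      proof (rule oriented_integral_dominated_convergence[OF _ dom _ _ cd(3) t])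
        show "(\<lambda>t. kq t * (\<Sum>n<N. e n t)) absolutely_integrable_on {c..d}" for N
          by (intro ai[OF kq _ cd(1,2)] continuous_on_sum esc)
        show "kq absolutely_integrable_on {c..d}" by (rule kq[OF cd(1,2)])
        show "norm (kq t * (\<Sum>n<N. e n t)) \<le> norm (kq t) * (\<Sum>n. K n)" if "t \<in> {c..d}" for N t
          using ebd[OF that] by (simp add: norm_mult mult_left_mono)
        show "(\<lambda>N. kq t * (\<Sum>n<N. e n t)) \<longlonglongrightarrow> kq t * y t" if "t \<in> {c..d}" for t
          by (intro tendsto_mult tendsto_const esum that)
      qed
    qed
    have eq: "(\<Sum>n<N. e (Suc n) x) = oriented_integral x0 (\<lambda>t. kp t * (\<Sum>n<N. s n t)) x" for N
    proof -
      have "primitive_on S (\<lambda>x. \<Sum>n<N. e (Suc n) x) (\<lambda>x. \<Sum>n<N. kp x * s n x)"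
        using es by (intro primitive_on_sum) blast
      then show ?thesis
        using primitive_eq_oriented_integral[of S "\<lambda>x. \<Sum>n<N. e (Suc n) x" _ x0 x] x S(3)
        by (auto simp: eS0 sum_distrib_left)
    qed
    have "(\<lambda>N. \<Sum>n<N. e (Suc n) x) \<longlonglongrightarrow> oriented_integral x0 (\<lambda>t. kp t * \<tau> t) x"
      unfolding eq
    proof (rule oriented_integral_dominated_convergence[OF _ dom _ _ cd(3,4)])
      show "(\<lambda>t. kp t * (\<Sum>n<N. s n t)) absolutely_integrable_on {c..d}" for N
        by (intro ai[OF kp _ cd(1,2)] continuous_on_sum esc)
      show "kp absolutely_integrable_on {c..d}" by (rule kp[OF cd(1,2)])
      show "norm (kp t * (\<Sum>n<N. s n t)) \<le> norm (kp t) * (\<gamma> * (\<Sum>n. K n))" if "t \<in> {c..d}" for N t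
        using sbd[OF that] by (simp add: norm_mult mult_left_mono)
      show "(\<lambda>N. kp t * (\<Sum>n<N. s n t)) \<longlonglongrightarrow> kp t * \<tau> t" if "t \<in> {c..d}" for t
        by (intro tendsto_mult tendsto_const ssum that)
    qed
    moreover have "(\<lambda>N. \<Sum>n<N. e (Suc n) x) \<longlonglongrightarrow> y x - Y0 x"
    proof -
      have "(\<lambda>N. (\<Sum>n<Suc N. e n x) - Y0 x) \<longlonglongrightarrow> y x - Y0 x"
        by (intro tendsto_diff tendsto_const LIMSEQ_Suc[OF esum[OF cd(4)]])
      then show ?thesis by (simp only: sum.lessThan_Suc_shift e0 add_diff_cancel_left')
    qed
    ultimately show ?thesis using LIMSEQ_unique by blast
  qed
  show ?thesis
  proof (rule that[OF \<tau>])
    show "primitive_on S (\<lambda>x. y x - Y0 x) (\<lambda>t. kp t * \<tau> t)"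
      by (rule primitive_on_cong[OF opr[OF kp \<tau>cont] main[symmetric]])
    show "\<tau> x0 = 0" by (simp add: \<tau>_def)
    show "y x0 = Y0 x0" using main[OF S(3)] by simp
  qed
qed

context sturm_liouville
begin

lemma coefficient_local:
  assumes "x \<in> I" "y \<in> I"
  shows "(\<lambda>t. complex_of_real (q t)) absolutely_integrable_on {x..y}"
    "(\<lambda>t. 1 / complex_of_real (p t)) absolutely_integrable_on {x..y}"
proof -
  have q: "q absolutely_integrable_on {x..y}" and p: "(\<lambda>t. 1 / p t) absolutely_integrable_on {x..y}"
    using coeff I_sub[OF assms] by (auto simp: sl_coefficients_def loc_integrable_def)
  show "(\<lambda>t. complex_of_real (q t)) absolutely_integrable_on {x..y}"
    using absolutely_integrable_linear[OF q bounded_linear_of_real[where 'a=complex]] by (simp add: o_def)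
  show "(\<lambda>t. 1 / complex_of_real (p t)) absolutely_integrable_on {x..y}"
    using absolutely_integrable_linear[OF p bounded_linear_of_real[where 'a=complex]] by (simp add: o_def)
qed

text \<open>Let \<open>R\<close> be the primitive of \<open>r * w\<close>. Then \<open>y1 = \<beta> - R + s\<close>, where \<open>s\<close> is the primitive of
  \<open>q * y\<close>, and \<open>y\<close> solves the Volterra equation whose inhomogeneity is the primitive of
  \<open>(\<beta> - R) / p\<close>, shifted by \<open>\<alpha>\<close>.\<close>

lemma initial_value_problem:
  assumes w: "\<And>x y. x \<in> I \<Longrightarrow> y \<in> I \<Longrightarrow> (\<lambda>t. complex_of_real (r t) * w t) absolutely_integrable_on {x..y}"
    and x0: "x0 \<in> I"
  obtains y y1 where "sl_pair y y1 w" "y x0 = \<alpha>" "y1 x0 = \<beta>"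
proof -
  define R where "R = oriented_integral x0 (\<lambda>t. complex_of_real (r t) * w t)"
  have R: "primitive_on I R (\<lambda>t. complex_of_real (r t) * w t)"
    unfolding R_def by (rule primitive_on_oriented_integral[OF is_interval_I x0 w])
  define Z where "Z = oriented_integral x0 (\<lambda>t. (1 / complex_of_real (p t)) * (\<beta> - R t))"
  have contR: "continuous_on I (\<lambda>t. \<beta> - R t)"
    using primitive_on_continuous_on[OF R open_I] by (intro continuous_intros)
  have Z: "primitive_on I Z (\<lambda>t. (1 / complex_of_real (p t)) * (\<beta> - R t))"
    unfolding Z_def
    by (intro primitive_on_oriented_integral is_interval_I x0 absolutely_integrable_mult_continuous
        coefficient_local(2) continuous_on_subset[OF contR I_sub])
  have contY: "continuous_on I (\<lambda>x. \<alpha> + Z x)"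
    using primitive_on_continuous_on[OF Z open_I] by (intro continuous_intros)
  obtain y s where ys: "primitive_on I s (\<lambda>t. complex_of_real (q t) * y t)"
    "primitive_on I (\<lambda>x. y x - (\<alpha> + Z x)) (\<lambda>t. (1 / complex_of_real (p t)) * s t)" "s x0 = 0" "y x0 = \<alpha> + Z x0"
    using linear_volterra_solution[OF open_I is_interval_I x0 coefficient_local(2) coefficient_local(1) contY] by blast
  define y1 where "y1 x = s x + \<beta> - R x" for x
  have c: "primitive_on I (\<lambda>x. F x + k) f" if "primitive_on I F f" for F f and k :: complex
    using that by (simp add: primitive_on_def)
  have "primitive_on I y1 (\<lambda>x. complex_of_real (q x) * y x - complex_of_real (r x) * w x)"
    unfolding y1_def[abs_def] by (rule primitive_on_diff[OF c[OF ys(1)] R])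
  moreover have "primitive_on I y (\<lambda>x. y1 x / complex_of_real (p x))"
  proof -
    have "primitive_on I (\<lambda>x. (y x - (\<alpha> + Z x)) + (Z x + \<alpha>))
        (\<lambda>t. (1 / complex_of_real (p t)) * s t + (1 / complex_of_real (p t)) * (\<beta> - R t))"
      by (rule primitive_on_add[OF ys(2) c[OF Z]])
    moreover have "(\<lambda>x. (y x - (\<alpha> + Z x)) + (Z x + \<alpha>)) = y" by (auto simp: algebra_simps)
    moreover have "(\<lambda>t. (1 / complex_of_real (p t)) * s t + (1 / complex_of_real (p t)) * (\<beta> - R t))
        = (\<lambda>x. y1 x / complex_of_real (p x))"
      by (auto simp: y1_def add_divide_distrib diff_divide_distrib)
    ultimately show ?thesis by simp
  qed
  ultimately have "sl_pair y y1 w" by (simp add: sl_pair_def)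
  moreover have "y x0 = \<alpha>" "y1 x0 = \<beta>" using ys(3,4) by (simp_all add: y1_def Z_def R_def)
  ultimately show ?thesis by (rule that)
qed

lemma fundamental_system:
  obtains \<phi> \<phi>1 \<theta> \<theta>1 where "sl_pair \<phi> \<phi>1 (\<lambda>x. 0)" "sl_pair \<theta> \<theta>1 (\<lambda>x. 0)"
    "\<And>x. x \<in> I \<Longrightarrow> \<phi> x * \<theta>1 x - \<phi>1 x * \<theta> x = 1"
proof -
  obtain x0 where x0: "x0 \<in> I" using einterval_nonempty[OF ab] by blast
  have 0: "(\<lambda>t. complex_of_real (r t) * 0) absolutely_integrable_on {x..y}" for x y
    by (simp add: set_integrable_def)
  obtain \<phi> \<phi>1 where \<phi>: "sl_pair \<phi> \<phi>1 (\<lambda>x. 0)" "\<phi> x0 = 1" "\<phi>1 x0 = 0"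
    by (rule initial_value_problem[OF 0 x0, of 1 0])
  obtain \<theta> \<theta>1 where \<theta>: "sl_pair \<theta> \<theta>1 (\<lambda>x. 0)" "\<theta> x0 = 0" "\<theta>1 x0 = 1"
    by (rule initial_value_problem[OF 0 x0, of 0 1])
  have W: "primitive_on I (\<lambda>x. \<phi> x * \<theta>1 x - \<phi>1 x * \<theta> x) (\<lambda>x. 0)"
    using sl_pair_wronskian[OF \<phi>(1) \<theta>(1)] by simp
  have "\<phi> x * \<theta>1 x - \<phi>1 x * \<theta> x = 1" if x: "x \<in> I" for x
    using primitive_onD(3)[OF W x x0] primitive_onD(3)[OF W x0 x] \<phi>(2,3) \<theta>(2,3) by (cases "x \<le> x0") auto
  with \<phi>(1) \<theta>(1) show ?thesis by (rule that)
qed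

lemma bounded_times_indicator_sq_integrable:
  assumes y: "continuous_on I y" and cd: "c \<in> I" "d \<in> I"
  shows "sq_integrable M (\<lambda>t. indicator {c..d} t * y t)"
proof -
  have "compact (y ` {c..d})" by (rule compact_continuous_image[OF continuous_on_subset[OF y I_sub[OF cd]]]) simp
  then obtain B where "\<forall>z\<in>y ` {c..d}. norm z \<le> B" using compact_imp_bounded bounded_iff by metis
  then have B: "norm (y t) \<le> B" if "t \<in> {c..d}" for t using that by blast
  note ind = sq_integrable_indicator[OF cd]
  show ?thesis
  proof (rule sq_integrable_bound[OF ind ind, of _ "B\<^sup>2"])
    have "y \<in> borel_measurable M"
      unfolding borel_measurable_M_iff using y by (rule continuous_imp_measurable_on_sets_lebesgue) (rule I_lebesgue)
    then show "(\<lambda>t. indicator {c..d} t * y t) \<in> borel_measurable M"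
      using sq_integrableD(1)[OF ind] by (intro borel_measurable_times)
    show "AE t in M. (cmod (indicator {c..d} t * y t))\<^sup>2 \<le>
        B\<^sup>2 * (cmod (indicator {c..d} t))\<^sup>2 + B\<^sup>2 * (cmod (indicator {c..d} t))\<^sup>2"
    proof (rule AE_I2)
      fix t
      have "(cmod (y t))\<^sup>2 \<le> B\<^sup>2" if "t \<in> {c..d}" using B[OF that] by (intro power_mono) auto
      then show "(cmod (indicator {c..d} t * y t))\<^sup>2 \<le>
        B\<^sup>2 * (cmod (indicator {c..d} t))\<^sup>2 + B\<^sup>2 * (cmod (indicator {c..d} t))\<^sup>2"
        using zero_le_power2[of B] by (cases "t \<in> {c..d}") (auto intro: order_trans)
    qed
  qed
qed

section \<open>The adjoint of the compactly supported restriction\<close>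

text \<open>The right-hand sides \<open>k\<close> for which \<open>\<tau> f = k\<close> may have a compactly supported solution.\<close>

definition compact_test :: "(real \<Rightarrow> complex) \<Rightarrow> bool" where
  "compact_test k \<longleftrightarrow> sq_integrable M k \<and> (\<exists>c\<in>I. \<exists>d\<in>I. \<forall>x. x \<notin> {c..d} \<longrightarrow> k x = 0)"

lemma compact_testE:
  assumes "compact_test k"
  obtains c d where "sq_integrable M k" "c \<in> I" "d \<in> I" "c \<le> d" "\<And>x. x \<notin> {c..d} \<Longrightarrow> k x = 0"
proof -
  obtain c d where cd: "sq_integrable M k" "c \<in> I" "d \<in> I" "\<And>x. x \<notin> {c..d} \<Longrightarrow> k x = 0"
    using assms unfolding compact_test_def by blast
  have "k x = 0" if "x \<notin> {min c d..max c d}" for x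
    by (rule cd(4)) (use that in auto)
  then show ?thesis
    by (intro that[of "min c d" "max c d"]) (use cd(1,2,3) in \<open>auto simp: min_def max_def\<close>)
qed

lemma compact_test_lin:
  assumes "compact_test k" "compact_test l"
  shows "compact_test (\<lambda>x. k x + c * l x)"
proof -
  obtain c1 d1 where 1: "sq_integrable M k" "c1 \<in> I" "d1 \<in> I" "\<And>x. x \<notin> {c1..d1} \<Longrightarrow> k x = 0"
    using assms(1) by (rule compact_testE) blast
  obtain c2 d2 where 2: "sq_integrable M l" "c2 \<in> I" "d2 \<in> I" "\<And>x. x \<notin> {c2..d2} \<Longrightarrow> l x = 0"
    using assms(2) by (rule compact_testE) blast
  have "\<forall>x. x \<notin> {min c1 c2..max d1 d2} \<longrightarrow> k x + c * l x = 0"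
  proof (intro allI impI)
    fix x assume "x \<notin> {min c1 c2..max d1 d2}"
    then have "x \<notin> {c1..d1}" "x \<notin> {c2..d2}" by auto
    then show "k x + c * l x = 0" using 1(4)[of x] 2(4)[of x] by simp
  qed
  moreover have "min c1 c2 \<in> I" "max d1 d2 \<in> I" using 1 2 by (auto simp: min_def max_def)
  moreover have "sq_integrable M (\<lambda>x. k x + c * l x)" using 1 2 by (intro sq_integrable_add sq_integrable_scale)
  ultimately show ?thesis unfolding compact_test_def by blast
qed

lemma integrable_continuous_mult_test:
  assumes y: "continuous_on I y" and k: "compact_test k"
  shows "integrable M (\<lambda>x. y x * k x)"
proof -
  obtain c d where cd: "sq_integrable M k" "c \<in> I" "d \<in> I" "\<And>x. x \<notin> {c..d} \<Longrightarrow> k x = 0"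
    using k by (rule compact_testE) blast
  have "integrable M (\<lambda>x. (indicator {c..d} x * y x) * k x)"
    by (rule integrable_cnj_mult(1)[OF bounded_times_indicator_sq_integrable[OF y cd(2,3)] cd(1)])
  moreover have "(indicator {c..d} x * y x) * k x = y x * k x" for x
    using cd(4)[of x] by (cases "x \<in> {c..d}") auto
  ultimately show ?thesis by simp
qed

lemma integral_M_supported:
  fixes h :: "real \<Rightarrow> complex"
  assumes h: "integrable M h" and c: "c \<in> I" "d \<in> I" "\<And>x. x \<in> I \<Longrightarrow> x \<notin> {c..d} \<Longrightarrow> h x = 0"
  shows "integral\<^sup>L M h = integral {c..d} (\<lambda>x. complex_of_real (r x) * h x)"
proof -
  have "integral\<^sup>L M h = integral I (\<lambda>x. complex_of_real (r x) * h x)"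
    using integral_M(2)[OF h] by (simp add: scaleR_conv_of_real)
  also have "\<dots> = integral I (\<lambda>x. if x \<in> {c..d} then complex_of_real (r x) * h x else 0)"
    by (rule Henstock_Kurzweil_Integration.integral_cong) (use c(3) in auto)
  also have "\<dots> = integral (I \<inter> {c..d}) (\<lambda>x. complex_of_real (r x) * h x)"
    by (subst Int_commute) (rule integral_restrict_Int)
  also have "I \<inter> {c..d} = {c..d}" using I_sub[OF c(1,2)] by blast
  finally show ?thesis .
qed

text \<open>The solution with zero initial values at \<open>c\<close> vanishes to the left of \<open>c\<close>. Its Wronskians with
  the fundamental system are constant to the right of \<open>d\<close>, and by Lagrange's identity the constants
  are the integrals of \<open>\<phi> * k\<close> and \<open>\<theta> * k\<close> up to sign. As these are zero, the solution vanishes to the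
  right of \<open>d\<close> too.\<close>

lemma compactly_supported_solution:
  assumes \<phi>: "sl_pair \<phi> \<phi>1 (\<lambda>x. 0)" and \<theta>: "sl_pair \<theta> \<theta>1 (\<lambda>x. 0)"
    and W: "\<And>x. x \<in> I \<Longrightarrow> \<phi> x * \<theta>1 x - \<phi>1 x * \<theta> x = 1"
    and k: "sq_integrable M k" "c \<in> I" "d \<in> I" "c \<le> d" "\<And>x. x \<notin> {c..d} \<Longrightarrow> k x = 0"
    and orth: "integral\<^sup>L M (\<lambda>x. \<phi> x * k x) = 0" "integral\<^sup>L M (\<lambda>x. \<theta> x * k x) = 0"
  obtains f f1 where "sl_pair f f1 k" "\<And>x. x \<in> I \<Longrightarrow> x \<notin> {c..d} \<Longrightarrow> f x = 0 \<and> f1 x = 0"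
proof -
  have kt: "compact_test k" using k by (auto simp: compact_test_def)
  obtain f f1 where f: "sl_pair f f1 k" "f c = 0" "f1 c = 0"
    by (rule initial_value_problem[OF sq_integrable_local[OF k(1)] k(2), of 0 0])
  have zero: "\<eta> x * f1 x - \<eta>1 x * f x = 0"
    if \<eta>: "sl_pair \<eta> \<eta>1 (\<lambda>x. 0)" and o: "integral\<^sup>L M (\<lambda>x. \<eta> x * k x) = 0"
      and x: "x \<in> I" "x \<notin> {c..d}" for \<eta> \<eta>1 x
  proof -
    have P: "primitive_on I (\<lambda>x. \<eta> x * f1 x - \<eta>1 x * f x) (\<lambda>x. - (complex_of_real (r x) * (\<eta> x * k x)))"
      using sl_pair_wronskian[OF \<eta> f(1)] by simp
    show ?thesis
    proof (cases "x < c")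
      case True
      then have "integral {x..c} (\<lambda>x. - (complex_of_real (r x) * (\<eta> x * k x))) = integral {x..c} (\<lambda>x. 0)"
        using k(5) by (intro integral_spike[of "{c}"]) auto
      then show ?thesis using primitive_onD(3)[OF P x(1) k(2)] True f(2,3) by simp
    next
      case False
      then have xd: "x > d" "c \<le> x" using x k(4) by auto
      have "continuous_on I \<eta>" using \<eta> by (auto simp: sl_pair_def intro: primitive_on_continuous_on open_I)
      then have "integral\<^sup>L M (\<lambda>x. \<eta> x * k x) = integral {c..x} (\<lambda>x. complex_of_real (r x) * (\<eta> x * k x))"
        using xd k(5) by (intro integral_M_supported integrable_continuous_mult_test kt k(2) x(1)) auto
      then show ?thesis using primitive_onD(3)[OF P k(2) x(1) xd(2)] o f(2,3) by simp
    qed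
  qed
  have "f x = 0 \<and> f1 x = 0" if x: "x \<in> I" "x \<notin> {c..d}" for x
  proof -
    note z = zero[OF \<phi> orth(1) x] zero[OF \<theta> orth(2) x]
    have "f x * (\<phi> x * \<theta>1 x - \<phi>1 x * \<theta> x) =
        \<theta> x * (\<phi> x * f1 x - \<phi>1 x * f x) - \<phi> x * (\<theta> x * f1 x - \<theta>1 x * f x)"
      by (simp add: algebra_simps)
    moreover have "f1 x * (\<phi> x * \<theta>1 x - \<phi>1 x * \<theta> x) =
        \<theta>1 x * (\<phi> x * f1 x - \<phi>1 x * f x) - \<phi>1 x * (\<theta> x * f1 x - \<theta>1 x * f x)"
      by (simp add: algebra_simps)
    ultimately show ?thesis unfolding z W[OF x(1)] by simp
  qed
  with f(1) show ?thesis by (rule that)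
qed

end

text \<open>If \<open>l2\<close> does not vanish on the kernel of \<open>l1\<close>, then subtracting a multiple of it from \<open>l\<close> makes
  \<open>l\<close> vanish on that kernel; then only one functional is left to compare with.\<close>

lemma functional_combination:
  fixes X :: "('a \<Rightarrow> complex) set" and l l1 l2 :: "('a \<Rightarrow> complex) \<Rightarrow> complex"
  assumes X: "\<And>k m c. k \<in> X \<Longrightarrow> m \<in> X \<Longrightarrow> (\<lambda>x. k x + c * m x) \<in> X"
    and lin: "\<And>L k m c. L \<in> {l, l1, l2} \<Longrightarrow> k \<in> X \<Longrightarrow> m \<in> X \<Longrightarrow> L (\<lambda>x. k x + c * m x) = L k + c * L m"
    and ker: "\<And>k. k \<in> X \<Longrightarrow> l1 k = 0 \<Longrightarrow> l2 k = 0 \<Longrightarrow> l k = 0"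
  obtains c1 c2 where "\<And>k. k \<in> X \<Longrightarrow> l k = c1 * l1 k + c2 * l2 k"
proof -
  have one: "\<exists>c. \<forall>k\<in>X. L k = c * L1 k"
    if L: "\<And>k m c. k \<in> X \<Longrightarrow> m \<in> X \<Longrightarrow> L (\<lambda>x. k x + c * m x) = L k + c * L m"
      and L1: "\<And>k m c. k \<in> X \<Longrightarrow> m \<in> X \<Longrightarrow> L1 (\<lambda>x. k x + c * m x) = L1 k + c * L1 m"
      and kr: "\<And>k. k \<in> X \<Longrightarrow> L1 k = 0 \<Longrightarrow> L k = 0" for L L1 :: "('a \<Rightarrow> complex) \<Rightarrow> complex"
  proof (cases "\<exists>m\<in>X. L1 m \<noteq> 0")
    case True
    then obtain m where m: "m \<in> X" "L1 m \<noteq> 0" by blast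
    have "L k = (L m / L1 m) * L1 k" if k: "k \<in> X" for k
    proof -
      have "L1 (\<lambda>x. k x + (- L1 k / L1 m) * m x) = 0"
        unfolding L1[OF k m(1)] using m(2) by simp
      then have "L (\<lambda>x. k x + (- L1 k / L1 m) * m x) = 0" by (rule kr[OF X[OF k m(1)]])
      then show ?thesis unfolding L[OF k m(1)] by (simp add: mult.commute add_eq_0_iff)
    qed
    then show ?thesis by blast
  next
    case False
    then show ?thesis using kr by (intro exI[of _ 0]) auto
  qed
  have ins: "l \<in> {l, l1, l2}" "l1 \<in> {l, l1, l2}" "l2 \<in> {l, l1, l2}" by auto
  show ?thesis
  proof (cases "\<exists>m\<in>X. l1 m = 0 \<and> l2 m \<noteq> 0")
    case True
    then obtain m where m: "m \<in> X" "l1 m = 0" "l2 m \<noteq> 0" by blast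
    define c2 where "c2 = l m / l2 m"
    have "\<exists>c. \<forall>k\<in>X. l k - c2 * l2 k = c * l1 k"
    proof (rule one)
      fix k assume k: "k \<in> X" "l1 k = 0"
      have "l1 (\<lambda>x. k x + (- l2 k / l2 m) * m x) = 0"
        unfolding lin[OF ins(2) k(1) m(1)] using m k by simp
      moreover have "l2 (\<lambda>x. k x + (- l2 k / l2 m) * m x) = 0"
        unfolding lin[OF ins(3) k(1) m(1)] using m k by simp
      ultimately have "l (\<lambda>x. k x + (- l2 k / l2 m) * m x) = 0" by (rule ker[OF X[OF k(1) m(1)]])
      then show "l k - c2 * l2 k = 0"
        unfolding lin[OF ins(1) k(1) m(1)] by (simp add: c2_def mult.commute)
    next
      fix k m c assume km: "k \<in> X" "m \<in> X"
      show "l (\<lambda>x. k x + c * m x) - c2 * l2 (\<lambda>x. k x + c * m x) = (l k - c2 * l2 k) + c * (l m - c2 * l2 m)"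
        unfolding lin[OF ins(1) km] lin[OF ins(3) km] by (simp add: algebra_simps)
      show "l1 (\<lambda>x. k x + c * m x) = l1 k + c * l1 m" by (rule lin[OF ins(2) km])
    qed
    then obtain c where "\<And>k. k \<in> X \<Longrightarrow> l k - c2 * l2 k = c * l1 k" by blast
    then have "\<And>k. k \<in> X \<Longrightarrow> l k = c * l1 k + c2 * l2 k" by (simp add: algebra_simps)
    then show ?thesis by (rule that)
  next
    case False
    have "\<exists>c. \<forall>k\<in>X. l k = c * l1 k" by (rule one) (use lin ker False in auto)
    then obtain c where "\<And>k. k \<in> X \<Longrightarrow> l k = c * l1 k + 0 * l2 k" by auto
    then show ?thesis by (rule that)
  qed
qed

context sturm_liouville
begin

definition compact_support :: "(real \<Rightarrow> complex) \<Rightarrow> bool" where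
  "compact_support g \<longleftrightarrow> (\<exists>K. compact K \<and> K \<subseteq> I \<and> (\<forall>x\<in>I - K. g x = 0))"

text \<open>Let \<open>y\<close> solve \<open>\<tau> y = cnj w\<close> and put \<open>h = cnj u - y\<close>. Every test function \<open>k\<close> orthogonal to a
  fundamental system is \<open>\<tau> f\<close> for some \<open>f\<close> of compact support, so the hypothesis and Green's
  formula show that \<open>h\<close> annihilates \<open>k\<close>. Hence \<open>h\<close> acts on test functions like a combination of
  the fundamental system and is equal to it almost everywhere. This reduction to a fundamental system
  is used because \<open>q * u\<close> need not be locally integrable for \<open>u\<close> in \<open>L2\<close>.\<close>

lemma weak_solution_regular:
  assumes u: "sq_integrable M u" and w: "sq_integrable M w"
    and weak: "\<And>f. f \<in> \<D> \<Longrightarrow> compact_support f \<Longrightarrow>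
      inner_product M u (\<tau> f) = inner_product M w f"
  obtains U where "U \<in> \<D>" "AE x in M. U x = u x" "AE x in M. \<tau> U x = w x"
proof -
  obtain \<phi> \<phi>1 \<theta> \<theta>1 where \<phi>: "sl_pair \<phi> \<phi>1 (\<lambda>x. 0)" and \<theta>: "sl_pair \<theta> \<theta>1 (\<lambda>x. 0)"
    and W: "\<And>x. x \<in> I \<Longrightarrow> \<phi> x * \<theta>1 x - \<phi>1 x * \<theta> x = 1"
    using fundamental_system by blast
  obtain x0 where x0: "x0 \<in> I" using einterval_nonempty[OF ab] by blast
  obtain y y1 where y: "sl_pair y y1 (\<lambda>x. cnj (w x))"
    by (rule initial_value_problem[OF sq_integrable_local[OF sq_integrable_cnj[OF w]] x0, of 0 0])
  have cont: "continuous_on I \<phi>" "continuous_on I \<theta>" "continuous_on I y"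
    using \<phi> \<theta> y by (auto simp: sl_pair_def intro: primitive_on_continuous_on open_I)
  define h where "h x = cnj (u x) - y x" for x
  have hi: "integrable M (\<lambda>x. h x * k x)" if "compact_test k" for k
  proof -
    have "sq_integrable M k" using that by (simp add: compact_test_def)
    from Bochner_Integration.integrable_diff[OF integrable_cnj_mult(2)[OF u this] integrable_continuous_mult_test[OF cont(3) that]]
    show ?thesis by (simp add: h_def left_diff_distrib)
  qed
  define X where "X = {k. compact_test k}"
  have Xlin: "(\<lambda>x. k x + c * m x) \<in> X" if "k \<in> X" "m \<in> X" for k m c
    using that compact_test_lin by (simp add: X_def)
  define l :: "(real \<Rightarrow> complex) \<Rightarrow> (real \<Rightarrow> complex) \<Rightarrow> complex"
    where "l \<eta> k = integral\<^sup>L M (\<lambda>x. \<eta> x * k x)" for \<eta> k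
  have llin: "l \<eta> (\<lambda>x. k x + c * m x) = l \<eta> k + c * l \<eta> m"
    if "\<And>k. k \<in> X \<Longrightarrow> integrable M (\<lambda>x. \<eta> x * k x)" "k \<in> X" "m \<in> X" for \<eta> k m c
  proof -
    have "l \<eta> (\<lambda>x. k x + c * m x) = integral\<^sup>L M (\<lambda>x. \<eta> x * k x + c * (\<eta> x * m x))"
      unfolding l_def by (simp add: algebra_simps)
    then show ?thesis using that(1)[OF that(2)] that(1)[OF that(3)] by (simp add: l_def)
  qed
  have ker: "l h k = 0" if k: "k \<in> X" and 0: "l \<phi> k = 0" "l \<theta> k = 0" for k
  proof -
    obtain c d where cd: "sq_integrable M k" "c \<in> I" "d \<in> I" "c \<le> d" "\<And>x. x \<notin> {c..d} \<Longrightarrow> k x = 0"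
      using k unfolding X_def by (auto elim: compact_testE)
    obtain f f1 where f: "sl_pair f f1 k" "\<And>x. x \<in> I \<Longrightarrow> x \<notin> {c..d} \<Longrightarrow> f x = 0 \<and> f1 x = 0"
      by (rule compactly_supported_solution[of \<phi> \<phi>1 \<theta> \<theta>1 k c d])
        (use \<phi> \<theta> W cd 0[unfolded l_def] that in blast)+
    have fc: "continuous_on I f" using f(1) by (auto simp: sl_pair_def intro: primitive_on_continuous_on open_I)
    have fsq: "sq_integrable M f"
    proof (rule sq_integrable_AE_cong[OF bounded_times_indicator_sq_integrable[OF fc cd(2,3)] sl_pair_measurable[OF f(1)]])
      show "AE x in M. f x = indicator {c..d} x * f x"
      proof (rule AE_I2)
        fix x assume "x \<in> space M"
        then have "x \<in> I" by (simp add: sl_measure_def space_restrict_space)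
        then show "f x = indicator {c..d} x * f x" using f(2)[of x] by (cases "x \<in> {c..d}") auto
      qed
    qed
    note fm = max_domI[OF f(1) fsq cd(1)]
    have "compact_support f"
      unfolding compact_support_def using f(2) I_sub[OF cd(2,3)] by (intro exI[of _ "{c..d}"]) auto
    from weak[OF fm(1) this]
    have "inner_product M u k = inner_product M w f"
    proof -
      have "inner_product M u (\<tau> f) = inner_product M u k"
        unfolding inner_product_def
        by (rule integral_cong_AE) (use fm integrable_cnj_mult(2)[OF u cd(1)] integrable_cnj_mult(2)[OF u max_domD(2)[OF fm(1)]]
          in \<open>auto elim: eventually_mono\<close>)
      then show ?thesis using weak[OF fm(1) \<open>compact_support f\<close>] by simp
    qed
    moreover have "inner_product M w f = integral\<^sup>L M (\<lambda>x. y x * k x)"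
    proof -
      have yk: "integrable M (\<lambda>x. y x * k x)" using integrable_continuous_mult_test[OF cont(3)] k by (simp add: X_def)
      have wf: "integrable M (\<lambda>x. cnj (w x) * f x)" by (rule integrable_cnj_mult(2)[OF w fsq])
      obtain c' where c': "c' \<in> I" "c' < c"
      proof -
        obtain z where z: "a < z" "z < ereal c" using dense[of a "ereal c"] cd(2) by (auto simp: einterval_def)
        then obtain c' where e: "z = ereal c'" by (cases z) auto
        have "ereal c < b" using cd(2) by (simp add: einterval_def)
        then have "z < b" using z(2) by (rule less_trans[rotated])
        then show ?thesis using that[of c'] z e by (simp add: einterval_def)
      qed
      obtain d' where d': "d' \<in> I" "d < d'"
      proof -
        obtain z where z: "ereal d < z" "z < b" using dense[of "ereal d" b] cd(3) by (auto simp: einterval_def)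
        then obtain d' where e: "z = ereal d'" by (cases z) auto
        have "a < ereal d" using cd(3) by (simp add: einterval_def)
        then have "a < z" using z(1) by (rule less_trans)
        then show ?thesis using that[of d'] z e by (simp add: einterval_def)
      qed
      have P: "primitive_on I (\<lambda>x. y x * f1 x - y1 x * f x) (\<lambda>x. complex_of_real (r x) * (cnj (w x) * f x - y x * k x))"
        by (rule sl_pair_wronskian[OF y f(1)])
      have "integral\<^sup>L M (\<lambda>x. cnj (w x) * f x - y x * k x)
          = integral {c'..d'} (\<lambda>x. complex_of_real (r x) * (cnj (w x) * f x - y x * k x))"
      proof (rule integral_M_supported[OF _ c'(1) d'(1)])
        show "integrable M (\<lambda>x. cnj (w x) * f x - y x * k x)" using wf yk by simp
        fix x assume x: "x \<in> I" "x \<notin> {c'..d'}"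
        then have "x \<notin> {c..d}" using c' d' by auto
        then show "cnj (w x) * f x - y x * k x = 0" using f(2)[OF x(1)] cd(5) by simp
      qed
      also have "\<dots> = 0"
        using primitive_onD(3)[OF P c'(1) d'(1)] f(2)[OF c'(1)] f(2)[OF d'(1)] c' d' cd(4) by auto
      finally show ?thesis using wf yk by (simp add: inner_product_def)
    qed
    ultimately have "integral\<^sup>L M (\<lambda>x. cnj (u x) * k x) - integral\<^sup>L M (\<lambda>x. y x * k x) = 0"
      by (simp add: inner_product_def)
    then show ?thesis
      using integrable_cnj_mult(2)[OF u cd(1)] integrable_continuous_mult_test[OF cont(3)] k
      by (simp add: l_def h_def left_diff_distrib X_def)
  qed
  have int\<phi>: "integrable M (\<lambda>x. \<phi> x * k x)" "integrable M (\<lambda>x. \<theta> x * k x)" "integrable M (\<lambda>x. h x * k x)" if "k \<in> X" for k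
    using that integrable_continuous_mult_test[OF cont(1)] integrable_continuous_mult_test[OF cont(2)] hi by (auto simp: X_def)
  obtain c1 c2 where c12: "\<And>k. k \<in> X \<Longrightarrow> l h k = c1 * l \<phi> k + c2 * l \<theta> k"
  proof (rule functional_combination[of X "l h" "l \<phi>" "l \<theta>"])
    show "L (\<lambda>x. k x + c * m x) = L k + c * L m" if "L \<in> {l h, l \<phi>, l \<theta>}" "k \<in> X" "m \<in> X" for L k m c
      using that llin[OF int\<phi>(1)] llin[OF int\<phi>(2)] llin[OF int\<phi>(3)] by auto
  qed (use Xlin ker in auto)
  define v where "v x = h x - (c1 * \<phi> x + c2 * \<theta> x)" for x
  have loc: "AE x in M. x \<in> {c..d} \<longrightarrow> v x = 0" if cd: "c \<in> I" "d \<in> I" for c d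
  proof -
    define k where "k x = cnj (indicator {c..d} x * v x)" for x
    have "sq_integrable M (\<lambda>x. indicator {c..d} x * cnj (u x))"
      by (rule sq_integrable_bound[OF sq_integrable_cnj[OF u] sq_integrable_cnj[OF u], of _ 1])
        (use sq_integrableD(1)[OF sq_integrable_cnj[OF u]] sq_integrableD(1)[OF sq_integrable_indicator[OF cd]] in
          \<open>auto intro!: borel_measurable_times simp: indicator_def\<close>)
    moreover have "sq_integrable M (\<lambda>x. indicator {c..d} x * (y x + (c1 * \<phi> x + c2 * \<theta> x)))"
      using cont cd by (intro bounded_times_indicator_sq_integrable continuous_intros)
    ultimately have "sq_integrable M (\<lambda>x. indicator {c..d} x * cnj (u x) - indicator {c..d} x * (y x + (c1 * \<phi> x + c2 * \<theta> x)))"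
      by (rule sq_integrable_diff)
    then have iv: "sq_integrable M (\<lambda>x. indicator {c..d} x * v x)"
      by (simp add: v_def h_def algebra_simps)
    then have "sq_integrable M k" unfolding k_def[abs_def] by (rule sq_integrable_cnj)
    moreover have "\<forall>x. x \<notin> {c..d} \<longrightarrow> k x = 0" by (simp add: k_def)
    ultimately have kX: "k \<in> X" unfolding X_def compact_test_def using cd by blast
    have "integral\<^sup>L M (\<lambda>x. v x * k x) = l h k - (c1 * l \<phi> k + c2 * l \<theta> k)"
      using int\<phi>[OF kX] by (simp add: l_def v_def left_diff_distrib distrib_right mult.assoc)
    also have "\<dots> = 0" using c12[OF kX] by simp
    finally have "integral\<^sup>L M (\<lambda>x. v x * k x) = 0" .
    moreover have "v x * k x = complex_of_real ((cmod (indicator {c..d} x * v x))\<^sup>2)" for x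
      unfolding complex_norm_square by (auto simp: k_def indicator_def)
    ultimately have "complex_of_real (norm_sq M (\<lambda>x. indicator {c..d} x * v x)) = 0"
      by (simp add: norm_sq_def flip: integral_complex_of_real)
    then have "norm_sq M (\<lambda>x. indicator {c..d} x * v x) = 0" by (simp only: of_real_eq_0_iff)
    then have "AE x in M. indicator {c..d} x * v x = 0" using norm_sq_eq_0_iff[OF iv] by simp
    then show ?thesis by (auto elim!: eventually_mono simp: indicator_def)
  qed
  obtain lo hi :: "nat \<Rightarrow> real" where lh: "I = (\<Union>i. {lo i..hi i})" "\<And>i. lo i < hi i"
    using einterval_Icc_approximation[OF ab] by metis
  have "AE x in M. \<forall>i. x \<in> {lo i..hi i} \<longrightarrow> v x = 0"
  proof (subst AE_all_countable, rule allI)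
    fix i
    have "lo i \<in> {lo i..hi i}" "hi i \<in> {lo i..hi i}" using lh(2)[of i] by auto
    then have "lo i \<in> I" "hi i \<in> I" using lh(1) by blast+
    then show "AE x in M. x \<in> {lo i..hi i} \<longrightarrow> v x = 0" by (rule loc)
  qed
  moreover have "AE x in M. x \<in> I" by (rule AE_I2) (simp add: sl_measure_def space_restrict_space)
  ultimately have v0: "AE x in M. v x = 0"
    by eventually_elim (use lh(1) in blast)
  define U where "U x = cnj (y x + (c1 * \<phi> x + c2 * \<theta> x))" for x
  have "sl_pair U (\<lambda>x. cnj (y1 x + (c1 * \<phi>1 x + c2 * \<theta>1 x))) (\<lambda>x. cnj (cnj (w x) + (c1 * 0 + c2 * 0)))"
    unfolding U_def[abs_def] by (intro sl_pair_cnj sl_pair_add sl_pair_scale y \<phi> \<theta>)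
  then have U: "sl_pair U (\<lambda>x. cnj (y1 x + (c1 * \<phi>1 x + c2 * \<theta>1 x))) w" by simp
  have Uu: "AE x in M. U x = u x"
    using v0
  proof eventually_elim
    case (elim x)
    then have "cnj (u x) = y x + (c1 * \<phi> x + c2 * \<theta> x)" by (simp add: v_def h_def algebra_simps)
    then have "cnj (cnj (u x)) = U x" by (simp only: U_def)
    then show ?case by simp
  qed
  have "sq_integrable M U" by (rule sq_integrable_AE_cong[OF u sl_pair_measurable[OF U] Uu])
  from max_domI[OF U this w] Uu show ?thesis by (intro that)
qed

end

section \<open>Restrictions of the maximal operator\<close>

context sturm_liouville
begin

lemma max_dom_cong:
  assumes y: "y \<in> \<D>" and eq: "\<And>x. x \<in> I \<Longrightarrow> y x = y' x"
  shows "y' \<in> \<D>" "AE x in M. \<tau> y' x = \<tau> y x"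
proof -
  note Y = max_domD[OF y]
  have P: "sl_pair y' (qderiv a b p y) (\<tau> y)"
    by (rule sl_pair_cong[OF Y(3)]) (use eq in auto)
  have "sq_integrable M y'"
    by (rule sq_integrable_AE_cong[OF Y(1) sl_pair_measurable[OF P]], rule AE_I2)
      (use eq in \<open>auto simp: sl_measure_def space_restrict_space\<close>)
  then show "y' \<in> \<D>" "AE x in M. \<tau> y' x = \<tau> y x"
    using max_domI[OF P _ Y(2)] by auto
qed

lemma max_dom_AE_eq:
  assumes y: "y \<in> \<D>" and u: "u \<in> \<D>" and ae: "AE x in M. y x = u x"
  shows "\<And>x. x \<in> I \<Longrightarrow> y x = u x" "AE x in M. \<tau> y x = \<tau> u x"
  using sl_pair_unique[OF max_domD(3)[OF y] max_domD(3)[OF u] ae] by blast+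

lemma sl_solution_max_dom:
  assumes "sq_integrable M y"
  shows "sl_solution a b p q r z y \<longleftrightarrow>
    y \<in> \<D> \<and> (AE x in M. \<tau> y x = z * y x)"
proof
  assume s: "sl_solution a b p q r z y"
  then have "sl_pair y (qderiv a b p y) (\<lambda>x. z * y x)"
    by (intro sl_pair_cong[OF sl_regular_pair[of y]]) (auto simp: sl_solution_def elim: eventually_mono)
  from max_domI[OF this assms sq_integrable_scale[OF assms]]
  show "y \<in> \<D> \<and> (AE x in M. \<tau> y x = z * y x)" by simp
qed (auto simp: sl_solution_def max_dom_def AE_M_iff)

lemma zero_max_dom: "(\<lambda>x. 0) \<in> \<D>" "AE x in M. \<tau> (\<lambda>x. 0) x = 0"
proof -
  have P: "sl_pair (\<lambda>x. 0) (\<lambda>x. 0) (\<lambda>x. 0)" by (simp add: sl_pair_def primitive_on_def set_integrable_def)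
  show "(\<lambda>x. 0) \<in> \<D>" "AE x in M. \<tau> (\<lambda>x. 0) x = 0"
    using max_domI[OF P sq_integrable_zero sq_integrable_zero] by simp_all
qed

text \<open>The second component agrees with \<open>\<tau> g\<close> only almost everywhere, because \<open>\<tau>\<close> is additive only
  up to null sets; in this form the pairs are closed under linear combinations.\<close>

definition restriction_pairs :: "((real \<Rightarrow> complex) \<Rightarrow> bool) \<Rightarrow> ((real \<Rightarrow> complex) \<times> (real \<Rightarrow> complex)) set" where
  "restriction_pairs P = {(g, h). g \<in> \<D> \<and> P g \<and> sq_integrable M h \<and>
     (AE x in M. h x = \<tau> g x)}"

definition linear_condition :: "((real \<Rightarrow> complex) \<Rightarrow> bool) \<Rightarrow> bool" where
  "linear_condition P \<longleftrightarrow> P (\<lambda>x. 0) \<and> (\<forall>f\<in>\<D>. \<forall>g\<in>\<D>. \<forall>c.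
     P f \<longrightarrow> P g \<longrightarrow> P (\<lambda>x. f x + c * g x))"

lemma sl_restriction_class_graph: "sl_restriction a b p q r P = class_graph M (restriction_pairs P)"
proof
  show "sl_restriction a b p q r P \<subseteq> class_graph M (restriction_pairs P)"
  proof
    fix e assume "e \<in> sl_restriction a b p q r P"
    then obtain g where g: "g \<in> \<D>" "P g"
      "e = (l2_class M g, l2_class M (\<tau> g))" by (auto simp: sl_restriction_def)
    then have "(g, \<tau> g) \<in> restriction_pairs P"
      using max_domD(2)[OF g(1)] by (simp add: restriction_pairs_def)
    then show "e \<in> class_graph M (restriction_pairs P)" unfolding class_graph_def g(3) by force
  qed
  show "class_graph M (restriction_pairs P) \<subseteq> sl_restriction a b p q r P"
  proof
    fix e assume "e \<in> class_graph M (restriction_pairs P)"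
    then obtain g h where g: "g \<in> \<D>" "P g" "AE x in M. h x = \<tau> g x"
      "e = (l2_class M g, l2_class M h)" by (auto simp: class_graph_def restriction_pairs_def)
    from l2_class_cong[OF g(3)] show "e \<in> sl_restriction a b p q r P"
      using g by (auto simp: sl_restriction_def)
  qed
qed

lemma linear_restriction_pairs:
  assumes "linear_condition P"
  shows "linear_pairs M (restriction_pairs P)"
  unfolding linear_pairs_def
proof (intro conjI)
  have "((\<lambda>x. 0), (\<lambda>x. 0)) \<in> restriction_pairs P"
    using assms zero_max_dom sq_integrable_zero
    by (auto simp: restriction_pairs_def linear_condition_def elim: eventually_mono)
  then show "restriction_pairs P \<noteq> {}" by blast
  show "\<forall>(f, g)\<in>restriction_pairs P. sq_integrable M f \<and> sq_integrable M g"
    using max_domD(1) by (auto simp: restriction_pairs_def)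
  have "((\<lambda>x. f x + c * f' x), (\<lambda>x. g x + c * g' x)) \<in> restriction_pairs P"
    if fg: "(f, g) \<in> restriction_pairs P" "(f', g') \<in> restriction_pairs P" for f g f' g' c
  proof -
    have 1: "f \<in> \<D>" "P f" "sq_integrable M g" "AE x in M. g x = \<tau> f x"
      and 2: "f' \<in> \<D>" "P f'" "sq_integrable M g'" "AE x in M. g' x = \<tau> f' x"
      using fg by (auto simp: restriction_pairs_def)
    have "AE x in M. g x + c * g' x = \<tau> (\<lambda>x. f x + c * f' x) x"
      using max_dom_lin(2)[OF 1(1) 2(1), of c] 1(4) 2(4) by eventually_elim simp
    then show ?thesis
      using assms 1 2 max_dom_lin(1)[OF 1(1) 2(1), of c]
      by (auto simp: restriction_pairs_def linear_condition_def intro: sq_integrable_add sq_integrable_scale)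
  qed
  then show "\<forall>(f, g)\<in>restriction_pairs P. \<forall>(f', g')\<in>restriction_pairs P. \<forall>c.
      ((\<lambda>x. f x + c * f' x), (\<lambda>x. g x + c * g' x)) \<in> restriction_pairs P" by blast
qed

lemma linear_operator_sl_restriction:
  assumes "linear_condition P"
  shows "linear_operator M (sl_restriction a b p q r P)"
  unfolding sl_restriction_class_graph
proof (rule linear_operator_class_graph[OF linear_restriction_pairs[OF assms]])
  fix f g assume "(f, g) \<in> restriction_pairs P" and 0: "AE x in M. f x = 0"
  then have f: "f \<in> \<D>" "AE x in M. g x = \<tau> f x"
    by (auto simp: restriction_pairs_def)
  show "AE x in M. g x = 0"
    using f(2) max_dom_AE_eq(2)[OF f(1) zero_max_dom(1) 0] zero_max_dom(2) by eventually_elim simp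
qed

lemma sl_restriction_cong:
  assumes "\<And>g. g \<in> \<D> \<Longrightarrow> P g \<longleftrightarrow> Q g"
  shows "sl_restriction a b p q r P = sl_restriction a b p q r Q"
  using assms unfolding sl_restriction_def by blast

lemma sl_restriction_mono:
  assumes "\<And>g. g \<in> \<D> \<Longrightarrow> P g \<Longrightarrow> Q g"
  shows "sl_restriction a b p q r P \<subseteq> sl_restriction a b p q r Q"
  using assms unfolding sl_restriction_def by blast

lemma sl_restriction_L2: "sl_restriction a b p q r P \<subseteq> L2 M \<times> L2 M"
  unfolding sl_restriction_def using max_domD(1,2) by (auto intro: l2_class_in_L2)

lemma T_min_closure: "T_min a b p q r = op_closure M (sl_restriction a b p q r compact_support)"
  unfolding T_min_def compact_support_def[abs_def] ..

lemma linear_condition_compact_support: "linear_condition compact_support"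
  unfolding linear_condition_def
proof (intro conjI ballI allI impI)
  show "compact_support (\<lambda>x. 0)" unfolding compact_support_def by (intro exI[of _ "{}"]) auto
  fix f g c assume "compact_support f" "compact_support g"
  then obtain K L where "compact K" "K \<subseteq> I" "\<forall>x\<in>I - K. f x = 0" "compact L" "L \<subseteq> I" "\<forall>x\<in>I - L. g x = 0"
    by (auto simp: compact_support_def)
  then show "compact_support (\<lambda>x. f x + c * g x)"
    unfolding compact_support_def by (intro exI[of _ "K \<union> L"]) auto
qed

text \<open>A function orthogonal to all compactly supported \<open>f\<close> is, in the weak sense, \<open>\<tau>\<close> applied to
  zero.\<close>

lemma densely_defined_sl_restriction:
  assumes "\<And>g. g \<in> \<D> \<Longrightarrow> compact_support g \<Longrightarrow> P g"
  shows "densely_defined M (sl_restriction a b p q r P)"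
proof -
  have "densely_defined M (sl_restriction a b p q r compact_support)"
    unfolding sl_restriction_class_graph
  proof (rule densely_defined_class_graph[OF linear_restriction_pairs[OF linear_condition_compact_support]])
    fix h assume h: "sq_integrable M h"
      and orth: "\<And>f g. (f, g) \<in> restriction_pairs compact_support \<Longrightarrow> inner_product M h f = 0"
    obtain U where U: "U \<in> \<D>" "AE x in M. U x = 0" "AE x in M. \<tau> U x = h x"
    proof (rule weak_solution_regular[OF sq_integrable_zero h])
      fix f assume "f \<in> \<D>" "compact_support f"
      then have "(f, \<tau> f) \<in> restriction_pairs compact_support"
        using max_domD(2) by (simp add: restriction_pairs_def)
      then show "inner_product M (\<lambda>x. 0) (\<tau> f) = inner_product M h f"
        using orth by (simp add: inner_product_def)
    qed blast
    show "AE x in M. h x = 0"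
      using U(3) max_dom_AE_eq(2)[OF U(1) zero_max_dom(1) U(2)] zero_max_dom(2) by eventually_elim simp
  qed
  then show ?thesis
    using sl_restriction_mono[of compact_support P] assms unfolding densely_defined_def by (meson Domain_mono subsetD)
qed

lemma resolvent_sl_restriction:
  "(f, h) \<in> resolvent M (sl_restriction a b p q r P) z \<longleftrightarrow>
    (\<exists>y\<in>\<D>. P y \<and> h = l2_class M y \<and> f = l2_class M (\<lambda>x. \<tau> y x - z * y x))"
proof -
  have "l2_diff M (l2_class M (\<tau> y)) (l2_scale M z (l2_class M y))
      = l2_class M (\<lambda>x. \<tau> y x - z * y x)" if "y \<in> \<D>" for y
    using max_domD(1,2)[OF that] by (simp add: l2_scale_class l2_diff_class sq_integrable_scale)
  then show ?thesis
    unfolding resolvent_def op_minus_scalar_def sl_restriction_def by fastforce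
qed

text \<open>The resolvent would map the class of zero both to the class of \<open>y\<close> and to zero.\<close>

lemma resolvent_set_no_eigenfunction:
  assumes z: "z \<in> resolvent_set M (sl_restriction a b p q r P)" and P: "linear_condition P"
    and y: "y \<in> \<D>" "P y" "AE x in M. \<tau> y x = z * y x"
  shows "AE x in M. y x = 0"
proof -
  have "(l2_class M (\<lambda>x. \<tau> y x - z * y x), l2_class M y) \<in> resolvent M (sl_restriction a b p q r P) z"
    unfolding resolvent_sl_restriction using y by blast
  moreover have "l2_class M (\<lambda>x. \<tau> y x - z * y x) =
      l2_class M (\<lambda>x. \<tau> (\<lambda>x. 0) x - z * 0)"
    by (rule l2_class_cong, use y(3) zero_max_dom(2) in eventually_elim) simp
  moreover have "(l2_class M (\<lambda>x. \<tau> (\<lambda>x. 0) x - z * 0), l2_class M (\<lambda>x. 0)) \<in> resolvent M (sl_restriction a b p q r P) z"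
    unfolding resolvent_sl_restriction using zero_max_dom(1) P by (auto simp: linear_condition_def)
  ultimately have "l2_class M y = l2_class M (\<lambda>x. 0)"
    using z unfolding resolvent_set_def by (auto dest: single_valuedD)
  then show ?thesis using l2_class_eq_iff[OF max_domD(1)[OF y(1)] sq_integrable_zero] by simp
qed

text \<open>Where \<open>g\<close> vanishes on an open set its derivative vanishes too; so the quasi-derivative is zero
  almost everywhere and, by continuity, everywhere on that set.\<close>

lemma compact_support_vanishes_near_a:
  assumes g: "g \<in> \<D>" and c: "compact_support g"
  obtains k where "k \<in> I" "\<And>x. x \<in> I \<Longrightarrow> x < k \<Longrightarrow> g x = 0 \<and> qderiv a b p g x = 0"
proof -
  obtain K where K: "compact K" "K \<subseteq> I" "\<forall>x\<in>I - K. g x = 0" using c by (auto simp: compact_support_def)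
  obtain k where k: "k \<in> I" "\<And>x. x \<in> K \<Longrightarrow> k \<le> x"
  proof (cases "K = {}")
    case True
    then show ?thesis using einterval_nonempty[OF ab] that by blast
  next
    case False
    then obtain m where "m \<in> K" "\<And>x. x \<in> K \<Longrightarrow> m \<le> x" using compact_attains_inf[OF K(1)] by blast
    then show ?thesis using K(2) that by blast
  qed
  define S where "S = I \<inter> {..<k}"
  have S: "open S" "S \<subseteq> I" unfolding S_def using open_I by auto
  have g0: "g x = 0" if "x \<in> S" for x
    using K(3) k(2)[of x] that by (cases "x \<in> K") (auto simp: S_def)
  have P: "primitive_on I g (\<lambda>x. qderiv a b p g x / complex_of_real (p x))"
    and P1: "continuous_on I (qderiv a b p g)"
    using max_domD(3)[OF g] by (auto simp: sl_pair_def intro: primitive_on_continuous_on open_I)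
  have "AE x in lebesgue_on I. x \<in> S \<longrightarrow> qderiv a b p g x = 0"
    using primitive_on_has_vector_derivative[OF P open_I] AE_pos(1)
  proof eventually_elim
    case (elim x)
    show ?case
    proof
      assume x: "x \<in> S"
      have "((\<lambda>x. 0) has_vector_derivative qderiv a b p g x / complex_of_real (p x)) (at x)"
        by (rule has_vector_derivative_transform_within_open[OF elim(1) S(1) x g0])
      then have "qderiv a b p g x / complex_of_real (p x) = 0"
        using vector_derivative_unique_at has_vector_derivative_const by blast
      then show "qderiv a b p g x = 0" using elim(2) by simp
    qed
  qed
  then obtain N where N: "negligible N" "\<forall>x\<in>I - N. x \<in> S \<longrightarrow> qderiv a b p g x = 0"
    using AE_lebesgue_on_iff_negligible[OF I_lebesgue] by blast
  have "S \<in> sets lebesgue" using S(1) by (simp add: borel_open sets_completionI_sets)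
  then have "AE x in lebesgue_on S. qderiv a b p g x = 0"
    using N S(2) by (subst AE_lebesgue_on_iff_negligible) auto
  then have "qderiv a b p g x = 0" if "x \<in> S" for x
    using continuous_AE_eq_imp_eq[OF S(1) continuous_on_subset[OF P1 S(2)] continuous_on_const _ that] by blast
  then show ?thesis using k(1) g0 that[of k] by (auto simp: S_def)
qed

lemma wronskian_compact_support:
  assumes f: "f \<in> \<D>" and g: "g \<in> \<D>" and c: "compact_support g"
  shows "wronskian_at_left_end a b p f g = 0"
proof -
  obtain k where k: "k \<in> I" "\<And>x. x \<in> I \<Longrightarrow> x < k \<Longrightarrow> g x = 0 \<and> qderiv a b p g x = 0"
    by (rule compact_support_vanishes_near_a[OF g c]) (rule that; blast)
  have ak: "a < ereal k" using k(1) by (simp add: einterval_def)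
  have "\<forall>\<^sub>F x in at_right a. wronskian a b p f g (real_of_ereal x) = 0"
    unfolding eventually_at_right[OF ak]
  proof (intro exI[of _ "ereal k"] conjI allI impI ak)
    fix x assume x: "a < x" "x < ereal k"
    then obtain t where t: "x = ereal t" by (cases x) auto
    have "ereal k < b" using k(1) by (simp add: einterval_def)
    then have "x < b" using x(2) by (rule less_trans[rotated])
    then have "t \<in> I" "t < k" using x t by (auto simp: einterval_def)
    then show "wronskian a b p f g (real_of_ereal x) = 0" using k(2)[of t] t by (simp add: wronskian_def)
  qed
  then have "((\<lambda>x. wronskian a b p f g (real_of_ereal x)) \<longlongrightarrow> 0) (at_right a)" by (rule tendsto_eventually)
  then show ?thesis
    using tendsto_unique[OF einterval_at_right_neq_bot(1)[OF ab] wronskian_limits(2)[OF f g]] by blast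
qed

end

section \<open>Boundary values in the limit point case\<close>

locale limit_point_problem = sturm_liouville +
  fixes v1 v2 :: "real \<Rightarrow> complex"
  assumes lp: "limit_point_right a b p q r" and pair: "boundary_pair a b p q r v1 v2"
begin

abbreviation W0 where "W0 \<equiv> wronskian_at_left_end a b p"
abbreviation bv where "bv \<equiv> bval a b p v2"
abbreviation bv' where "bv' \<equiv> bval' a b p v1"

lemma v12: "v1 \<in> \<D>" "v2 \<in> \<D>" "\<And>x. x \<in> I \<Longrightarrow> v1 x \<in> \<real>" "\<And>x. x \<in> I \<Longrightarrow> v2 x \<in> \<real>" "W0 v1 v2 = 1"
  using pair by (auto simp: boundary_pair_def)

lemma W0_integral: "f \<in> \<D> \<Longrightarrow> g \<in> \<D> \<Longrightarrow> W0 f g = - integral\<^sup>L M (lagrange f g)"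
  by (rule wronskian_vanishes_at_limit_point[OF lp])

lemma W0_AE:
  assumes "f \<in> \<D>" "g \<in> \<D>" "f' \<in> \<D>" "g' \<in> \<D>"
    and "AE x in M. lagrange f g x = lagrange f' g' x"
  shows "W0 f g = W0 f' g'"
proof -
  have "integral\<^sup>L M (lagrange f g) = integral\<^sup>L M (lagrange f' g')"
    by (rule integral_cong_AE) (use assms wronskian_limits(1) in auto)
  then show ?thesis using assms by (simp add: W0_integral)
qed

lemma W0_lin:
  assumes f: "f \<in> \<D>" and g: "g \<in> \<D>" and h: "h \<in> \<D>"
  shows "W0 f (\<lambda>x. g x + c * h x) = W0 f g + c * W0 f h"
proof -
  note L = wronskian_limits(1)
  have gh: "(\<lambda>x. g x + c * h x) \<in> \<D>" by (rule max_dom_lin(1)[OF g h])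
  have "integral\<^sup>L M (lagrange f (\<lambda>x. g x + c * h x)) = integral\<^sup>L M (\<lambda>x. lagrange f g x + c * lagrange f h x)"
  proof (rule integral_cong_AE)
    show "AE x in M. lagrange f (\<lambda>x. g x + c * h x) x = lagrange f g x + c * lagrange f h x"
      using max_dom_lin(2)[OF g h, of c]
      by eventually_elim (simp add: lagrange_def algebra_simps)
    show "lagrange f (\<lambda>x. g x + c * h x) \<in> borel_measurable M" using L[OF f gh] by auto
    have "integrable M (\<lambda>x. lagrange f g x + c * lagrange f h x)" using L[OF f g] L[OF f h] by simp
    then show "(\<lambda>x. lagrange f g x + c * lagrange f h x) \<in> borel_measurable M" by (rule borel_measurable_integrable)
  qed
  also have "\<dots> = integral\<^sup>L M (lagrange f g) + c * integral\<^sup>L M (lagrange f h)"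
    using L[OF f g] L[OF f h] by simp
  finally show ?thesis using f g h gh by (simp add: W0_integral)
qed

lemma W0_antisym:
  assumes f: "f \<in> \<D>" and g: "g \<in> \<D>"
  shows "W0 f g = - W0 g f"
proof -
  have "lagrange f g = (\<lambda>x. - lagrange g f x)" by (auto simp: lagrange_def)
  then show ?thesis using f g by (simp add: W0_integral)
qed

lemma W0_self: "f \<in> \<D> \<Longrightarrow> W0 f f = 0"
  using W0_antisym[of f f] by simp

lemma W0_AE_right:
  assumes "f \<in> \<D>" "g \<in> \<D>" "g' \<in> \<D>" "AE x in M. g x = g' x"
  shows "W0 f g = W0 f g'"
  by (rule W0_AE[OF assms(1,2,1,3)], use assms(4) max_dom_AE_eq(2)[OF assms(2-4)] in eventually_elim)
    (simp add: lagrange_def)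

text \<open>Complex conjugation commutes with \<open>\<tau>\<close> because the coefficients are real.\<close>

lemma W0_cnj:
  assumes v: "v \<in> \<D>" "\<And>x. x \<in> I \<Longrightarrow> v x \<in> \<real>" and g: "g \<in> \<D>"
  shows "W0 v (\<lambda>x. cnj (g x)) = cnj (W0 v g)"
proof -
  have Iae: "AE x in M. x \<in> I" by (rule AE_I2) (simp add: sl_measure_def space_restrict_space)
  have rv: "AE x in M. v x = cnj (v x)" using Iae by eventually_elim (use v(2) in \<open>simp add: Reals_cnj_iff\<close>)
  have r\<tau>: "AE x in M. \<tau> v x = cnj (\<tau> v x)"
    using max_dom_AE_eq(2)[OF v(1) max_dom_cnj(1)[OF v(1)] rv] max_dom_cnj(2)[OF v(1)] by eventually_elim (erule trans)
  note cg = max_dom_cnj[OF g]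
  have "integral\<^sup>L M (lagrange v (\<lambda>x. cnj (g x))) = integral\<^sup>L M (\<lambda>x. cnj (lagrange v g x))"
  proof (rule integral_cong_AE)
    show "AE x in M. lagrange v (\<lambda>x. cnj (g x)) x = cnj (lagrange v g x)"
      using rv r\<tau> cg(2) by eventually_elim (simp add: lagrange_def)
    show "lagrange v (\<lambda>x. cnj (g x)) \<in> borel_measurable M" using wronskian_limits(1)[OF v(1) cg(1)] by auto
    show "(\<lambda>x. cnj (lagrange v g x)) \<in> borel_measurable M"
      using wronskian_limits(1)[OF v(1) g] by (intro borel_measurable_cnj) auto
  qed
  then show ?thesis using W0_integral[OF v(1) cg(1)] W0_integral[OF v(1) g] by simp
qed

lemma bv_lin:
  assumes "f \<in> \<D>" "g \<in> \<D>"
  shows "bv (\<lambda>x. f x + c * g x) = bv f + c * bv g" "bv' (\<lambda>x. f x + c * g x) = bv' f + c * bv' g"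
  using W0_lin[OF v12(1) assms] W0_lin[OF v12(2) assms] by (simp_all add: bval_def bval'_def algebra_simps)

lemma bv_zero: "bv (\<lambda>x. 0) = 0" "bv' (\<lambda>x. 0) = 0"
  using bv_lin[OF v12(1) v12(1), of "-1"] by simp_all

lemma bv_AE:
  assumes "f \<in> \<D>" "g \<in> \<D>" "AE x in M. f x = g x"
  shows "bv f = bv g" "bv' f = bv' g"
  using W0_AE_right[OF v12(1) assms] W0_AE_right[OF v12(2) assms] by (simp_all add: bval_def bval'_def)

lemma bv_cnj:
  assumes "g \<in> \<D>"
  shows "bv (\<lambda>x. cnj (g x)) = cnj (bv g)" "bv' (\<lambda>x. cnj (g x)) = cnj (bv' g)"
  using W0_cnj[OF v12(1,3) assms] W0_cnj[OF v12(2,4) assms] by (simp_all add: bval_def bval'_def)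

lemma bv_basis: "bv v1 = 1" "bv' v1 = 0" "bv v2 = 0" "bv' v2 = 1"
  using W0_antisym[OF v12(2,1)] v12(5) W0_self[OF v12(1)] W0_self[OF v12(2)]
  by (simp_all add: bval_def bval'_def)

lemma bv_compact_support:
  assumes "g \<in> \<D>" "compact_support g"
  shows "bv g = 0" "bv' g = 0"
  using wronskian_compact_support[OF v12(1) assms] wronskian_compact_support[OF v12(2) assms]
  by (simp_all add: bval_def bval'_def)

text \<open>The Pluecker relation between the six Wronskians of \<open>f\<close>, \<open>g\<close>, \<open>v1\<close>, \<open>v2\<close> holds at every
  point; at \<open>a\<close> the Wronskian of \<open>v1\<close> and \<open>v2\<close> is \<open>1\<close>.\<close>

lemma W0_bv:
  assumes f: "f \<in> \<D>" and g: "g \<in> \<D>"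
  shows "W0 f g = bv f * bv' g - bv' f * bv g"
proof -
  note L = wronskian_limits(2)
  have eq: "wronskian a b p f g x * wronskian a b p v1 v2 x =
      wronskian a b p v1 f x * wronskian a b p v2 g x - wronskian a b p v2 f x * wronskian a b p v1 g x" for x
    by (simp add: wronskian_def algebra_simps)
  have "W0 f g * W0 v1 v2 = W0 v1 f * W0 v2 g - W0 v2 f * W0 v1 g"
    by (rule tendsto_unique[OF einterval_at_right_neq_bot(1)[OF ab]
          tendsto_mult[OF L[OF f g] L[OF v12(1,2)], unfolded eq]
          tendsto_diff[OF tendsto_mult[OF L[OF v12(1) f] L[OF v12(2) g]] tendsto_mult[OF L[OF v12(2) f] L[OF v12(1) g]]]])
  then show ?thesis by (simp add: v12(5) bval_def bval'_def)
qed

lemma green: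
  assumes f: "f \<in> \<D>" and g: "g \<in> \<D>"
  shows "W0 (\<lambda>x. cnj (f x)) g = inner_product M f (\<tau> g) - inner_product M (\<tau> f) g"
proof -
  note F = max_domD[OF f] and G = max_domD[OF g] and C = max_dom_cnj[OF f]
  have "integral\<^sup>L M (lagrange (\<lambda>x. cnj (f x)) g) = integral\<^sup>L M (\<lambda>x. cnj (\<tau> f x) * g x - cnj (f x) * \<tau> g x)"
  proof (rule integral_cong_AE)
    show "AE x in M. lagrange (\<lambda>x. cnj (f x)) g x = cnj (\<tau> f x) * g x - cnj (f x) * \<tau> g x"
      using C(2) by eventually_elim (simp add: lagrange_def)
    show "lagrange (\<lambda>x. cnj (f x)) g \<in> borel_measurable M" using wronskian_limits(1)[OF C(1) g] by auto
    show "(\<lambda>x. cnj (\<tau> f x) * g x - cnj (f x) * \<tau> g x) \<in> borel_measurable M"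
      using integrable_cnj_mult(2)[OF F(2) G(1)] integrable_cnj_mult(2)[OF F(1) G(2)]
      by (intro borel_measurable_diff) auto
  qed
  also have "\<dots> = inner_product M (\<tau> f) g - inner_product M f (\<tau> g)"
    using integrable_cnj_mult(2)[OF F(2) G(1)] integrable_cnj_mult(2)[OF F(1) G(2)]
    by (simp add: inner_product_def)
  finally show ?thesis using W0_integral[OF C(1) g] by simp
qed

section \<open>Self-adjoint realizations\<close>

lemma inner_product_AE_left:
  assumes "sq_integrable M f" "sq_integrable M g" "sq_integrable M h" "AE x in M. f x = g x"
  shows "inner_product M f h = inner_product M g h"
  unfolding inner_product_def
  by (rule integral_cong_AE)
    (use integrable_cnj_mult(2)[OF assms(1,3)] integrable_cnj_mult(2)[OF assms(2,3)] assms(4) in \<open>auto elim: eventually_mono\<close>)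

lemma inner_product_AE_right:
  assumes "sq_integrable M f" "sq_integrable M g" "sq_integrable M h" "AE x in M. f x = g x"
  shows "inner_product M h f = inner_product M h g"
  unfolding inner_product_def
  by (rule integral_cong_AE)
    (use integrable_cnj_mult(2)[OF assms(3,1)] integrable_cnj_mult(2)[OF assms(3,2)] assms(4) in \<open>auto elim: eventually_mono\<close>)

text \<open>An element of the adjoint satisfies the equation weakly, since the restriction contains all
  compactly supported functions. So it is given by some \<open>U\<close> in the maximal domain, and in Green's
  formula only the Wronskian at \<open>a\<close> remains.\<close>

lemma adjoint_sl_restriction:
  assumes P: "\<And>g. g \<in> \<D> \<Longrightarrow> compact_support g \<Longrightarrow> P g"
  shows "op_adjoint M (sl_restriction a b p q r P) =
    sl_restriction a b p q r (\<lambda>g. \<forall>f\<in>\<D>. P f \<longrightarrow> W0 (\<lambda>x. cnj (g x)) f = 0)" (is "?A = ?B")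
proof
  have sq: "sq_integrable M f \<and> sq_integrable M g" if "(f, g) \<in> restriction_pairs P" for f g
    using that max_domD(1) by (auto simp: restriction_pairs_def)
  have rp: "(f, \<tau> f) \<in> restriction_pairs P" if "f \<in> \<D>" "P f" for f
    using that max_domD(2)[OF that(1)] by (simp add: restriction_pairs_def)
  show "?A \<subseteq> ?B"
  proof clarify
    fix u w assume uw: "(u, w) \<in> ?A"
    then have "u \<in> L2 M" "w \<in> L2 M" by (auto simp: op_adjoint_def)
    then obtain u' w' where u': "sq_integrable M u'" "u = l2_class M u'" and w': "sq_integrable M w'" "w = l2_class M w'"
      by (metis L2E)
    have weak: "inner_product M u' g = inner_product M w' f" if "(f, g) \<in> restriction_pairs P" for f g
      using uw that op_adjoint_class_graph[OF sq u'(1) w'(1)] unfolding sl_restriction_class_graph u' w' by blast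
    obtain U where U: "U \<in> \<D>" "AE x in M. U x = u' x" "AE x in M. \<tau> U x = w' x"
    proof (rule weak_solution_regular[OF u'(1) w'(1)])
      show "inner_product M u' (\<tau> f) = inner_product M w' f" if "f \<in> \<D>" "compact_support f" for f
        using weak[OF rp] P that by blast
    qed blast
    have "W0 (\<lambda>x. cnj (U x)) f = 0" if f: "f \<in> \<D>" "P f" for f
      using green[OF U(1) f(1)] weak[OF rp[OF f]]
        inner_product_AE_left[OF max_domD(1)[OF U(1)] u'(1) max_domD(2)[OF f(1)] U(2)]
        inner_product_AE_left[OF max_domD(2)[OF U(1)] w'(1) max_domD(1)[OF f(1)] U(3)] by simp
    moreover have "u = l2_class M U" "w = l2_class M (\<tau> U)"
      using l2_class_cong[OF U(2)] l2_class_cong[OF U(3)] u' w' by simp_all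
    ultimately show "(u, w) \<in> ?B" using U(1) unfolding sl_restriction_def by blast
  qed
  show "?B \<subseteq> ?A"
  proof clarify
    fix u w assume "(u, w) \<in> ?B"
    then obtain U where U: "U \<in> \<D>" "u = l2_class M U" "w = l2_class M (\<tau> U)"
      "\<And>f. f \<in> \<D> \<Longrightarrow> P f \<Longrightarrow> W0 (\<lambda>x. cnj (U x)) f = 0" unfolding sl_restriction_def by blast
    note S = max_domD(1,2)[OF U(1)]
    show "(u, w) \<in> ?A"
      unfolding sl_restriction_class_graph U(2,3)
    proof (subst op_adjoint_class_graph[OF sq S], assumption, clarify)
      fix f g assume "(f, g) \<in> restriction_pairs P"
      then have f: "f \<in> \<D>" "P f" "sq_integrable M g" "AE x in M. g x = \<tau> f x" by (auto simp: restriction_pairs_def)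
      have "inner_product M U g = inner_product M U (\<tau> f)"
        by (rule inner_product_AE_right[OF f(3) max_domD(2)[OF f(1)] S(1) f(4)])
      then show "inner_product M U g = inner_product M (\<tau> U) f"
        using green[OF U(1) f(1)] U(4)[OF f(1,2)] by simp
    qed
  qed
qed

definition bc :: "real \<Rightarrow> (real \<Rightarrow> complex) \<Rightarrow> bool" where
  "bc \<alpha> g \<longleftrightarrow> complex_of_real (cos \<alpha>) * bv g + complex_of_real (sin \<alpha>) * bv' g = 0"

lemma T_bc_eq: "T_bc a b p q r v1 v2 \<alpha> = sl_restriction a b p q r (bc \<alpha>)"
  unfolding T_bc_def bc_def[abs_def] ..

lemma linear_condition_bc: "linear_condition (bc \<alpha>)"
  unfolding linear_condition_def
proof (intro conjI ballI allI impI)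
  show "bc \<alpha> (\<lambda>x. 0)" by (simp add: bc_def bv_zero)
  fix f g c assume "f \<in> \<D>" "g \<in> \<D>" "bc \<alpha> f" "bc \<alpha> g"
  then show "bc \<alpha> (\<lambda>x. f x + c * g x)"
  proof -
    have "complex_of_real (cos \<alpha>) * (bv f + c * bv g) + complex_of_real (sin \<alpha>) * (bv' f + c * bv' g)
      = (complex_of_real (cos \<alpha>) * bv f + complex_of_real (sin \<alpha>) * bv' f)
        + c * (complex_of_real (cos \<alpha>) * bv g + complex_of_real (sin \<alpha>) * bv' g)" by (simp add: algebra_simps)
    then show ?thesis using \<open>f \<in> \<D>\<close> \<open>g \<in> \<D>\<close> \<open>bc \<alpha> f\<close> \<open>bc \<alpha> g\<close> by (simp add: bc_def bv_lin)
  qed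
qed

lemma compact_support_bc: "g \<in> \<D> \<Longrightarrow> compact_support g \<Longrightarrow> bc \<alpha> g"
  by (simp add: bc_def bv_compact_support)

lemma bc_cnj:
  assumes "g \<in> \<D>"
  shows "bc \<alpha> (\<lambda>x. cnj (g x)) \<longleftrightarrow> bc \<alpha> g"
proof -
  have "complex_of_real (cos \<alpha>) * cnj (bv g) + complex_of_real (sin \<alpha>) * cnj (bv' g)
      = cnj (complex_of_real (cos \<alpha>) * bv g + complex_of_real (sin \<alpha>) * bv' g)" by simp
  then show ?thesis using assms by (simp add: bc_def bv_cnj del: complex_cnj_add complex_cnj_mult)
qed

text \<open>A boundary condition confines the two boundary values to a line in the plane, and a line is its
  own complement with respect to the determinant.\<close>

lemma bc_wronskian:
  assumes g: "g \<in> \<D>"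
  shows "(\<forall>f\<in>\<D>. bc \<alpha> f \<longrightarrow> W0 g f = 0) \<longleftrightarrow> bc \<alpha> g"
proof
  let ?c = "complex_of_real (cos \<alpha>)" and ?s = "complex_of_real (sin \<alpha>)"
  \<comment> \<open>the combination of \<open>v1\<close> and \<open>v2\<close> with boundary values \<open>sin \<alpha>\<close> and \<open>- cos \<alpha>\<close>\<close>
  define f where "f = (\<lambda>x. (0 + ?s * v1 x) + (- ?c) * v2 x)"
  have sv: "(\<lambda>x. 0 + ?s * v1 x) \<in> \<D>" by (rule max_dom_lin(1)[OF zero_max_dom(1) v12(1)])
  have f: "f \<in> \<D>" unfolding f_def by (rule max_dom_lin(1)[OF sv v12(2)])
  have fb: "bv f = ?s" "bv' f = - ?c"
    unfolding f_def bv_lin[OF sv v12(2)] bv_lin[OF zero_max_dom(1) v12(1)] by (simp_all add: bv_basis bv_zero)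
  assume "\<forall>f\<in>\<D>. bc \<alpha> f \<longrightarrow> W0 g f = 0"
  then have "W0 g f = 0" using f by (auto simp: bc_def fb)
  then show "bc \<alpha> g" by (simp add: W0_bv[OF g f] fb bc_def add_eq_0_iff algebra_simps)
next
  let ?c = "complex_of_real (cos \<alpha>)" and ?s = "complex_of_real (sin \<alpha>)"
  assume G: "bc \<alpha> g"
  show "\<forall>f\<in>\<D>. bc \<alpha> f \<longrightarrow> W0 g f = 0"
  proof (intro ballI impI)
    fix f assume f: "f \<in> \<D>" "bc \<alpha> f"
    define w where "w = bv g * bv' f - bv' g * bv f"
    have "?c * w = (?c * bv g + ?s * bv' g) * bv' f - bv' g * (?c * bv f + ?s * bv' f)"
      "?s * w = bv g * (?c * bv f + ?s * bv' f) - (?c * bv g + ?s * bv' g) * bv f"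
      by (simp_all add: w_def algebra_simps)
    then have cs: "?c * w = 0" "?s * w = 0" using G f(2) by (simp_all add: bc_def)
    have "w = (?c\<^sup>2 + ?s\<^sup>2) * w" by (simp flip: of_real_power of_real_add)
    also have "\<dots> = ?c * (?c * w) + ?s * (?s * w)" by (simp add: power2_eq_square algebra_simps)
    also have "\<dots> = 0" unfolding cs by simp
    finally show "W0 g f = 0" by (simp add: W0_bv[OF g f(1)] w_def)
  qed
qed

lemma self_adjoint_T_bc: "self_adjoint M (T_bc a b p q r v1 v2 \<alpha>)"
  unfolding self_adjoint_def T_bc_eq
proof (intro conjI)
  show "linear_operator M (sl_restriction a b p q r (bc \<alpha>))"
    by (rule linear_operator_sl_restriction[OF linear_condition_bc])
  show "densely_defined M (sl_restriction a b p q r (bc \<alpha>))"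
    by (rule densely_defined_sl_restriction[OF compact_support_bc])
  have "op_adjoint M (sl_restriction a b p q r (bc \<alpha>)) =
      sl_restriction a b p q r (\<lambda>g. \<forall>f\<in>\<D>. bc \<alpha> f \<longrightarrow> W0 (\<lambda>x. cnj (g x)) f = 0)"
    by (rule adjoint_sl_restriction[OF compact_support_bc])
  also have "\<dots> = sl_restriction a b p q r (bc \<alpha>)"
    by (rule sl_restriction_cong) (simp add: bc_wronskian[OF max_dom_cnj(1)] bc_cnj)
  finally show "op_adjoint M (sl_restriction a b p q r (bc \<alpha>)) = sl_restriction a b p q r (bc \<alpha>)" .
qed

definition no_bv :: "(real \<Rightarrow> complex) \<Rightarrow> bool" where
  "no_bv g \<longleftrightarrow> bv g = 0 \<and> bv' g = 0"

lemma linear_condition_no_bv: "linear_condition no_bv"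
  unfolding linear_condition_def by (auto simp: no_bv_def bv_zero bv_lin)

text \<open>A Wronskian at \<open>a\<close> that vanishes against \<open>v1\<close> and \<open>v2\<close> leaves no boundary value.\<close>

lemma adjoint_T_max: "op_adjoint M (T_max a b p q r) = sl_restriction a b p q r no_bv"
proof -
  have "op_adjoint M (T_max a b p q r) = sl_restriction a b p q r (\<lambda>g. \<forall>f\<in>\<D>. True \<longrightarrow> W0 (\<lambda>x. cnj (g x)) f = 0)"
    unfolding T_max_def by (rule adjoint_sl_restriction) simp
  also have "\<dots> = sl_restriction a b p q r no_bv"
  proof (rule sl_restriction_cong)
    fix g assume g: "g \<in> \<D>"
    note c = max_dom_cnj(1)[OF g]
    have "(\<forall>f\<in>\<D>. W0 (\<lambda>x. cnj (g x)) f = 0) \<longleftrightarrow> no_bv g"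
    proof
      assume "\<forall>f\<in>\<D>. W0 (\<lambda>x. cnj (g x)) f = 0"
      then have "W0 (\<lambda>x. cnj (g x)) v1 = 0" "W0 (\<lambda>x. cnj (g x)) v2 = 0" using v12 by auto
      then show "no_bv g" by (simp add: W0_bv[OF c] v12 bv_basis bv_cnj[OF g] no_bv_def)
    next
      assume "no_bv g"
      then show "\<forall>f\<in>\<D>. W0 (\<lambda>x. cnj (g x)) f = 0" by (simp add: W0_bv[OF c] bv_cnj[OF g] no_bv_def)
    qed
    then show "(\<forall>f\<in>\<D>. True \<longrightarrow> W0 (\<lambda>x. cnj (g x)) f = 0) \<longleftrightarrow> no_bv g" by simp
  qed
  finally show ?thesis .
qed

text \<open>Functions of compact support have no boundary values, and the right-hand side is closed, being
  the adjoint of \<open>T_max\<close>. Conversely \<open>T_max\<close> is the adjoint of the compactly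
  supported restriction, so the adjoint of \<open>T_max\<close> is the double adjoint, that is, the closure, of
  that restriction.\<close>

theorem T_min_eq: "T_min a b p q r = sl_restriction a b p q r no_bv"
proof
  have cs: "compact_support g \<Longrightarrow> g \<in> \<D> \<Longrightarrow> no_bv g" for g by (simp add: no_bv_def bv_compact_support)
  have "sl_restriction a b p q r compact_support \<subseteq> op_adjoint M (T_max a b p q r)"
    unfolding adjoint_T_max by (rule sl_restriction_mono) (rule cs)
  then have "op_closure M (sl_restriction a b p q r compact_support) \<subseteq> op_adjoint M (T_max a b p q r)"
    by (rule op_closure_subset_adjoint) (simp_all add: sl_restriction_L2 T_max_def)
  then show "T_min a b p q r \<subseteq> sl_restriction a b p q r no_bv" unfolding T_min_closure adjoint_T_max .
  show "sl_restriction a b p q r no_bv \<subseteq> T_min a b p q r"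
  proof
    fix e assume "e \<in> sl_restriction a b p q r no_bv"
    then obtain g where g: "g \<in> \<D>" "no_bv g" "e = (l2_class M g, l2_class M (\<tau> g))" by (auto simp: sl_restriction_def)
    show "e \<in> T_min a b p q r"
      unfolding T_min_closure g(3) sl_restriction_class_graph
    proof (rule biadjoint_imp_closure[OF linear_restriction_pairs[OF linear_condition_compact_support] max_domD(1,2)[OF g(1)]])
      fix u w assume u: "sq_integrable M u" and w: "sq_integrable M w"
        and weak: "\<And>f h. (f, h) \<in> restriction_pairs compact_support \<Longrightarrow> inner_product M u h = inner_product M w f"
      obtain U where U: "U \<in> \<D>" "AE x in M. U x = u x" "AE x in M. \<tau> U x = w x"
      proof (rule weak_solution_regular[OF u w])
        fix f assume "f \<in> \<D>" "compact_support f"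
        then show "inner_product M u (\<tau> f) = inner_product M w f"
          using max_domD(2) by (intro weak) (simp add: restriction_pairs_def)
      qed blast
      have "W0 (\<lambda>x. cnj (U x)) g = 0"
        using g(2) by (simp add: W0_bv[OF max_dom_cnj(1)[OF U(1)] g(1)] no_bv_def)
      then show "inner_product M u (\<tau> g) = inner_product M w g"
        using green[OF U(1) g(1)]
          inner_product_AE_left[OF max_domD(1)[OF U(1)] u max_domD(2)[OF g(1)] U(2)]
          inner_product_AE_left[OF max_domD(2)[OF U(1)] w max_domD(1)[OF g(1)] U(3)] by simp
    qed
  qed
qed

lemma T_min_subset: "T_min a b p q r \<subseteq> T_bc a b p q r v1 v2 \<alpha>"
  unfolding T_min_eq T_bc_eq by (rule sl_restriction_mono) (simp add: no_bv_def bc_def)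

lemma symmetric_T_min: "symmetric_operator M (T_min a b p q r)"
  unfolding symmetric_operator_def
proof (intro conjI)
  show "linear_operator M (T_min a b p q r)"
    unfolding T_min_eq by (rule linear_operator_sl_restriction[OF linear_condition_no_bv])
  show "densely_defined M (T_min a b p q r)"
    unfolding T_min_eq by (rule densely_defined_sl_restriction) (simp add: no_bv_def bv_compact_support)
  have "T_min a b p q r \<subseteq> T_max a b p q r" unfolding T_min_eq T_max_def by (rule sl_restriction_mono) simp
  then have "op_adjoint M (T_max a b p q r) \<subseteq> op_adjoint M (T_min a b p q r)"
    unfolding op_adjoint_def by blast
  then show "T_min a b p q r \<subseteq> op_adjoint M (T_min a b p q r)" unfolding adjoint_T_max T_min_eq .
qed

text \<open>As \<open>sin \<alpha> \<noteq> 0\<close>, the boundary conditions for \<open>0\<close> and for \<open>\<alpha>\<close> together make both boundary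
  values vanish.\<close>

lemma relatively_prime_T_bc:
  assumes \<alpha>: "\<alpha> \<in> {0<..<pi}"
  shows "relatively_prime M (T_min a b p q r) (T_bc a b p q r v1 v2 0) (T_bc a b p q r v1 v2 \<alpha>)"
  unfolding relatively_prime_def
proof (intro conjI symmetric_T_min self_adjoint_T_bc T_min_subset)
  show "common_part (T_bc a b p q r v1 v2 0) (T_bc a b p q r v1 v2 \<alpha>) = T_min a b p q r"
  proof
    show "T_min a b p q r \<subseteq> common_part (T_bc a b p q r v1 v2 0) (T_bc a b p q r v1 v2 \<alpha>)"
      using T_min_subset[of 0] T_min_subset[of \<alpha>] unfolding common_part_def by blast
    show "common_part (T_bc a b p q r v1 v2 0) (T_bc a b p q r v1 v2 \<alpha>) \<subseteq> T_min a b p q r"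
    proof clarify
      fix u v assume "(u, v) \<in> common_part (T_bc a b p q r v1 v2 0) (T_bc a b p q r v1 v2 \<alpha>)"
      then have uv: "(u, v) \<in> sl_restriction a b p q r (bc 0)" "(u, v) \<in> sl_restriction a b p q r (bc \<alpha>)"
        by (auto simp: common_part_def T_bc_eq)
      then obtain g g' where g: "g \<in> \<D>" "bc 0 g" "u = l2_class M g" "v = l2_class M (\<tau> g)"
        and g': "g' \<in> \<D>" "bc \<alpha> g'" "u = l2_class M g'" unfolding sl_restriction_def by blast
      have "AE x in M. g x = g' x"
        using g g' l2_class_eq_iff[OF max_domD(1)[OF g(1)] max_domD(1)[OF g'(1)]] by simp
      then have e: "bv g = bv g'" "bv' g = bv' g'" using bv_AE[OF g(1) g'(1)] by auto
      have "sin \<alpha> \<noteq> 0" using sin_gt_zero[of \<alpha>] \<alpha> by auto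
      then have "no_bv g" using g(2) g'(2) e by (simp add: bc_def no_bv_def)
      then show "(u, v) \<in> T_min a b p q r" unfolding T_min_eq sl_restriction_def using g by blast
    qed
  qed
qed

section \<open>Krein's formula\<close>

definition weyl_candidate :: "complex \<Rightarrow> (real \<Rightarrow> complex) \<Rightarrow> bool" where
  "weyl_candidate z y \<longleftrightarrow> y \<in> \<D> \<and> (AE x in M. \<tau> y x = z * y x) \<and> bv y = 1 \<and> (\<forall>x. x \<notin> I \<longrightarrow> y x = 0)"

lemma weyl_solution_eq: "weyl_solution a b p q r v2 z = (THE y. weyl_candidate z y)"
proof -
  have "(sl_solution a b p q r z y \<and> sq_integrable M y \<and> bv y = 1 \<and> (\<forall>x. x \<notin> I \<longrightarrow> y x = 0)) \<longleftrightarrow> weyl_candidate z y" for y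
    using sl_solution_max_dom[of y z] max_domD(1)[of y] unfolding weyl_candidate_def by blast
  then show ?thesis unfolding weyl_solution_def by presburger
qed

lemma weyl_candidate_unique:
  assumes z: "z \<in> resolvent_set M (T_bc a b p q r v1 v2 0)"
    and y: "weyl_candidate z y" and u: "weyl_candidate z u"
  shows "y = u"
proof -
  have Y: "y \<in> \<D>" "AE x in M. \<tau> y x = z * y x" "bv y = 1" "\<And>x. x \<notin> I \<Longrightarrow> y x = 0"
    and U: "u \<in> \<D>" "AE x in M. \<tau> u x = z * u x" "bv u = 1" "\<And>x. x \<notin> I \<Longrightarrow> u x = 0"
    using y u by (auto simp: weyl_candidate_def)
  define d where "d = (\<lambda>x. y x + (-1) * u x)"
  note dl = max_dom_lin[OF Y(1) U(1), of "-1", folded d_def]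
  have "bc 0 d" unfolding bc_def d_def bv_lin[OF Y(1) U(1)] by (simp add: Y U)
  moreover have "AE x in M. \<tau> d x = z * d x"
    using dl(2) Y(2) U(2) by eventually_elim (simp add: d_def algebra_simps)
  ultimately have "AE x in M. d x = 0"
    using resolvent_set_no_eigenfunction[OF z[unfolded T_bc_eq] linear_condition_bc dl(1)] by blast
  then have "AE x in M. y x = u x" by (auto simp: d_def elim: eventually_mono)
  then show ?thesis using max_dom_AE_eq(1)[OF Y(1) U(1)] Y(4) U(4) by (metis ext)
qed

text \<open>The function \<open>v1\<close> has boundary value \<open>1\<close>. Subtracting the resolvent of \<open>T_0\<close> applied to
  \<open>\<tau> v1 - z * v1\<close> turns it into a solution and does not change the boundary value.\<close>

lemma weyl_candidate_exists:
  assumes z: "z \<in> resolvent_set M (T_bc a b p q r v1 v2 0)"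
  shows "\<exists>y. weyl_candidate z y"
proof -
  define f where "f = (\<lambda>x. \<tau> v1 x - z * v1 x)"
  have fsq: "sq_integrable M f"
    unfolding f_def using max_domD(1,2)[OF v12(1)] by (intro sq_integrable_diff sq_integrable_scale)
  then have "l2_class M f \<in> Domain (resolvent M (T_bc a b p q r v1 v2 0) z)"
    using z l2_class_in_L2 unfolding resolvent_set_def by blast
  then obtain u where u: "u \<in> \<D>" "bc 0 u" "l2_class M f = l2_class M (\<lambda>x. \<tau> u x - z * u x)"
    unfolding T_bc_eq Domain_iff resolvent_sl_restriction by blast
  have usq: "sq_integrable M (\<lambda>x. \<tau> u x - z * u x)"
    using max_domD(1,2)[OF u(1)] by (intro sq_integrable_diff sq_integrable_scale)
  have ae: "AE x in M. f x = \<tau> u x - z * u x" using u(3) l2_class_eq_iff[OF fsq usq] by simp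
  define y0 where "y0 = (\<lambda>x. v1 x + (-1) * u x)"
  note y0 = max_dom_lin[OF v12(1) u(1), of "-1", folded y0_def]
  have y0e: "AE x in M. \<tau> y0 x = z * y0 x"
    using y0(2) ae
  proof eventually_elim
    case (elim x)
    have "\<tau> v1 x - \<tau> u x = z * v1 x - z * u x" using elim(2) by (simp add: f_def algebra_simps)
    then show ?case using elim(1) by (simp add: y0_def right_diff_distrib)
  qed
  have y0b: "bv y0 = 1" unfolding y0_def bv_lin[OF v12(1) u(1)] using u(2) by (simp add: bv_basis bc_def)
  define y where "y x = (if x \<in> I then y0 x else 0)" for x
  have yI: "y0 x = y x" if "x \<in> I" for x using that by (simp add: y_def)
  have yd: "y \<in> \<D>" "AE x in M. \<tau> y x = \<tau> y0 x"
    using max_dom_cong[OF y0(1), of y] yI by blast+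
  have yae: "AE x in M. y0 x = y x" by (rule AE_I2) (simp add: yI sl_measure_def space_restrict_space)
  have "AE x in M. \<tau> y x = z * y x" using yd(2) y0e yae by eventually_elim simp
  moreover have "bv y = 1" using bv_AE(1)[OF y0(1) yd(1) yae] y0b by simp
  ultimately have "weyl_candidate z y" using yd(1) by (simp add: weyl_candidate_def y_def)
  then show ?thesis by blast
qed

lemma weyl_solution_candidate:
  assumes "z \<in> resolvent_set M (T_bc a b p q r v1 v2 0)"
  shows "weyl_candidate z (weyl_solution a b p q r v2 z)"
  unfolding weyl_solution_eq using weyl_candidate_exists[OF assms] weyl_candidate_unique[OF assms] by (metis theI)

lemma weyl_candidate_cnj:
  assumes "weyl_candidate z y"
  shows "weyl_candidate (cnj z) (\<lambda>x. cnj (y x))"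
proof -
  have Y: "y \<in> \<D>" "AE x in M. \<tau> y x = z * y x" "bv y = 1" "\<And>x. x \<notin> I \<Longrightarrow> y x = 0"
    using assms by (auto simp: weyl_candidate_def)
  note C = max_dom_cnj[OF Y(1)]
  have "AE x in M. \<tau> (\<lambda>x. cnj (y x)) x = cnj z * cnj (y x)" using C(2) Y(2) by eventually_elim simp
  then show ?thesis using C(1) Y(3,4) by (simp add: weyl_candidate_def bv_cnj[OF Y(1)])
qed

text \<open>The coefficients and \<open>v2\<close> are real, so conjugation maps solutions for \<open>z\<close> to solutions for
  \<open>cnj z\<close> and preserves the boundary value \<open>1\<close>.\<close>

lemma weyl_solution_cnj:
  assumes z: "z \<in> resolvent_set M (T_bc a b p q r v1 v2 0)"
  shows "weyl_solution a b p q r v2 (cnj z) = (\<lambda>x. cnj (weyl_solution a b p q r v2 z x))"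
  unfolding weyl_solution_eq[of "cnj z"]
proof (rule the_equality)
  note W = weyl_solution_candidate[OF z]
  show "weyl_candidate (cnj z) (\<lambda>x. cnj (weyl_solution a b p q r v2 z x))" by (rule weyl_candidate_cnj[OF W])
  fix y assume "weyl_candidate (cnj z) y"
  from weyl_candidate_cnj[OF this] have "weyl_candidate z (\<lambda>x. cnj (y x))" by simp
  then have "(\<lambda>x. cnj (y x)) = weyl_solution a b p q r v2 z" by (rule weyl_candidate_unique[OF z _ W])
  then show "y = (\<lambda>x. cnj (weyl_solution a b p q r v2 z x))" by (metis complex_cnj_cnj)
qed

text \<open>Let \<open>y\<close> be the resolvent of \<open>T_0\<close> applied to \<open>g\<close>. Adding \<open>e * \<psi>\<close> to \<open>y\<close> does not affect
  \<open>\<tau> y - z * y = g\<close> and changes the boundary values from \<open>0\<close> and \<open>bv' y\<close> to \<open>e\<close> and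
  \<open>bv' y + e * bv' \<psi>\<close>. The boundary condition for \<open>\<alpha>\<close> then reads \<open>e * k = bv' y\<close>, and Green's
  formula gives \<open>bv' y\<close> as the inner product of \<open>g\<close> with \<open>cnj \<psi>\<close>, which is the Weyl solution for
  \<open>cnj z\<close>. If \<open>k\<close> were zero, \<open>\<psi>\<close> would be an eigenfunction.\<close>

lemma krein_formula:
  assumes \<alpha>: "\<alpha> \<in> {0<..<pi}"
    and z0: "z \<in> resolvent_set M (T_bc a b p q r v1 v2 0)"
    and z\<alpha>: "z \<in> resolvent_set M (T_bc a b p q r v1 v2 \<alpha>)"
  shows "krein_scalar a b p q r v1 v2 \<alpha> z \<noteq> 0"
    and "resolvent M (T_bc a b p q r v1 v2 \<alpha>) z =
      op_add M (resolvent M (T_bc a b p q r v1 v2 0) z)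
        (op_scale M (inverse (krein_scalar a b p q r v1 v2 \<alpha> z))
          (rank_one M (l2_class M (weyl_solution a b p q r v2 (cnj z)))
            (l2_class M (weyl_solution a b p q r v2 z))))" (is "?R\<alpha> = ?R")
proof -
  define \<psi> where "\<psi> = weyl_solution a b p q r v2 z"
  have \<psi>: "\<psi> \<in> \<D>" "AE x in M. \<tau> \<psi> x = z * \<psi> x" "bv \<psi> = 1"
    using weyl_solution_candidate[OF z0] by (auto simp: weyl_candidate_def \<psi>_def)
  note \<psi>sq = max_domD(1,2)[OF \<psi>(1)]
  define k where "k = krein_scalar a b p q r v1 v2 \<alpha> z"
  have k: "k = - complex_of_real (cot \<alpha>) - bv' \<psi>" by (simp add: k_def krein_scalar_def \<psi>_def)
  have s: "sin \<alpha> \<noteq> 0" using sin_gt_zero[of \<alpha>] \<alpha> by auto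
  have sc: "complex_of_real (sin \<alpha>) * complex_of_real (cot \<alpha>) = complex_of_real (cos \<alpha>)"
  proof -
    have "sin \<alpha> * cot \<alpha> = cos \<alpha>" using s by (simp add: cot_def)
    then show ?thesis by (metis of_real_mult)
  qed
  show k0: "krein_scalar a b p q r v1 v2 \<alpha> z \<noteq> 0"
  proof
    assume "krein_scalar a b p q r v1 v2 \<alpha> z = 0"
    then have "bv' \<psi> = - complex_of_real (cot \<alpha>)" using k by (simp add: k_def eq_neg_iff_add_eq_0 algebra_simps)
    then have "bc \<alpha> \<psi>" using sc by (simp add: bc_def \<psi>(3))
    then have "AE x in M. \<psi> x = 0"
      using resolvent_set_no_eigenfunction[OF z\<alpha>[unfolded T_bc_eq] linear_condition_bc \<psi>(1) _ \<psi>(2)] by blast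
    then have "bv \<psi> = 0" using bv_AE(1)[OF \<psi>(1) zero_max_dom(1)] bv_zero by simp
    then show False using \<psi>(3) by simp
  qed
  \<comment> \<open>the pairing with the Weyl solution reads off the second boundary value of the resolvent\<close>
  have pairing: "inner_product M (\<lambda>x. cnj (\<psi> x)) (\<lambda>x. \<tau> y x - z * y x) = bv' y"
    if y: "y \<in> \<D>" "bc 0 y" for y
  proof -
    note ysq = max_domD(1,2)[OF y(1)]
    have i1: "integrable M (\<lambda>x. \<psi> x * (\<tau> y x - z * y x))"
      by (intro integrable_cnj_mult(1) \<psi>sq sq_integrable_diff sq_integrable_scale ysq)
    have i2: "integrable M (lagrange \<psi> y)" by (rule wronskian_limits(1)[OF \<psi>(1) y(1)])
    have "inner_product M (\<lambda>x. cnj (\<psi> x)) (\<lambda>x. \<tau> y x - z * y x) = integral\<^sup>L M (\<lambda>x. \<psi> x * (\<tau> y x - z * y x))"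
      by (simp add: inner_product_def)
    also have "\<dots> = integral\<^sup>L M (\<lambda>x. - lagrange \<psi> y x)"
    proof (rule integral_cong_AE)
      show "AE x in M. \<psi> x * (\<tau> y x - z * y x) = - lagrange \<psi> y x"
        using \<psi>(2) by eventually_elim (simp add: lagrange_def algebra_simps)
    qed (use i1 i2 in auto)
    also have "\<dots> = W0 \<psi> y" using W0_integral[OF \<psi>(1) y(1)] by simp
    also have "\<dots> = bv' y" using y(2) by (simp add: W0_bv[OF \<psi>(1) y(1)] \<psi>(3) bc_def)
    finally show ?thesis .
  qed
  have step: "\<exists>v. (l2_class M (\<lambda>x. \<tau> y x - z * y x), v) \<in> ?R\<alpha> \<and>
      v = l2_add M (l2_class M y) (l2_scale M (inverse k) (l2_scale M
        (l2_inner M (l2_class M (weyl_solution a b p q r v2 (cnj z))) (l2_class M (\<lambda>x. \<tau> y x - z * y x))) (l2_class M \<psi>)))"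
    if y: "y \<in> \<D>" "bc 0 y" for y
  proof -
    note ysq = max_domD(1,2)[OF y(1)]
    have gsq: "sq_integrable M (\<lambda>x. \<tau> y x - z * y x)" by (intro sq_integrable_diff sq_integrable_scale ysq)
    have c: "l2_inner M (l2_class M (weyl_solution a b p q r v2 (cnj z))) (l2_class M (\<lambda>x. \<tau> y x - z * y x)) = bv' y"
      unfolding weyl_solution_cnj[OF z0] \<psi>_def[symmetric]
      using pairing[OF y] sq_integrable_cnj[OF \<psi>sq(1)] gsq by (simp add: l2_inner_class)
    define e where "e = inverse k * bv' y"
    define u where "u = (\<lambda>x. y x + e * \<psi> x)"
    note u = max_dom_lin[OF y(1) \<psi>(1), of e, folded u_def]
    have ub: "bv u = e" "bv' u = bv' y + e * bv' \<psi>"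
      using y(2) unfolding u_def bv_lin[OF y(1) \<psi>(1)] by (simp_all add: \<psi>(3) bc_def)
    have "bc \<alpha> u"
    proof -
      have ek: "e * k = bv' y" using k0 by (simp add: e_def k_def)
      have "complex_of_real (cos \<alpha>) * bv u + complex_of_real (sin \<alpha>) * bv' u =
          complex_of_real (sin \<alpha>) * (e * (complex_of_real (cot \<alpha>) + bv' \<psi>) + e * k)"
        unfolding ub ek sc[symmetric] by (simp add: algebra_simps)
      also have "\<dots> = 0" by (simp add: k algebra_simps)
      finally show ?thesis by (simp add: bc_def)
    qed
    moreover have "l2_class M (\<lambda>x. \<tau> y x - z * y x) = l2_class M (\<lambda>x. \<tau> u x - z * u x)"
      by (rule l2_class_cong, use u(2) \<psi>(2) in eventually_elim) (simp add: u_def algebra_simps)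
    ultimately have "(l2_class M (\<lambda>x. \<tau> y x - z * y x), l2_class M u) \<in> ?R\<alpha>"
      unfolding T_bc_eq resolvent_sl_restriction using u(1) by blast
    moreover have "l2_class M u = l2_add M (l2_class M y) (l2_scale M (inverse k) (l2_scale M (bv' y) (l2_class M \<psi>)))"
      using ysq \<psi>sq by (simp add: l2_scale_class sq_integrable_scale l2_add_class u_def e_def mult.assoc)
    ultimately show ?thesis unfolding c by blast
  qed
  have R0: "\<exists>y\<in>\<D>. bc 0 y \<and> h = l2_class M y \<and> g = l2_class M (\<lambda>x. \<tau> y x - z * y x)"
    if "(g, h) \<in> resolvent M (T_bc a b p q r v1 v2 0) z" for g h
    using that unfolding T_bc_eq resolvent_sl_restriction by blast
  show "?R\<alpha> = ?R"
  proof
    show "?R \<subseteq> ?R\<alpha>"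
    proof
      fix e assume "e \<in> ?R"
      then obtain g h where g: "(g, h) \<in> resolvent M (T_bc a b p q r v1 v2 0) z"
        and e: "e = (g, l2_add M h (l2_scale M (inverse k) (l2_scale M
          (l2_inner M (l2_class M (weyl_solution a b p q r v2 (cnj z))) g) (l2_class M \<psi>))))"
        unfolding op_add_def op_scale_def rank_one_def k_def \<psi>_def by blast
      obtain y where y: "y \<in> \<D>" "bc 0 y" "h = l2_class M y" "g = l2_class M (\<lambda>x. \<tau> y x - z * y x)"
        using R0[OF g] by blast
      show "e \<in> ?R\<alpha>" using step[OF y(1,2)] unfolding e y(3,4) by blast
    qed
    show "?R\<alpha> \<subseteq> ?R"
    proof
      fix e assume e: "e \<in> ?R\<alpha>"
      obtain g v where gv: "e = (g, v)" by (cases e)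
      have dom: "Domain (resolvent M (T_bc a b p q r v1 v2 0) z) = L2 M" "single_valued ?R\<alpha>"
        "Domain ?R\<alpha> = L2 M" using z0 z\<alpha> by (auto simp: resolvent_set_def)
      have gL: "g \<in> L2 M" using e gv dom(3) by blast
      then obtain h where g: "(g, h) \<in> resolvent M (T_bc a b p q r v1 v2 0) z" using dom(1) by blast
      obtain y where y: "y \<in> \<D>" "bc 0 y" "h = l2_class M y" "g = l2_class M (\<lambda>x. \<tau> y x - z * y x)"
        using R0[OF g] by blast
      obtain v' where v': "(g, v') \<in> ?R\<alpha>" "v' = l2_add M h (l2_scale M (inverse k) (l2_scale M
          (l2_inner M (l2_class M (weyl_solution a b p q r v2 (cnj z))) g) (l2_class M \<psi>)))"
        using step[OF y(1,2)] unfolding y(3,4) by blast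
      have "v = v'" using dom(2) e v'(1) unfolding gv by (rule single_valuedD)
      then show "e \<in> ?R"
        unfolding gv v'(2) op_add_def op_scale_def rank_one_def k_def \<psi>_def using g gL by blast
    qed
  qed
qed

end

theorem theorem3p2:
  fixes a b :: ereal and p q r :: "real \<Rightarrow> real" and v1 v2 :: "real \<Rightarrow> complex" and \<alpha> :: real
  assumes "a < b"
    and "sl_coefficients a b p q r"
    and "limit_circle_left a b p q r"
    and "limit_point_right a b p q r"
    and "boundary_pair a b p q r v1 v2"
    and "\<alpha> \<in> {0<..<pi}"
  shows "relatively_prime (sl_measure a b r) (T_min a b p q r)
           (T_bc a b p q r v1 v2 0) (T_bc a b p q r v1 v2 \<alpha>) \<and>
    (\<forall>z \<in> resolvent_set (sl_measure a b r) (T_bc a b p q r v1 v2 0) \<inter>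
           resolvent_set (sl_measure a b r) (T_bc a b p q r v1 v2 \<alpha>).
       krein_scalar a b p q r v1 v2 \<alpha> z \<noteq> 0 \<and>
       resolvent (sl_measure a b r) (T_bc a b p q r v1 v2 \<alpha>) z =
         op_add (sl_measure a b r)
           (resolvent (sl_measure a b r) (T_bc a b p q r v1 v2 0) z)
           (op_scale (sl_measure a b r) (inverse (krein_scalar a b p q r v1 v2 \<alpha> z))
             (rank_one (sl_measure a b r)
               (l2_class (sl_measure a b r) (weyl_solution a b p q r v2 (cnj z)))
               (l2_class (sl_measure a b r) (weyl_solution a b p q r v2 z)))))"
proof -
  interpret limit_point_problem a b p q r v1 v2
    by unfold_locales (use assms in auto)
  show ?thesis
    using relatively_prime_T_bc[OF assms(6)] krein_formula[OF assms(6)] by blast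
qed

end
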